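(* The algebra $\mathcal{A}_n$ is isomorphic to the algebra $\overline{\mathcal{B}}'(2n+1,n)$ (for every positive integer $n$).
   Context: Algebra $\mathcal{A}_n$. Let $[2n]=\{1,\dots,2n\}$. The algebra $A_n$ is generated over $\mathbb{Q}[u_1,\dots,u_{2n}]$ by monotone bijections $P:S_1\to S_2$ (if $i<j$ then $P(i)<P(j)$) between $n$-element subsets of $[2n]$. The product of $P_1:S_1\to S_2$ and $P_2:S_3\to S_4$ is $0$ if $S_2\ne S_3$, and otherwise $P_1P_2=\prod_iu_i^{\alpha_i}P$, where $P$ is the concatenation $P_2\circ P_1$ and $$\alpha_i=\#\{j:\ \max\{j,P_2(P_1(j))\}\le i<P_1(j)\ \text{ or }\ \min\{j,P_2(P_1(j))\}>i\ge P_1(j)\}.$$ Put $\iota_S=\mathrm{id}_S$; $\sum_S\iota_S=1$. If $i\in S$, $i+1\notin S$, let $r_i(S)=(S\cup\{i+1\})\setminus\{i\}$ and let $R_i^S:S\to r_i(S)$ be the monotone bijection; if $i+1\in S$, $i\notin S$, let $l_i(S)=(S\cup\{i\})\setminus\{i+1\}$ and let $L_i^S:S\to l_i(S)$ be the monotone bijection; set $R_i^S=0$, $L_i^S=0$ when $r_i(S)$, $l_i(S)$ are not defined. Let $R_i=\sum_SR_i^S$ and $L_i=\sum_SL_i^S$ for $1\le i\le2n-1$. $A_n$ is generated by the $\iota_S$, $R_i$ and $L_i$, and these satisfy: (R1) the $u_i$ commute with all $R_i$, $L_i$ and idempotents; (R2) $\iota_S\iota_S=\iota_S$; (R3) $\iota_S\iota_{S'}=0$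 for $S\ne S'$; (R4) if $r_i(S)$ (resp. $l_i(S)$) is not defined then $\iota_SR_i=0$ (resp. $\iota_SL_i=0$), and otherwise $\iota_SR_i=R_i\iota_{r_i(S)}=\iota_SR_i\iota_{r_i(S)}$ and $\iota_SL_i=L_i\iota_{l_i(S)}=\iota_SL_i\iota_{l_i(S)}$; (R5) for $i=1,\dots,2n-1$, $R_iL_i=\iota_iu_i$ and $L_iR_i=\iota_{i+1}u_i$, where $\iota_i=\sum_{S\ni i}\iota_S$. $\mathcal{A}_n$ is the quotient of $A_n$ by the ideal generated by $R_iR_{i-1}$ and $L_{i-1}L_i$ for $2\le i\le2n-1$. Algebra $\overline{\mathcal{B}}'(2n+1,n)$. This is the algebra used by Ozsváth and Szabó for the $DA$-bimodule in their algebraic construction of knot Floer homology, recalled here as follows. Given $m$ points $\{1,\dots,m\}\subset\mathbb{R}$, a local state $\mathbf{x}$ is a choice of $k$ of the intervals $[i,i+1]$, $1\le i\le m-1$; identifying each interval with its midpoint $i+1/2$, it is a $k$-element subset of $\{3/2,5/2,\dots,m-1/2\}$. If $\mathbf{x}\cap\{i-1/2,i+1/2\}=\{i-1/2\}$, put $r_i(\mathbf{x})=(\mathbf{x}\setminus\{i-1/2\})\cup\{i+1/2\}$; if $\mathbf{x}\cap\{i-1/2,i+1/2\}=\{i+1/2\}$, put $l_i(\mathbf{x})=(\mathbf{x}\setminus\{i+1/2\})\cup\{i-1/2\}$. $\mathcal{B}'(m,k)$ is the $\mathbb{Q}[u_1,\dots,u_m]$-algebra generated by idempotents $I_{\mathbf{x}}$,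 one for each local state $\mathbf{x}$, and elements $R'_i$, $L'_i$ for $2\le i\le m-1$, modulo: (B1) for each local state $\mathbf{x}$, $I_{\mathbf{x}}R'_i=R'_iI_{r_i(\mathbf{x})}=I_{\mathbf{x}}R'_iI_{r_i(\mathbf{x})}$ and $I_{\mathbf{x}}L'_i=L'_iI_{l_i(\mathbf{x})}=I_{\mathbf{x}}L'_iI_{l_i(\mathbf{x})}$, where $I_{\mathbf{x}}R'_i$ and $I_{\mathbf{x}}L'_i$ vanish if $r_i(\mathbf{x})$ and $l_i(\mathbf{x})$ are not defined, respectively; (B2) if $r_i(\mathbf{x})$ is defined then $I_{\mathbf{x}}R'_iL'_i=u_iI_{\mathbf{x}}$, and if $l_i(\mathbf{x})$ is defined then $I_{\mathbf{x}}L'_iR'_i=u_iI_{\mathbf{x}}$; (B3) $R'_iR'_{i+1}=0$ and $L'_{i+1}L'_i=0$ for every $i$; (B4) if $\{i-1/2,i+1/2\}\cap\mathbf{x}=\emptyset$, then $u_iI_{\mathbf{x}}=0$. $\overline{\mathcal{B}}'(2n+1,n)$ is the quotient of $\mathcal{B}'(2n+1,n)$ by the ideal generated by $u_1$.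
   Formalization: (R5), which fails for the free module on monotone bijections, is imposed on A_n; commutation of R'_i, L'_i with R'_j, L'_j for |i-j|>1 is added to (B1)-(B4); (B4) is taken only for 2≤i≤m-1. Without these the claim is inconsistent or false. *)

theory Defs
  imports Complex_Main "HOL-Algebra.QuotRing" "HOL-Library.Poly_Mapping"
begin

section \<open>Coefficients and quotients by relations\<close>

text \<open>Polynomials over the rationals in variables u 0, u 1, u 2, ...; the ring
  \<open>\<rat>[u\<^sub>1,\<dots>,u\<^sub>m]\<close> is the subset \<open>Upoly m\<close>.\<close>

type_synonym upoly = "(nat \<Rightarrow>\<^sub>0 nat) \<Rightarrow>\<^sub>0 rat"

definition uvar :: "nat \<Rightarrow> upoly" where
  "uvar i = Poly_Mapping.single (Poly_Mapping.single i 1) 1"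

definition Upoly :: "nat \<Rightarrow> upoly set" where
  "Upoly m = {p. \<forall>t \<in> Poly_Mapping.keys p. Poly_Mapping.keys t \<subseteq> {1..m}}"

text \<open>A relation \<open>a = b\<close> is given as the pair \<open>(a, b)\<close>; the ideals are two-sided.\<close>

definition rel_ideal :: "('a, 'b) ring_scheme \<Rightarrow> ('a \<times> 'a) set \<Rightarrow> 'a set" where
  "rel_ideal A rels = Idl\<^bsub>A\<^esub> {a \<ominus>\<^bsub>A\<^esub> b | a b. (a, b) \<in> rels}"

definition quot_by :: "('a, 'b) ring_scheme \<Rightarrow> ('a \<times> 'a) set \<Rightarrow> 'a set ring" where
  "quot_by A rels = A Quot (rel_ideal A rels)"

definition cls :: "('a, 'b) ring_scheme \<Rightarrow> ('a \<times> 'a) set \<Rightarrow> 'a \<Rightarrow> 'a set" where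
  "cls A rels a = rel_ideal A rels +>\<^bsub>A\<^esub> a"


section \<open>The algebra of monotone bijections\<close>

definition nsubsets :: "nat \<Rightarrow> nat set set" where
  "nsubsets n = {S. S \<subseteq> {1..2*n} \<and> card S = n}"

text \<open>A bijection \<open>P : S\<^sub>1 \<rightarrow> S\<^sub>2\<close> is a partial map with domain \<open>S\<^sub>1\<close> and range \<open>S\<^sub>2\<close>;
  injectivity follows from strict monotonicity.\<close>

definition mono_bij :: "nat \<Rightarrow> (nat \<rightharpoonup> nat) set" where
  "mono_bij n = {P. dom P \<in> nsubsets n \<and> ran P \<in> nsubsets n \<and>
     (\<forall>i \<in> dom P. \<forall>j \<in> dom P. i < j \<longrightarrow> the (P i) < the (P j))}"

definition alpha :: "(nat \<rightharpoonup> nat) \<Rightarrow> (nat \<rightharpoonup> nat) \<Rightarrow> nat \<Rightarrow> nat" where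
  "alpha P1 P2 i = card {j \<in> dom P1.
     let p = the (P1 j); q = the (P2 p) in
       (max j q \<le> i \<and> i < p) \<or> (min j q > i \<and> i \<ge> p)}"

type_synonym strand_elt = "(nat \<rightharpoonup> nat) \<Rightarrow> upoly"

definition strand_mult :: "nat \<Rightarrow> strand_elt \<Rightarrow> strand_elt \<Rightarrow> strand_elt" where
  "strand_mult n f g = (\<lambda>P. \<Sum>P1 \<in> mono_bij n. \<Sum>P2 \<in> mono_bij n.
     if ran P1 = dom P2 \<and> P2 \<circ>\<^sub>m P1 = P
     then (\<Prod>i = 1..2*n. uvar i ^ alpha P1 P2 i) * f P1 * g P2 else 0)"

definition basis :: "'a \<Rightarrow> 'a \<Rightarrow> upoly" where
  "basis x = (\<lambda>y. if y = x then 1 else 0)"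

definition smul :: "upoly \<Rightarrow> ('a \<Rightarrow> upoly) \<Rightarrow> 'a \<Rightarrow> upoly" where
  "smul c f = (\<lambda>x. c * f x)"

definition sum_fun :: "('b \<Rightarrow> 'a \<Rightarrow> upoly) \<Rightarrow> 'b set \<Rightarrow> 'a \<Rightarrow> upoly" where
  "sum_fun f X = (\<lambda>x. \<Sum>y \<in> X. f y x)"

definition id_bij :: "nat set \<Rightarrow> (nat \<rightharpoonup> nat)" where
  "id_bij S = Some |` S"

definition iota :: "nat set \<Rightarrow> strand_elt" where
  "iota S = basis (id_bij S)"

text \<open>The free \<open>\<rat>[u\<^sub>1,\<dots>,u\<^bsub>2n\<^esub>]\<close>-module on the monotone bijections with the
  given product.\<close>

definition strand_alg :: "nat \<Rightarrow> strand_elt ring" where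
  "strand_alg n =
     \<lparr>carrier = {f. (\<forall>P. f P \<in> Upoly (2*n)) \<and> (\<forall>P. P \<notin> mono_bij n \<longrightarrow> f P = 0)},
      mult = strand_mult n,
      one = sum_fun iota (nsubsets n),
      zero = (\<lambda>P. 0),
      add = (\<lambda>f g P. f P + g P)\<rparr>"

text \<open>The maps \<open>R\<^sub>i\<^sup>S\<close> and \<open>L\<^sub>i\<^sup>S\<close> fix all of \<open>S\<close> except the point that is moved.\<close>

definition Rgen :: "nat \<Rightarrow> nat \<Rightarrow> strand_elt" where
  "Rgen n i = sum_fun (\<lambda>S. basis ((id_bij S)(i \<mapsto> i + 1)))
                {S \<in> nsubsets n. i \<in> S \<and> i + 1 \<notin> S}"

definition Lgen :: "nat \<Rightarrow> nat \<Rightarrow> strand_elt" where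
  "Lgen n i = sum_fun (\<lambda>S. basis ((id_bij S)(i + 1 \<mapsto> i)))
                {S \<in> nsubsets n. i + 1 \<in> S \<and> i \<notin> S}"

definition iota_at :: "nat \<Rightarrow> nat \<Rightarrow> strand_elt" where
  "iota_at n i = sum_fun iota {S \<in> nsubsets n. i \<in> S}"

text \<open>The relations \<open>R\<^sub>i L\<^sub>i = \<iota>\<^sub>i u\<^sub>i\<close> and \<open>L\<^sub>i R\<^sub>i = \<iota>\<^bsub>i+1\<^esub> u\<^sub>i\<close> do not follow from the
  product: when \<open>i, i+1 \<in> S\<close> the elements \<open>\<iota>\<^sub>S R\<^sub>i\<close> and \<open>\<iota>\<^sub>S L\<^sub>i\<close> vanish, so that
  the relations say \<open>u\<^sub>i \<iota>\<^sub>S = 0\<close>, which is false in the free module.  They are therefore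
  imposed; their other components already hold in \<open>strand_alg n\<close>.\<close>

definition A_rels :: "nat \<Rightarrow> (strand_elt \<times> strand_elt) set" where
  "A_rels n =
     {(Rgen n i \<otimes>\<^bsub>strand_alg n\<^esub> Lgen n i, smul (uvar i) (iota_at n i)) | i. i \<in> {1..2*n-1}} \<union>
     {(Lgen n i \<otimes>\<^bsub>strand_alg n\<^esub> Rgen n i, smul (uvar i) (iota_at n (i + 1))) | i. i \<in> {1..2*n-1}}"

definition A_alg :: "nat \<Rightarrow> strand_elt set ring" where
  "A_alg n = quot_by (strand_alg n) (A_rels n)"

definition A_cls :: "nat \<Rightarrow> strand_elt \<Rightarrow> strand_elt set" where
  "A_cls n = cls (strand_alg n) (A_rels n)"

definition calA_rels :: "nat \<Rightarrow> (strand_elt set \<times> strand_elt set) set" where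
  "calA_rels n =
     {(A_cls n (Rgen n i) \<otimes>\<^bsub>A_alg n\<^esub> A_cls n (Rgen n (i - 1)), \<zero>\<^bsub>A_alg n\<^esub>) | i. i \<in> {2..2*n-1}} \<union>
     {(A_cls n (Lgen n (i - 1)) \<otimes>\<^bsub>A_alg n\<^esub> A_cls n (Lgen n i), \<zero>\<^bsub>A_alg n\<^esub>) | i. i \<in> {2..2*n-1}}"

definition calA :: "nat \<Rightarrow> strand_elt set set ring" where
  "calA n = quot_by (A_alg n) (calA_rels n)"

definition calA_scalar :: "nat \<Rightarrow> upoly \<Rightarrow> strand_elt set set" where
  "calA_scalar n c = cls (A_alg n) (calA_rels n) (A_cls n (smul c \<one>\<^bsub>strand_alg n\<^esub>))"


section \<open>The Ozsvath-Szabo algebra\<close>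

text \<open>The free associative unital \<open>\<rat>[u\<^sub>1,\<dots>,u\<^sub>m]\<close>-algebra on a set of generators:
  finitely supported functions on words, multiplied by splitting words.\<close>

definition free_alg :: "nat \<Rightarrow> 'g set \<Rightarrow> ('g list \<Rightarrow> upoly) ring" where
  "free_alg m G =
     \<lparr>carrier = {f. finite {w. f w \<noteq> 0} \<and> (\<forall>w. f w \<in> Upoly m) \<and>
                    (\<forall>w. f w \<noteq> 0 \<longrightarrow> set w \<subseteq> G)},
      mult = (\<lambda>f g w. \<Sum>k \<le> length w. f (take k w) * g (drop k w)),
      one = basis [],
      zero = (\<lambda>w. 0),
      add = (\<lambda>f g w. f w + g w)\<rparr>"

text \<open>The interval \<open>[j, j+1]\<close>, with midpoint \<open>j + 1/2\<close>, is represented by its left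
  endpoint \<open>j\<close>.  So \<open>i - 1/2\<close> becomes \<open>i - 1\<close> and \<open>i + 1/2\<close> becomes \<open>i\<close>.\<close>

definition local_states :: "nat \<Rightarrow> nat \<Rightarrow> nat set set" where
  "local_states m k = {x. x \<subseteq> {1..m-1} \<and> card x = k}"

definition r_defined :: "nat \<Rightarrow> nat set \<Rightarrow> bool" where
  "r_defined i x \<longleftrightarrow> x \<inter> {i - 1, i} = {i - 1}"

definition l_defined :: "nat \<Rightarrow> nat set \<Rightarrow> bool" where
  "l_defined i x \<longleftrightarrow> x \<inter> {i - 1, i} = {i}"

definition r_move :: "nat \<Rightarrow> nat set \<Rightarrow> nat set" where
  "r_move i x = insert i (x - {i - 1})"

definition l_move :: "nat \<Rightarrow> nat set \<Rightarrow> nat set" where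
  "l_move i x = insert (i - 1) (x - {i})"

datatype gen = GI "nat set" | GR nat | GL nat

definition gens :: "nat \<Rightarrow> nat \<Rightarrow> gen set" where
  "gens m k = GI ` local_states m k \<union> GR ` {2..m-1} \<union> GL ` {2..m-1}"

abbreviation wd :: "gen list \<Rightarrow> gen list \<Rightarrow> upoly" where
  "wd w \<equiv> basis w"

abbreviation zer :: "gen list \<Rightarrow> upoly" where
  "zer \<equiv> (\<lambda>w. 0)"

text \<open>Every index \<open>i\<close> runs over \<open>{2..m-1}\<close>, where both \<open>i - 1/2\<close> and \<open>i + 1/2\<close> are
  midpoints of intervals; in particular this is the range of \<open>B4\<close>.  With \<open>i = m\<close> admitted
  in \<open>B4\<close>, the image of \<open>u\<^bsub>2n\<^esub>\<close> would annihilate idempotents, whereas no relation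
  of the strand algebra restricts \<open>u\<^bsub>2n\<^esub>\<close>; the case \<open>i = 1\<close> is void modulo \<open>u\<^sub>1\<close>.

  The relations \<open>idem\<close> and \<open>unit\<close> say that the \<open>GI x\<close> are orthogonal idempotents
  with sum 1.  The relations \<open>comm\<close> say that moves at distant points commute; they hold in
  the algebra of Ozsvath and Szabo, and for monotone bijections, but are not consequences
  of \<open>B1\<close> to \<open>B4\<close>.\<close>

inductive_set B_rels ::
    "nat \<Rightarrow> nat \<Rightarrow> ((gen list \<Rightarrow> upoly) \<times> (gen list \<Rightarrow> upoly)) set"
  for m k :: nat
where
  idem: "\<lbrakk>x \<in> local_states m k; y \<in> local_states m k\<rbrakk> \<Longrightarrow>
    (wd [GI x, GI y], if x = y then wd [GI x] else zer) \<in> B_rels m k"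
| unit: "(sum_fun (\<lambda>x. wd [GI x]) (local_states m k), wd []) \<in> B_rels m k"
| B1_R: "\<lbrakk>x \<in> local_states m k; i \<in> {2..m-1}; r_defined i x\<rbrakk> \<Longrightarrow>
    (wd [GI x, GR i], wd [GR i, GI (r_move i x)]) \<in> B_rels m k"
| B1_R': "\<lbrakk>x \<in> local_states m k; i \<in> {2..m-1}; r_defined i x\<rbrakk> \<Longrightarrow>
    (wd [GI x, GR i], wd [GI x, GR i, GI (r_move i x)]) \<in> B_rels m k"
| B1_R0: "\<lbrakk>x \<in> local_states m k; i \<in> {2..m-1}; \<not> r_defined i x\<rbrakk> \<Longrightarrow>
    (wd [GI x, GR i], zer) \<in> B_rels m k"
| B1_L: "\<lbrakk>x \<in> local_states m k; i \<in> {2..m-1}; l_defined i x\<rbrakk> \<Longrightarrow>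
    (wd [GI x, GL i], wd [GL i, GI (l_move i x)]) \<in> B_rels m k"
| B1_L': "\<lbrakk>x \<in> local_states m k; i \<in> {2..m-1}; l_defined i x\<rbrakk> \<Longrightarrow>
    (wd [GI x, GL i], wd [GI x, GL i, GI (l_move i x)]) \<in> B_rels m k"
| B1_L0: "\<lbrakk>x \<in> local_states m k; i \<in> {2..m-1}; \<not> l_defined i x\<rbrakk> \<Longrightarrow>
    (wd [GI x, GL i], zer) \<in> B_rels m k"
| B2_R: "\<lbrakk>x \<in> local_states m k; i \<in> {2..m-1}; r_defined i x\<rbrakk> \<Longrightarrow>
    (wd [GI x, GR i, GL i], smul (uvar i) (wd [GI x])) \<in> B_rels m k"
| B2_L: "\<lbrakk>x \<in> local_states m k; i \<in> {2..m-1}; l_defined i x\<rbrakk> \<Longrightarrow>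
    (wd [GI x, GL i, GR i], smul (uvar i) (wd [GI x])) \<in> B_rels m k"
| B3_R: "\<lbrakk>i \<in> {2..m-1}; i + 1 \<in> {2..m-1}\<rbrakk> \<Longrightarrow> (wd [GR i, GR (i + 1)], zer) \<in> B_rels m k"
| B3_L: "\<lbrakk>i \<in> {2..m-1}; i + 1 \<in> {2..m-1}\<rbrakk> \<Longrightarrow> (wd [GL (i + 1), GL i], zer) \<in> B_rels m k"
| B4: "\<lbrakk>x \<in> local_states m k; i \<in> {2..m-1}; {i - 1, i} \<inter> x = {}\<rbrakk> \<Longrightarrow>
    (smul (uvar i) (wd [GI x]), zer) \<in> B_rels m k"
| comm_RR: "\<lbrakk>i \<in> {2..m-1}; j \<in> {2..m-1}; i + 1 < j\<rbrakk> \<Longrightarrow>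
    (wd [GR i, GR j], wd [GR j, GR i]) \<in> B_rels m k"
| comm_LL: "\<lbrakk>i \<in> {2..m-1}; j \<in> {2..m-1}; i + 1 < j\<rbrakk> \<Longrightarrow>
    (wd [GL i, GL j], wd [GL j, GL i]) \<in> B_rels m k"
| comm_RL: "\<lbrakk>i \<in> {2..m-1}; j \<in> {2..m-1}; i + 1 < j \<or> j + 1 < i\<rbrakk> \<Longrightarrow>
    (wd [GR i, GL j], wd [GL j, GR i]) \<in> B_rels m k"

definition B_alg :: "nat \<Rightarrow> nat \<Rightarrow> (gen list \<Rightarrow> upoly) set ring" where
  "B_alg m k = quot_by (free_alg m (gens m k)) (B_rels m k)"

definition B_scalar :: "nat \<Rightarrow> nat \<Rightarrow> upoly \<Rightarrow> (gen list \<Rightarrow> upoly) set" where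
  "B_scalar m k c = cls (free_alg m (gens m k)) (B_rels m k) (smul c \<one>\<^bsub>free_alg m (gens m k)\<^esub>)"

definition Bbar_rels ::
    "nat \<Rightarrow> nat \<Rightarrow> ((gen list \<Rightarrow> upoly) set \<times> (gen list \<Rightarrow> upoly) set) set" where
  "Bbar_rels m k = {(B_scalar m k (uvar 1), \<zero>\<^bsub>B_alg m k\<^esub>)}"

definition Bbar :: "nat \<Rightarrow> nat \<Rightarrow> (gen list \<Rightarrow> upoly) set set ring" where
  "Bbar m k = quot_by (B_alg m k) (Bbar_rels m k)"

definition Bbar_scalar :: "nat \<Rightarrow> nat \<Rightarrow> upoly \<Rightarrow> (gen list \<Rightarrow> upoly) set set" where
  "Bbar_scalar m k c = cls (B_alg m k) (Bbar_rels m k) (B_scalar m k c)"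

end

theory Submission
  imports Defs "HOL-Algebra.Multiplicative_Group"
begin

text \<open>
  Read an \<open>n\<close>-element set \<open>S \<subseteq> {1..2n}\<close> as \<open>n\<close> particles on \<open>2n\<close> sites.  Its complement, the set of
  holes, is again an \<open>n\<close>-element set and is taken as the local state that belongs to \<open>S\<close>.  The
  element \<open>R\<^sub>i\<close> moves a particle from \<open>i\<close> to \<open>i + 1\<close>, hence a hole from \<open>i + 1\<close> to \<open>i\<close>, and so
  corresponds to \<open>L'\<close> with index \<open>i + 1\<close>; likewise \<open>L\<^sub>i\<close> corresponds to \<open>R'\<close> with index \<open>i + 1\<close>, and
  \<open>u\<^sub>i\<close> to the variable with index \<open>i + 1\<close>.  Under this dictionary the relations agree:
  \<open>R\<^sub>i R\<^bsub>i-1\<^esub> = 0\<close> and \<open>L\<^bsub>i-1\<^esub> L\<^sub>i = 0\<close> become \<open>B3\<close>, and the relation \<open>R\<^sub>i L\<^sub>i = \<iota>\<^sub>i u\<^sub>i\<close> at a set \<open>S\<close> with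
  \<open>i, i + 1 \<in> S\<close>, where \<open>\<iota>\<^sub>S R\<^sub>i = 0\<close>, becomes \<open>B4\<close>.  The variable \<open>u\<^sub>1\<close> of the second algebra has
  no partner and is set to zero.

  The difficulty is that the strand algebra is given by a basis and structure constants, while the
  other algebra is given by generators and relations.  The bridge is a mapping property of the strand
  algebra, theorem \<open>rep_hom\<close>: it maps to every algebra that contains orthogonal idempotents \<open>J S\<close>
  with sum 1 and elements \<open>G i\<close> which make a particle hop across the gap between \<open>i\<close> and \<open>i + 1\<close>,
  provided that hopping back and forth gives \<open>u\<^sub>i\<close> and that hops across distant gaps commute.
  Particles cannot overtake, so a monotone bijection \<open>S \<rightarrow> T\<close> is determined by \<open>S\<close> and \<open>T\<close>.
  Describe \<open>S\<close> by its height function, which counts the particles at sites up to \<open>i\<close>.  A hop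
  across gap \<open>i\<close> changes the height at \<open>i\<close> by one, and the exponent of \<open>u\<^sub>i\<close> in the product of
  \<open>S \<rightarrow> T\<close> and \<open>T \<rightarrow> V\<close> is half the excess of the length of the path of heights at \<open>i\<close> over the
  distance of its ends (\<open>alpha_eq_wexp\<close>, \<open>hdist_wexp\<close>).  If two different hops both lead from \<open>T\<close>
  towards \<open>S\<close>, their gaps are not adjacent (\<open>closer_far\<close>), so the two hops commute and can be
  completed to a square.  By induction on the distance all shortest paths of hops from \<open>S\<close> to \<open>T\<close>
  have the same product \<open>E S T\<close> (\<open>geo_unique\<close>).  One more hop either prolongs a shortest path or
  undoes its last step at the cost of \<open>u\<^sub>i\<close>, and this is the multiplication rule of the strand
  algebra (\<open>E_G\<close>, \<open>E_mult\<close>).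

  In the opposite direction the universal property of the free algebra is available (\<open>free_lift\<close>),
  and the relations are checked one at a time in the strand algebra (\<open>h_rels\<close>).  The two
  homomorphisms are mutually inverse because both composites fix generators and scalars.
\<close>

section \<open>Polynomial coefficients\<close>

definition subst :: "(nat \<Rightarrow> upoly) \<Rightarrow> upoly \<Rightarrow> upoly" where
  "subst \<phi> p = (\<Sum>t \<in> Poly_Mapping.keys p. Poly_Mapping.single 0 (Poly_Mapping.lookup p t) *
     (\<Prod>i \<in> Poly_Mapping.keys t. \<phi> i ^ Poly_Mapping.lookup t i))"

lemma upoly_sum_singles:
  fixes p :: "'a \<Rightarrow>\<^sub>0 'b::comm_monoid_add"
  shows "p = (\<Sum>t \<in> Poly_Mapping.keys p. Poly_Mapping.single t (Poly_Mapping.lookup p t))"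
proof (rule poly_mapping_eqI)
  fix k
  have "Poly_Mapping.lookup (\<Sum>t \<in> Poly_Mapping.keys p. Poly_Mapping.single t (Poly_Mapping.lookup p t)) k
      = (\<Sum>t \<in> Poly_Mapping.keys p. if t = k then Poly_Mapping.lookup p t else 0)"
    unfolding lookup_sum lookup_single when_def ..
  also have "\<dots> = Poly_Mapping.lookup p k"
    by (subst sum.delta) (auto simp: not_in_keys_iff_lookup_eq_zero)
  finally show "Poly_Mapping.lookup p k =
      Poly_Mapping.lookup (\<Sum>t \<in> Poly_Mapping.keys p. Poly_Mapping.single t (Poly_Mapping.lookup p t)) k" ..
qed

lemma subst_superset:
  assumes "finite K" "Poly_Mapping.keys p \<subseteq> K"
  shows "subst \<phi> p = (\<Sum>t \<in> K. Poly_Mapping.single 0 (Poly_Mapping.lookup p t) *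
     (\<Prod>i \<in> Poly_Mapping.keys t. \<phi> i ^ Poly_Mapping.lookup t i))"
  unfolding subst_def using assms
  by (intro sum.mono_neutral_left) (auto simp: in_keys_iff)

lemma subst_add: "subst \<phi> (p + q) = subst \<phi> p + subst \<phi> q"
proof -
  let ?K = "Poly_Mapping.keys p \<union> Poly_Mapping.keys q"
  show ?thesis
    using keys_add[of p q]
    by (simp add: subst_superset[of ?K] lookup_add single_add distrib_right sum.distrib)
qed

lemma subst_zero: "subst \<phi> 0 = 0"
  by (simp add: subst_def)

lemma subst_sum: "subst \<phi> (\<Sum>x\<in>A. f x) = (\<Sum>x\<in>A. subst \<phi> (f x))"
  by (induction A rule: infinite_finite_induct) (auto simp: subst_zero subst_add)

lemma subst_single:
  "subst \<phi> (Poly_Mapping.single t c) = Poly_Mapping.single 0 c *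
     (\<Prod>i \<in> Poly_Mapping.keys t. \<phi> i ^ Poly_Mapping.lookup t i)"
  by (auto simp: subst_def)

lemma monomial_value_superset:
  fixes \<phi> :: "nat \<Rightarrow> upoly" and t :: "nat \<Rightarrow>\<^sub>0 nat"
  assumes "finite K" "Poly_Mapping.keys t \<subseteq> K"
  shows "(\<Prod>i \<in> Poly_Mapping.keys t. \<phi> i ^ Poly_Mapping.lookup t i) =
    (\<Prod>i \<in> K. \<phi> i ^ Poly_Mapping.lookup t i)"
  using assms by (intro prod.mono_neutral_left) (auto simp: in_keys_iff)

lemma monomial_value_add:
  fixes \<phi> :: "nat \<Rightarrow> upoly" and s t :: "nat \<Rightarrow>\<^sub>0 nat"
  shows "(\<Prod>i \<in> Poly_Mapping.keys (s + t). \<phi> i ^ Poly_Mapping.lookup (s + t) i) =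
    (\<Prod>i \<in> Poly_Mapping.keys s. \<phi> i ^ Poly_Mapping.lookup s i) *
    (\<Prod>i \<in> Poly_Mapping.keys t. \<phi> i ^ Poly_Mapping.lookup t i)"
proof -
  let ?K = "Poly_Mapping.keys s \<union> Poly_Mapping.keys t"
  show ?thesis
    using monomial_value_superset[of ?K "s + t" \<phi>] monomial_value_superset[of ?K s \<phi>]
      monomial_value_superset[of ?K t \<phi>] keys_add[of s t]
    by (simp add: lookup_add power_add prod.distrib)
qed

lemma subst_mult: "subst \<phi> (p * q) = subst \<phi> p * subst \<phi> q"
proof -
  let ?s = "\<lambda>p t. Poly_Mapping.single t (Poly_Mapping.lookup p t)"
  have const_mult: "Poly_Mapping.single 0 (c * d) = Poly_Mapping.single 0 c * Poly_Mapping.single 0 d"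
    for c d :: rat
    by (simp add: mult_single)
  have single: "subst \<phi> (?s p a * ?s q b) = subst \<phi> (?s p a) * subst \<phi> (?s q b)" for a b
    by (simp only: mult_single subst_single monomial_value_add) (simp only: const_mult mult_ac)
  have "p * q = (\<Sum>a\<in>Poly_Mapping.keys p. \<Sum>b\<in>Poly_Mapping.keys q. ?s p a * ?s q b)"
    by (simp only: sum_product[symmetric] upoly_sum_singles[symmetric])
  then have "subst \<phi> (p * q) =
      (\<Sum>a\<in>Poly_Mapping.keys p. \<Sum>b\<in>Poly_Mapping.keys q. subst \<phi> (?s p a) * subst \<phi> (?s q b))"
    by (simp add: subst_sum single)
  also have "\<dots> = subst \<phi> (\<Sum>a\<in>Poly_Mapping.keys p. ?s p a) * subst \<phi> (\<Sum>b\<in>Poly_Mapping.keys q. ?s q b)"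
    by (simp add: subst_sum sum_product)
  finally show ?thesis by (simp flip: upoly_sum_singles)
qed

lemma subst_const: "subst \<phi> (Poly_Mapping.single 0 c) = Poly_Mapping.single 0 c"
  by (simp add: subst_single)

lemma subst_one: "subst \<phi> 1 = 1"
  using subst_const[of \<phi> 1] by simp

lemma subst_uvar: "subst \<phi> (uvar i) = \<phi> i"
  by (simp add: uvar_def subst_single)

lemma Upoly_zero [simp]: "0 \<in> Upoly m"
  and Upoly_const [simp]: "Poly_Mapping.single 0 c \<in> Upoly m"
  and Upoly_one [simp]: "1 \<in> Upoly m"
  and Upoly_uvar: "i \<in> {1..m} \<Longrightarrow> uvar i \<in> Upoly m"
  by (auto simp: Upoly_def uvar_def)

lemma Upoly_add [intro]: "p \<in> Upoly m \<Longrightarrow> q \<in> Upoly m \<Longrightarrow> p + q \<in> Upoly m"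
  using keys_add[of p q] by (auto simp: Upoly_def)

lemma Upoly_mult [intro]: "p \<in> Upoly m \<Longrightarrow> q \<in> Upoly m \<Longrightarrow> p * q \<in> Upoly m"
proof -
  assume pq: "p \<in> Upoly m" "q \<in> Upoly m"
  have "Poly_Mapping.keys t \<subseteq> {1..m}" if t: "t \<in> Poly_Mapping.keys (p * q)" for t
  proof -
    obtain a b where "t = a + b" "a \<in> Poly_Mapping.keys p" "b \<in> Poly_Mapping.keys q"
      using t keys_mult[of p q] by auto
    then show ?thesis
      using pq Poly_Mapping.keys_add[of a b] unfolding Upoly_def by blast
  qed
  then show ?thesis by (simp add: Upoly_def)
qed

lemma Upoly_uminus [intro]: "p \<in> Upoly m \<Longrightarrow> - p \<in> Upoly m"
  using Upoly_mult[OF Upoly_const[of "- 1"]] by (simp add: single_uminus)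

lemma Upoly_prod: "(\<And>x. x \<in> A \<Longrightarrow> f x \<in> Upoly m) \<Longrightarrow> (\<Prod>x\<in>A. f x) \<in> Upoly m"
  by (induction A rule: infinite_finite_induct) auto

lemma Upoly_power: "p \<in> Upoly m \<Longrightarrow> p ^ k \<in> Upoly m"
  by (induction k) auto

lemma monomial_eq_prod_uvar:
  "(\<Prod>i \<in> Poly_Mapping.keys t. uvar i ^ Poly_Mapping.lookup t i) = Poly_Mapping.single t 1"
proof -
  have pow: "uvar i ^ k = Poly_Mapping.single (Poly_Mapping.single i k) 1" for i k
    by (induction k) (auto simp: uvar_def mult_single simp flip: single_add)
  have prod: "(\<Prod>i\<in>A. Poly_Mapping.single (g i) (1::rat)) = Poly_Mapping.single (\<Sum>i\<in>A. g i) 1"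
    for A and g :: "nat \<Rightarrow> (nat \<Rightarrow>\<^sub>0 nat)"
    by (induction A rule: infinite_finite_induct) (auto simp: mult_single)
  show ?thesis by (simp add: pow prod flip: upoly_sum_singles)
qed

text \<open>Homomorphisms out of the coefficient ring are compared with this rule: constants and variables
  suffice.\<close>

lemma Upoly_induct [consumes 1, case_names const uvar add mult]:
  assumes "p \<in> Upoly m"
    and const: "\<And>c. P (Poly_Mapping.single 0 c)"
    and uvar: "\<And>i. i \<in> {1..m} \<Longrightarrow> P (uvar i)"
    and add: "\<And>p q. p \<in> Upoly m \<Longrightarrow> q \<in> Upoly m \<Longrightarrow> P p \<Longrightarrow> P q \<Longrightarrow> P (p + q)"
    and mult: "\<And>p q. p \<in> Upoly m \<Longrightarrow> q \<in> Upoly m \<Longrightarrow> P p \<Longrightarrow> P q \<Longrightarrow> P (p * q)"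
  shows "P p"
proof -
  define C where "C = {p \<in> Upoly m. P p}"
  have C: "Poly_Mapping.single 0 c \<in> C" "0 \<in> C" "1 \<in> C" for c
    using const[of c] const[of 0] const[of 1] by (auto simp: C_def)
  have C2: "p \<in> C \<Longrightarrow> q \<in> C \<Longrightarrow> p + q \<in> C" "p \<in> C \<Longrightarrow> q \<in> C \<Longrightarrow> p * q \<in> C" for p q
    by (auto simp: C_def add mult)
  have pow: "p \<in> C \<Longrightarrow> p ^ k \<in> C" for p k
    by (induction k) (auto simp: C C2)
  have sum: "(\<And>x. x \<in> A \<Longrightarrow> f x \<in> C) \<Longrightarrow> (\<Sum>x\<in>A. f x) \<in> C" for A and f :: "(nat \<Rightarrow>\<^sub>0 nat) \<Rightarrow> upoly"
    by (induction A rule: infinite_finite_induct) (auto simp: C C2)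
  have prod: "(\<And>x. x \<in> A \<Longrightarrow> f x \<in> C) \<Longrightarrow> (\<Prod>x\<in>A. f x) \<in> C" for A and f :: "nat \<Rightarrow> upoly"
    by (induction A rule: infinite_finite_induct) (auto simp: C C2)
  have "Poly_Mapping.single t c \<in> C" if t: "Poly_Mapping.keys t \<subseteq> {1..m}" for t c
  proof -
    have "Poly_Mapping.single t c = Poly_Mapping.single 0 c * Poly_Mapping.single t 1"
      by (simp add: mult_single)
    moreover have "uvar i \<in> C" if "i \<in> Poly_Mapping.keys t" for i
      using t that by (auto simp: C_def uvar Upoly_uvar)
    ultimately show ?thesis
      by (auto intro!: C C2 prod pow simp flip: monomial_eq_prod_uvar)
  qed
  then have "(\<Sum>t \<in> Poly_Mapping.keys p. Poly_Mapping.single t (Poly_Mapping.lookup p t)) \<in> C"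
    using assms(1) by (intro sum) (auto simp: Upoly_def)
  then show ?thesis by (simp add: C_def flip: upoly_sum_singles)
qed

lemma subst_Upoly:
  assumes "\<And>i. i \<in> {1..m} \<Longrightarrow> \<phi> i \<in> Upoly m'" and "p \<in> Upoly m"
  shows "subst \<phi> p \<in> Upoly m'"
  using assms(2)
  by (induction rule: Upoly_induct) (auto simp: subst_const subst_uvar subst_add subst_mult assms(1))

definition coeff_ring :: "nat \<Rightarrow> upoly ring" where
  "coeff_ring m = \<lparr>carrier = Upoly m, mult = (*), one = 1, zero = 0, add = (+)\<rparr>"

lemma coeff_ring_simps [simp]:
  "carrier (coeff_ring m) = Upoly m" "a \<otimes>\<^bsub>coeff_ring m\<^esub> b = a * b" "\<one>\<^bsub>coeff_ring m\<^esub> = 1"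
  "\<zero>\<^bsub>coeff_ring m\<^esub> = 0" "a \<oplus>\<^bsub>coeff_ring m\<^esub> b = a + b"
  by (simp_all add: coeff_ring_def)

lemma subst_ring_hom:
  assumes "\<And>i. i \<in> {1..m} \<Longrightarrow> \<phi> i \<in> Upoly m'"
  shows "subst \<phi> \<in> ring_hom (coeff_ring m) (coeff_ring m')"
  using subst_Upoly[of m \<phi> m'] assms
  by (auto simp: ring_hom_def subst_add subst_mult subst_one)

lemma ring_coeff_ring: "ring (coeff_ring m)"
proof (rule ringI)
  show "abelian_group (coeff_ring m)"
  proof (rule abelian_groupI)
    fix x assume "x \<in> carrier (coeff_ring m)"
    then show "\<exists>y\<in>carrier (coeff_ring m). y \<oplus>\<^bsub>coeff_ring m\<^esub> x = \<zero>\<^bsub>coeff_ring m\<^esub>"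
      by (auto intro!: bexI[of _ "- x"])
  qed (auto simp: add_ac)
  show "Group.monoid (coeff_ring m)"
    by (rule monoidI) (auto simp: mult_ac)
qed (auto simp: algebra_simps)

lemma coeff_hom_eqI:
  assumes "f \<in> ring_hom (coeff_ring m) B" "g \<in> ring_hom (coeff_ring m) B"
    and "\<And>c. f (Poly_Mapping.single 0 c) = g (Poly_Mapping.single 0 c)"
    and "\<And>i. i \<in> {1..m} \<Longrightarrow> f (uvar i) = g (uvar i)" and "p \<in> Upoly m"
  shows "f p = g p"
  using assms(5)
proof (induction rule: Upoly_induct)
  case (add p q)
  then show ?case
    using ring_hom_add[OF assms(1)] ring_hom_add[OF assms(2)] by simp
next
  case (mult p q)
  then show ?case
    using ring_hom_mult[OF assms(1)] ring_hom_mult[OF assms(2)] by simp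
qed (use assms in auto)

section \<open>Quotients by relations\<close>

context
  fixes A :: "('a, 'b) ring_scheme" and rels :: "('a \<times> 'a) set"
  assumes ringA: "ring A" and rels: "rels \<subseteq> carrier A \<times> carrier A"
begin

interpretation ring A by (fact ringA)

lemma rel_ideal_ideal: "ideal (rel_ideal A rels) A"
  unfolding rel_ideal_def using rels by (intro genideal_ideal) auto

lemma ring_quot_by: "ring (quot_by A rels)"
  unfolding quot_by_def by (rule ideal.quotient_is_ring[OF rel_ideal_ideal])

lemma cls_hom: "cls A rels \<in> ring_hom A (quot_by A rels)"
proof -
  have "cls A rels = (+>\<^bsub>A\<^esub>) (rel_ideal A rels)"
    by (auto simp: cls_def)
  then show ?thesis
    unfolding quot_by_def using ideal.rcos_ring_hom[OF rel_ideal_ideal] by simp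
qed

lemma cls_surj: "x \<in> carrier (quot_by A rels) \<Longrightarrow> \<exists>a \<in> carrier A. x = cls A rels a"
  by (auto simp: quot_by_def FactRing_simps cls_def)

lemma cls_eqI:
  assumes "(a, b) \<in> rels"
  shows "cls A rels a = cls A rels b"
proof -
  have ab: "a \<in> carrier A" "b \<in> carrier A" using assms rels by auto
  have "a \<ominus>\<^bsub>A\<^esub> b \<in> rel_ideal A rels"
    unfolding rel_ideal_def using rels assms by (intro subsetD[OF genideal_self]) auto
  then show ?thesis
    unfolding cls_def using quotient_eq_iff_same_a_r_cos[OF rel_ideal_ideal ab] by blast
qed

text \<open>The kernel of \<open>f\<close> is an ideal that contains the generators \<open>a - b\<close> of the ideal of relations,
  so \<open>f\<close> is constant on its cosets.\<close>

lemma quot_by_factor: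
  assumes B: "ring B" and f: "f \<in> ring_hom A B" and eq: "\<And>a b. (a, b) \<in> rels \<Longrightarrow> f a = f b"
  obtains g where "g \<in> ring_hom (quot_by A rels) B" "\<And>a. a \<in> carrier A \<Longrightarrow> g (cls A rels a) = f a"
proof -
  interpret f: ring_hom_ring A B f by (rule ring_hom_ringI2[OF ringA B f])
  have diff: "f (a \<ominus>\<^bsub>A\<^esub> b) = \<zero>\<^bsub>B\<^esub> \<longleftrightarrow> f a = f b" if "a \<in> carrier A" "b \<in> carrier A" for a b
  proof -
    have "f (a \<ominus>\<^bsub>A\<^esub> b) = f a \<ominus>\<^bsub>B\<^esub> f b"
      using that by (simp add: a_minus_def)
    then show ?thesis
      using ring.r_right_minus_eq[OF B, of "f a" "f b"] that by simp
  qed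
  have "a \<ominus>\<^bsub>A\<^esub> b \<in> a_kernel A B f" if "(a, b) \<in> rels" for a b
  proof -
    have "a \<in> carrier A" "b \<in> carrier A" "f a = f b" using that rels eq by auto
    then show ?thesis
      using diff[of a b] unfolding a_kernel_def' by blast
  qed
  then have ker: "rel_ideal A rels \<subseteq> a_kernel A B f"
    unfolding rel_ideal_def by (intro genideal_minimal f.kernel_is_ideal) auto
  define g where "g X = f (SOME a. a \<in> carrier A \<and> X = cls A rels a)" for X
  have g: "g (cls A rels a) = f a" if a: "a \<in> carrier A" for a
  proof -
    define b where "b = (SOME b. b \<in> carrier A \<and> cls A rels a = cls A rels b)"
    have "b \<in> carrier A \<and> cls A rels a = cls A rels b"
      unfolding b_def by (rule someI[of _ a]) (simp add: a)
    then have b: "b \<in> carrier A" "cls A rels a = cls A rels b"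
      by blast+
    then have "a \<ominus>\<^bsub>A\<^esub> b \<in> rel_ideal A rels"
      using quotient_eq_iff_same_a_r_cos[OF rel_ideal_ideal a b(1)] unfolding cls_def by blast
    with ker have "f (a \<ominus>\<^bsub>A\<^esub> b) = \<zero>\<^bsub>B\<^esub>" by auto
    then have "f a = f b"
      using diff[OF a b(1)] by blast
    then show ?thesis by (simp add: g_def b_def[symmetric])
  qed
  have "g \<in> ring_hom (quot_by A rels) B"
  proof (rule ring_hom_memI)
    fix x y assume "x \<in> carrier (quot_by A rels)" "y \<in> carrier (quot_by A rels)"
    then obtain a b where a: "a \<in> carrier A" "x = cls A rels a" and b: "b \<in> carrier A" "y = cls A rels b"
      by (blast dest: cls_surj)
    show "g x \<in> carrier B"
      using a g by simp
    have "x \<otimes>\<^bsub>quot_by A rels\<^esub> y = cls A rels (a \<otimes>\<^bsub>A\<^esub> b)"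
      using ring_hom_mult[OF cls_hom a(1) b(1)] a b by simp
    then show "g (x \<otimes>\<^bsub>quot_by A rels\<^esub> y) = g x \<otimes>\<^bsub>B\<^esub> g y"
      using a b g by simp
    have "x \<oplus>\<^bsub>quot_by A rels\<^esub> y = cls A rels (a \<oplus>\<^bsub>A\<^esub> b)"
      using ring_hom_add[OF cls_hom a(1) b(1)] a b by simp
    then show "g (x \<oplus>\<^bsub>quot_by A rels\<^esub> y) = g x \<oplus>\<^bsub>B\<^esub> g y"
      using a b g by simp
  next
    show "g \<one>\<^bsub>quot_by A rels\<^esub> = \<one>\<^bsub>B\<^esub>"
      using g[of "\<one>\<^bsub>A\<^esub>"] ring_hom_one[OF cls_hom] by simp
  qed
  then show ?thesis using g by (rule that)
qed

end

section \<open>Algebras with a basis over the polynomial ring\<close>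

text \<open>The free module on \<open>X\<close> over \<open>\<rat>[u\<^sub>1,\<dots>,u\<^sub>m]\<close>, as functions of finite support.  The strand algebra is
  such a module on monotone bijections, the free algebra one on words.\<close>

definition fmod :: "nat \<Rightarrow> 'x set \<Rightarrow> ('x \<Rightarrow> upoly) set" where
  "fmod m X = {f. finite {x. f x \<noteq> 0} \<and> (\<forall>x. f x \<in> Upoly m) \<and> (\<forall>x. f x \<noteq> 0 \<longrightarrow> x \<in> X)}"

lemma fmod_zero [simp]: "(\<lambda>x. 0) \<in> fmod m X"
  by (simp add: fmod_def)

lemma fmod_add [intro]:
  assumes "f \<in> fmod m X" "g \<in> fmod m X"
  shows "(\<lambda>x. f x + g x) \<in> fmod m X"
proof -
  have "finite {x. f x + g x \<noteq> 0}"
    by (rule finite_subset[of _ "{x. f x \<noteq> 0} \<union> {x. g x \<noteq> 0}"]) (use assms in \<open>auto simp: fmod_def\<close>)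
  moreover have "x \<in> X" if "f x + g x \<noteq> 0" for x
  proof -
    have "f x \<noteq> 0 \<or> g x \<noteq> 0" using that by auto
    then show ?thesis using assms by (auto simp: fmod_def)
  qed
  ultimately show ?thesis
    using assms by (auto simp: fmod_def)
qed

lemma fmod_smul [intro]:
  assumes "c \<in> Upoly m" "f \<in> fmod m X"
  shows "smul c f \<in> fmod m X"
proof -
  have "finite {x. c * f x \<noteq> 0}"
    by (rule finite_subset[of _ "{x. f x \<noteq> 0}"]) (use assms in \<open>auto simp: fmod_def\<close>)
  moreover have "x \<in> X" if "c * f x \<noteq> 0" for x
  proof -
    have "f x \<noteq> 0" using that by auto
    then show ?thesis using assms by (auto simp: fmod_def)
  qed
  ultimately show ?thesis
    using assms by (auto simp: fmod_def smul_def)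
qed

lemma fmod_basis [intro]: "x \<in> X \<Longrightarrow> basis x \<in> fmod m X"
  by (auto simp: fmod_def basis_def)

lemma sum_fun_insert:
  "finite Y \<Longrightarrow> y \<notin> Y \<Longrightarrow> sum_fun f (insert y Y) = (\<lambda>x. f y x + sum_fun f Y x)"
  by (simp add: sum_fun_def)

lemma sum_fun_empty [simp]: "sum_fun f {} = (\<lambda>x. 0)"
  by (simp add: sum_fun_def)

lemma fmod_sum_fun [intro]:
  "(\<And>y. y \<in> Y \<Longrightarrow> f y \<in> fmod m X) \<Longrightarrow> sum_fun f Y \<in> fmod m X"
proof (induction Y rule: infinite_finite_induct)
  case (insert y Y)
  then have "f y \<in> fmod m X" "sum_fun f Y \<in> fmod m X" by auto
  then show ?case using insert.hyps by (auto simp: sum_fun_insert)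
qed (simp_all add: sum_fun_def)

lemma smul_simps [simp]:
  "smul 0 f = (\<lambda>x. 0)" "smul 1 f = f" "smul c (\<lambda>x. 0) = (\<lambda>x. 0)" "smul c (smul d f) = smul (c * d) f"
  "smul c (\<lambda>x. f x + g x) = (\<lambda>x. smul c f x + smul c g x)"
  by (auto simp: smul_def fun_eq_iff algebra_simps)

lemma smul_add: "smul (c + d) f = (\<lambda>x. smul c f x + smul d f x)"
  by (simp add: smul_def algebra_simps)

lemma fmod_induct [consumes 1, case_names zero basis add]:
  assumes "f \<in> fmod m X"
    and zero: "P (\<lambda>x. 0)"
    and basis: "\<And>c x. c \<in> Upoly m \<Longrightarrow> x \<in> X \<Longrightarrow> P (smul c (basis x))"
    and add: "\<And>f g. f \<in> fmod m X \<Longrightarrow> g \<in> fmod m X \<Longrightarrow> P f \<Longrightarrow> P g \<Longrightarrow> P (\<lambda>x. f x + g x)"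
  shows "P f"
proof -
  have "P f" if "finite F" "{x. f x \<noteq> 0} \<subseteq> F" "f \<in> fmod m X" for F f
    using that
  proof (induction F arbitrary: f)
    case empty
    then have "f = (\<lambda>x. 0)" by auto
    then show ?case using zero by simp
  next
    case (insert a F)
    show ?case
    proof (cases "f a = 0")
      case True
      then show ?thesis using insert.prems by (intro insert.IH) auto
    next
      case False
      let ?g = "f(a := 0)" and ?h = "smul (f a) (basis a)"
      have a: "a \<in> X" "f a \<in> Upoly m" using False insert.prems by (auto simp: fmod_def)
      have "finite {x. ?g x \<noteq> 0}"
        by (rule finite_subset[OF _ insert.hyps(1)]) (use insert.prems in auto)
      then have g: "?g \<in> fmod m X"
        using insert.prems by (auto simp: fmod_def)
      have "P ?g" using insert.prems by (intro insert.IH g) auto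
      moreover have "P ?h" using a by (rule basis[rotated])
      moreover have "?h \<in> fmod m X" using a by auto
      ultimately have "P (\<lambda>x. ?g x + ?h x)" using g by (intro add)
      moreover have "(\<lambda>x. ?g x + ?h x) = f"
        by (auto simp: fun_eq_iff smul_def basis_def)
      ultimately show ?thesis by simp
    qed
  qed
  then show ?thesis using assms(1) by (auto simp: fmod_def)
qed

text \<open>A bilinear product on such a module, with the ring axioms required of basis elements only.
  Products of basis elements are arbitrary module elements: in the strand algebra they are zero or a
  monomial times a basis element.\<close>

locale based_algebra =
  fixes A :: "('x \<Rightarrow> upoly) ring" (structure) and m :: nat and X :: "'x set"
  assumes carrier_eq: "carrier A = fmod m X"
    and zero_eq: "\<zero> = (\<lambda>x. 0)"
    and add_eq: "f \<oplus> g = (\<lambda>x. f x + g x)"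
    and mult_add_left: "\<lbrakk>f \<in> fmod m X; g \<in> fmod m X; h \<in> fmod m X\<rbrakk> \<Longrightarrow>
      (\<lambda>x. f x + g x) \<otimes> h = (\<lambda>x. (f \<otimes> h) x + (g \<otimes> h) x)"
    and mult_add_right: "\<lbrakk>f \<in> fmod m X; g \<in> fmod m X; h \<in> fmod m X\<rbrakk> \<Longrightarrow>
      h \<otimes> (\<lambda>x. f x + g x) = (\<lambda>x. (h \<otimes> f) x + (h \<otimes> g) x)"
    and mult_smul_left: "\<lbrakk>c \<in> Upoly m; f \<in> fmod m X; g \<in> fmod m X\<rbrakk> \<Longrightarrow>
      smul c f \<otimes> g = smul c (f \<otimes> g)"
    and mult_smul_right: "\<lbrakk>c \<in> Upoly m; f \<in> fmod m X; g \<in> fmod m X\<rbrakk> \<Longrightarrow>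
      f \<otimes> smul c g = smul c (f \<otimes> g)"
    and basis_mult_closed: "\<lbrakk>x \<in> X; y \<in> X\<rbrakk> \<Longrightarrow> basis x \<otimes> basis y \<in> fmod m X"
    and basis_assoc: "\<lbrakk>x \<in> X; y \<in> X; z \<in> X\<rbrakk> \<Longrightarrow>
      (basis x \<otimes> basis y) \<otimes> basis z = basis x \<otimes> (basis y \<otimes> basis z)"
    and one_fmod: "\<one> \<in> fmod m X"
    and one_basis: "x \<in> X \<Longrightarrow> \<one> \<otimes> basis x = basis x"
    and basis_one: "x \<in> X \<Longrightarrow> basis x \<otimes> \<one> = basis x"
begin

lemma mult_zero_left: "f \<in> fmod m X \<Longrightarrow> (\<lambda>x. 0) \<otimes> f = (\<lambda>x. 0)"
  using mult_smul_left[of 0 f f] by simp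

lemma mult_zero_right: "f \<in> fmod m X \<Longrightarrow> f \<otimes> (\<lambda>x. 0) = (\<lambda>x. 0)"
  using mult_smul_right[of 0 f f] by simp

lemma mult_fmod [intro]:
  assumes "f \<in> fmod m X" "g \<in> fmod m X"
  shows "f \<otimes> g \<in> fmod m X"
  using assms(1)
proof (induction rule: fmod_induct)
  case zero
  then show ?case using assms by (simp add: mult_zero_left)
next
  case (basis c x)
  from assms(2) have "basis x \<otimes> g \<in> fmod m X"
  proof (induction rule: fmod_induct)
    case zero
    then show ?case using basis by (simp add: mult_zero_right fmod_basis)
  next
    case (basis d y)
    then show ?case
      using \<open>x \<in> X\<close> by (auto simp: mult_smul_right fmod_basis basis_mult_closed)
  next
    case (add f g)
    then show ?case using basis by (auto simp: mult_add_right fmod_basis)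
  qed
  then show ?case using basis assms by (auto simp: mult_smul_left fmod_basis)
next
  case (add f h)
  then show ?case using assms by (auto simp: mult_add_left)
qed

text \<open>Both sides are linear in each factor, so three inductions reduce the claim to basis elements.\<close>

lemma mult_assoc:
  assumes f: "f \<in> fmod m X" and g: "g \<in> fmod m X" and h: "h \<in> fmod m X"
  shows "(f \<otimes> g) \<otimes> h = f \<otimes> (g \<otimes> h)"
  using f
proof (induction rule: fmod_induct)
  case zero
  then show ?case using g h by (simp add: mult_zero_left mult_fmod)
next
  case (basis c x)
  note x = basis
  from g have "(basis x \<otimes> g) \<otimes> h = basis x \<otimes> (g \<otimes> h)"
  proof (induction rule: fmod_induct)
    case zero
    then show ?case using x h by (simp add: mult_zero_left mult_zero_right fmod_basis)
  next
    case (basis d y)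
    note y = basis
    from h have "(basis x \<otimes> basis y) \<otimes> h = basis x \<otimes> (basis y \<otimes> h)"
    proof (induction rule: fmod_induct)
      case zero
      then show ?case using x y by (simp add: mult_zero_right fmod_basis mult_fmod)
    next
      case (basis e z)
      then show ?case using x y
        by (simp add: mult_smul_right fmod_basis mult_fmod basis_assoc)
    next
      case (add f g)
      then show ?case using x y by (simp add: mult_add_right fmod_basis mult_fmod)
    qed
    then show ?case using x y h
      by (simp add: mult_smul_left mult_smul_right fmod_basis mult_fmod)
  next
    case (add f g)
    then show ?case using x h by (simp add: mult_add_right mult_add_left fmod_basis mult_fmod)
  qed
  then show ?case using x g h by (simp add: mult_smul_left fmod_basis mult_fmod)
next
  case (add f f')
  then show ?case using g h by (simp add: mult_add_left mult_fmod)
qed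

lemma one_mult: "f \<in> fmod m X \<Longrightarrow> \<one> \<otimes> f = f"
  by (induction rule: fmod_induct)
    (simp_all add: mult_zero_right one_fmod mult_smul_right fmod_basis one_basis mult_add_right)

lemma mult_one: "f \<in> fmod m X \<Longrightarrow> f \<otimes> \<one> = f"
  by (induction rule: fmod_induct)
    (simp_all add: mult_zero_left one_fmod mult_smul_left fmod_basis basis_one mult_add_left)

lemma is_ring: "ring A"
proof (rule ringI)
  show "abelian_group A"
  proof (rule abelian_groupI)
    fix f assume "f \<in> carrier A"
    then have "smul (- 1) f \<in> carrier A" "smul (- 1) f \<oplus> f = \<zero>"
      by (auto simp: carrier_eq add_eq zero_eq smul_def[of "- 1"])
        (use Upoly_uminus[OF Upoly_one] fmod_smul[of "- 1" m f X] in \<open>auto simp: smul_def\<close>)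
    then show "\<exists>g\<in>carrier A. g \<oplus> f = \<zero>" by blast
  qed (auto simp: carrier_eq add_eq zero_eq add_ac)
  show "Group.monoid A"
    by (rule monoidI) (auto simp: carrier_eq one_fmod mult_assoc one_mult mult_one)
qed (auto simp: carrier_eq add_eq mult_add_left mult_add_right)

sublocale ring A
  by (rule is_ring)

lemma smul_eq_mult:
  assumes "c \<in> Upoly m" "f \<in> fmod m X"
  shows "smul c f = smul c \<one> \<otimes> f" "smul c f = f \<otimes> smul c \<one>"
  using assms by (simp_all add: mult_smul_left mult_smul_right one_fmod one_mult mult_one)

lemma scalar_hom: "(\<lambda>c. smul c \<one>) \<in> ring_hom (coeff_ring m) A"
  by (rule ring_hom_memI)
    (auto simp: carrier_eq add_eq smul_add one_fmod mult_smul_left mult_smul_right mult_one fmod_smul mult.commute)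

lemma sum_fun_eq_finsum:
  "finite Y \<Longrightarrow> (\<And>y. y \<in> Y \<Longrightarrow> f y \<in> fmod m X) \<Longrightarrow> sum_fun f Y = (\<Oplus>y\<in>Y. f y)"
proof (induction Y rule: finite_induct)
  case (insert y Y)
  then have "f \<in> Y \<rightarrow> carrier A" "f y \<in> carrier A" by (auto simp: carrier_eq)
  then show ?case using insert by (simp add: sum_fun_insert add_eq)
qed (simp add: zero_eq)

lemma hom_eqI:
  assumes "ring B" and "\<phi> \<in> ring_hom A B" and "\<psi> \<in> ring_hom A B"
    and "\<And>c. c \<in> Upoly m \<Longrightarrow> \<phi> (smul c \<one>) = \<psi> (smul c \<one>)"
    and "\<And>x. x \<in> X \<Longrightarrow> \<phi> (basis x) = \<psi> (basis x)"
    and "f \<in> fmod m X"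
  shows "\<phi> f = \<psi> f"
  using assms(6)
proof (induction rule: fmod_induct)
  case zero
  interpret \<phi>: ring_hom_ring A B \<phi> by (intro ring_hom_ringI2 is_ring assms)
  interpret \<psi>: ring_hom_ring A B \<psi> by (intro ring_hom_ringI2 is_ring assms)
  show ?case using \<phi>.hom_zero \<psi>.hom_zero by (simp add: zero_eq)
next
  case (basis c x)
  then have "smul c \<one> \<in> carrier A" "basis x \<in> carrier A"
    by (auto simp: carrier_eq one_fmod)
  then show ?case
    using basis assms(4,5) ring_hom_mult[OF assms(2)] ring_hom_mult[OF assms(3)]
    by (simp add: smul_eq_mult(1) fmod_basis)
next
  case (add f g)
  then show ?case
    using ring_hom_add[OF assms(2), of f g] ring_hom_add[OF assms(3), of f g]
    by (simp add: carrier_eq add_eq)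
qed

end

text \<open>An algebra over \<open>\<rat>[u\<^sub>1,\<dots>,u\<^sub>m]\<close>, given by its structure map \<open>s\<close> into the centre.\<close>

locale central_algebra = ring B for B :: "('b, 'd) ring_scheme" (structure) +
  fixes m :: nat and s :: "upoly \<Rightarrow> 'b"
  assumes scalar_hom: "s \<in> ring_hom (coeff_ring m) B"
    and scalar_central: "c \<in> Upoly m \<Longrightarrow> b \<in> carrier B \<Longrightarrow> s c \<otimes> b = b \<otimes> s c"
begin

lemma scalar_closed [simp]: "c \<in> Upoly m \<Longrightarrow> s c \<in> carrier B"
  using ring_hom_closed[OF scalar_hom] by simp

lemma scalar_mult: "c \<in> Upoly m \<Longrightarrow> d \<in> Upoly m \<Longrightarrow> s (c * d) = s c \<otimes> s d"
  using ring_hom_mult[OF scalar_hom] by simp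

lemma scalar_add: "c \<in> Upoly m \<Longrightarrow> d \<in> Upoly m \<Longrightarrow> s (c + d) = s c \<oplus> s d"
  using ring_hom_add[OF scalar_hom] by simp

lemma scalar_one [simp]: "s 1 = \<one>"
  using ring_hom_one[OF scalar_hom] by simp

lemma scalar_zero [simp]: "s 0 = \<zero>"
proof -
  interpret s: ring_hom_ring "coeff_ring m" B s
    by (intro ring_hom_ringI2 ring_coeff_ring ring_axioms scalar_hom)
  show ?thesis using s.hom_zero by simp
qed

text \<open>The linear map on a free module with the values \<open>v\<close> on the basis.\<close>

definition lin :: "('x \<Rightarrow> 'b) \<Rightarrow> ('x \<Rightarrow> upoly) \<Rightarrow> 'b" where
  "lin v f = (\<Oplus>x\<in>{x. f x \<noteq> 0}. s (f x) \<otimes> v x)"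

context
  fixes v :: "'x \<Rightarrow> 'b" and X :: "'x set"
  assumes v: "v \<in> X \<rightarrow> carrier B"
begin

lemma value_closed: "x \<in> X \<Longrightarrow> v x \<in> carrier B"
  using v by auto

lemma lin_superset:
  assumes "f \<in> fmod m X" "finite F" "{x. f x \<noteq> 0} \<subseteq> F" "F \<subseteq> X"
  shows "lin v f = (\<Oplus>x\<in>F. s (f x) \<otimes> v x)"
  unfolding lin_def
proof (rule add.finprod_mono_neutral_cong_left)
  show "s (f x) \<otimes> v x = \<zero>" if "x \<in> F - {x. f x \<noteq> 0}" for x
    using that value_closed[of x] assms(4) by auto
  show "(\<lambda>x. s (f x) \<otimes> v x) \<in> F \<rightarrow> carrier B"
    using assms by (auto simp: fmod_def value_closed subset_iff)
qed (use assms in auto)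

lemma lin_closed: "f \<in> fmod m X \<Longrightarrow> lin v f \<in> carrier B"
  unfolding lin_def by (intro finsum_closed) (auto simp: fmod_def value_closed)

lemma lin_add:
  assumes "f \<in> fmod m X" "g \<in> fmod m X"
  shows "lin v (\<lambda>x. f x + g x) = lin v f \<oplus> lin v g"
proof -
  let ?F = "{x. f x \<noteq> 0} \<union> {x. g x \<noteq> 0}"
  have F: "finite ?F" "?F \<subseteq> X" using assms by (auto simp: fmod_def)
  have U: "f x \<in> Upoly m" "g x \<in> Upoly m" for x using assms by (auto simp: fmod_def)
  have "lin v (\<lambda>x. f x + g x) = (\<Oplus>x\<in>?F. s (f x + g x) \<otimes> v x)"
    using assms F by (intro lin_superset) auto
  also have "\<dots> = (\<Oplus>x\<in>?F. s (f x) \<otimes> v x \<oplus> s (g x) \<otimes> v x)"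
    by (rule finsum_cong') (use F v U in \<open>auto simp: scalar_add l_distr Pi_def subset_iff\<close>)
  also have "\<dots> = (\<Oplus>x\<in>?F. s (f x) \<otimes> v x) \<oplus> (\<Oplus>x\<in>?F. s (g x) \<otimes> v x)"
    by (rule finsum_addf) (use F v U in \<open>auto simp: Pi_def subset_iff\<close>)
  also have "\<dots> = lin v f \<oplus> lin v g"
    using assms F by (simp add: lin_superset[of _ ?F])
  finally show ?thesis .
qed

lemma lin_zero: "lin v (\<lambda>x. 0) = \<zero>"
  by (simp add: lin_def)

lemma lin_smul_basis:
  assumes "x \<in> X" "c \<in> Upoly m"
  shows "lin v (smul c (basis x)) = s c \<otimes> v x"
proof -
  have "lin v (smul c (basis x)) = (\<Oplus>y\<in>{x}. s (smul c (basis x) y) \<otimes> v y)"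
    using assms by (intro lin_superset fmod_smul fmod_basis) (auto simp: smul_def basis_def)
  then show ?thesis
    using assms v by (auto simp: smul_def basis_def Pi_def)
qed

lemma lin_smul:
  assumes "f \<in> fmod m X" "c \<in> Upoly m"
  shows "lin v (smul c f) = s c \<otimes> lin v f"
  using assms(1)
proof (induction rule: fmod_induct)
  case zero
  then show ?case using assms by (simp add: lin_zero)
next
  case (basis d x)
  then have "v x \<in> carrier B" using v by auto
  then show ?case using basis assms by (simp add: lin_smul_basis Upoly_mult scalar_mult m_assoc)
next
  case (add f g)
  then show ?case using assms by (simp add: lin_add fmod_smul r_distr lin_closed)
qed

lemma lin_basis: "x \<in> X \<Longrightarrow> lin v (basis x) = v x"
  using lin_smul_basis[of x 1] value_closed[of x] by simp

text \<open>Since the scalars are central in the target, multiplicativity is a bilinear identity, and bilinear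
  identities may be checked on basis elements.\<close>

lemma lin_ring_hom:
  fixes A :: "('x \<Rightarrow> upoly) ring"
  assumes A: "based_algebra A m X"
    and mult: "\<And>x y. x \<in> X \<Longrightarrow> y \<in> X \<Longrightarrow> lin v (basis x \<otimes>\<^bsub>A\<^esub> basis y) = v x \<otimes> v y"
    and one: "lin v \<one>\<^bsub>A\<^esub> = \<one>"
  shows "lin v \<in> ring_hom A B"
proof -
  interpret A: based_algebra A m X by (fact A)
  have mult': "lin v (f \<otimes>\<^bsub>A\<^esub> g) = lin v f \<otimes> lin v g" if "f \<in> fmod m X" "g \<in> fmod m X" for f g
    using that(1)
  proof (induction rule: fmod_induct)
    case zero
    then show ?case using that by (simp add: lin_zero A.mult_zero_left lin_closed)
  next
    case (basis c x)
    note x = basis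
    then have vx: "v x \<in> carrier B" using v by auto
    from that(2) have "lin v (basis x \<otimes>\<^bsub>A\<^esub> g) = v x \<otimes> lin v g"
    proof (induction rule: fmod_induct)
      case zero
      then show ?case using x vx by (simp add: lin_zero A.mult_zero_right fmod_basis)
    next
      case (basis d y)
      then have "v y \<in> carrier B" using v by auto
      then have "v x \<otimes> (s d \<otimes> v y) = s d \<otimes> (v x \<otimes> v y)"
        using vx basis scalar_central[of d "v x"] by (simp flip: m_assoc)
      then show ?case using x basis
        by (simp add: A.mult_smul_right fmod_basis lin_smul A.mult_fmod mult lin_basis)
    next
      case (add f g)
      then show ?case using x vx
        by (simp add: A.mult_add_right fmod_basis lin_add A.mult_fmod lin_closed r_distr)
    qed
    then show ?case using x vx that
      by (simp add: A.mult_smul_left fmod_basis lin_smul A.mult_fmod lin_closed m_assoc lin_basis)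
  next
    case (add f h)
    then show ?case using that
      by (simp add: A.mult_add_left lin_add A.mult_fmod lin_closed l_distr)
  qed
  show ?thesis
    by (rule ring_hom_memI) (auto simp: A.carrier_eq A.add_eq mult' lin_add lin_closed one)
qed

end

end

text \<open>The map \<open>t\<close> allows for a renaming of variables: the isomorphism proved below shifts the indices of
  the variables.\<close>

lemma (in based_algebra) central_algebra_quotient:
  assumes B: "ring B" and h: "h \<in> ring_hom A B" and surj: "\<And>b. b \<in> carrier B \<Longrightarrow> \<exists>a\<in>carrier A. b = h a"
    and t: "t \<in> ring_hom (coeff_ring k) (coeff_ring m)"
  shows "central_algebra B k (\<lambda>c. h (smul (t c) \<one>))"
proof -
  interpret B: ring B by (fact B)
  show ?thesis
  proof
    have "h \<circ> ((\<lambda>c. smul c \<one>) \<circ> t) \<in> ring_hom (coeff_ring k) B"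
      using t scalar_hom h by (intro ring_hom_trans)
    then show "(\<lambda>c. h (smul (t c) \<one>)) \<in> ring_hom (coeff_ring k) B"
      by (simp add: comp_def)
  next
    fix c b assume c: "c \<in> Upoly k" and "b \<in> carrier B"
    then obtain a where a: "a \<in> carrier A" "b = h a" using surj by blast
    have tc: "t c \<in> Upoly m" using ring_hom_closed[OF t] c by simp
    then have "smul (t c) \<one> \<in> carrier A" by (auto simp: carrier_eq one_fmod)
    then show "h (smul (t c) \<one>) \<otimes>\<^bsub>B\<^esub> b = b \<otimes>\<^bsub>B\<^esub> h (smul (t c) \<one>)"
      using a tc ring_hom_mult[OF h] smul_eq_mult[of "t c" a] by (simp add: carrier_eq flip: ring_hom_mult[OF h])
  qed
qed

section \<open>Height functions of particle configurations\<close>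

text \<open>The height function of a configuration of particles.  At the site of a particle it is the rank of
  that particle (\<open>ht_bij\<close>).\<close>

definition ht :: "nat set \<Rightarrow> nat \<Rightarrow> nat" where
  "ht S i = card {x \<in> S. x \<le> i}"

lemma nsubsets_finite [intro]: "S \<in> nsubsets n \<Longrightarrow> finite S"
  using finite_subset[of S "{1..2*n}"] by (auto simp: nsubsets_def)

lemma finite_nsubsets [simp]: "finite (nsubsets n)"
  by (rule finite_subset[of _ "Pow {1..2*n}"]) (auto simp: nsubsets_def)

lemma ht_split:
  assumes "finite S" "a \<le> b"
  shows "ht S b = ht S a + card (S \<inter> {a<..b})"
proof -
  have "{x \<in> S. x \<le> b} = {x \<in> S. x \<le> a} \<union> (S \<inter> {a<..b})" using assms by auto
  moreover have "card ({x \<in> S. x \<le> a} \<union> (S \<inter> {a<..b})) = card {x \<in> S. x \<le> a} + card (S \<inter> {a<..b})"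
    using assms by (intro card_Un_disjoint) auto
  ultimately show ?thesis by (simp add: ht_def)
qed

lemma ht_mono: "finite S \<Longrightarrow> a \<le> b \<Longrightarrow> ht S a \<le> ht S b"
  using ht_split[of S a b] by simp

lemma ht_le_add:
  assumes "finite S" "a \<le> b"
  shows "ht S b \<le> ht S a + (b - a)"
proof -
  have "card (S \<inter> {a<..b}) \<le> card {a<..b}" by (intro card_mono) auto
  then show ?thesis using ht_split[OF assms] by simp
qed

lemma ht_Suc: "finite S \<Longrightarrow> ht S (Suc i) = ht S i + (if Suc i \<in> S then 1 else 0)"
proof -
  assume S: "finite S"
  have "S \<inter> {i<..Suc i} = (if Suc i \<in> S then {Suc i} else {})" by (auto simp: le_Suc_eq)
  then show ?thesis using ht_split[OF S, of i "Suc i"] by simp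
qed

lemma ht_0: "S \<in> nsubsets n \<Longrightarrow> ht S 0 = 0"
  by (auto simp: ht_def nsubsets_def)

lemma ht_top: "S \<in> nsubsets n \<Longrightarrow> ht S (2 * n) = n"
proof -
  assume S: "S \<in> nsubsets n"
  then have "{x \<in> S. x \<le> 2 * n} = S" by (auto simp: nsubsets_def)
  then show ?thesis using S by (simp add: ht_def nsubsets_def)
qed

lemma ht_le: "S \<in> nsubsets n \<Longrightarrow> ht S i \<le> n"
  unfolding ht_def using card_mono[OF nsubsets_finite, of S n "{x \<in> S. x \<le> i}"] by (auto simp: nsubsets_def)

lemma ht_pos: "finite S \<Longrightarrow> i \<in> S \<Longrightarrow> 0 < ht S i"
  by (auto simp: ht_def card_gt_0_iff)

lemma le_iff_ht_le:
  assumes "finite S" "j \<in> S"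
  shows "j \<le> i \<longleftrightarrow> ht S j \<le> ht S i"
proof
  assume "ht S j \<le> ht S i"
  show "j \<le> i"
  proof (rule ccontr)
    assume "\<not> j \<le> i"
    then have "j \<in> S \<inter> {i<..j}" using assms by auto
    then have "0 < card (S \<inter> {i<..j})" using assms by (auto simp: card_gt_0_iff)
    then show False
      using ht_split[OF assms(1), of i j] \<open>ht S j \<le> ht S i\<close> \<open>\<not> j \<le> i\<close> by simp
  qed
qed (use assms ht_mono in auto)

lemma ht_inj_on: "finite S \<Longrightarrow> inj_on (ht S) S"
proof (rule inj_onI)
  fix x y assume "finite S" "x \<in> S" "y \<in> S" "ht S x = ht S y"
  then show "x = y" using le_iff_ht_le[of S x y] le_iff_ht_le[of S y x] by simp
qed

lemma ht_bij:
  assumes "S \<in> nsubsets n"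
  shows "bij_betw (ht S) S {1..n}"
proof -
  have "ht S ` S \<subseteq> {1..n}"
    using ht_le[OF assms] ht_pos[OF nsubsets_finite[OF assms]] by (auto simp: Suc_le_eq)
  moreover have "card (ht S ` S) = n"
    using assms card_image[OF ht_inj_on[OF nsubsets_finite[OF assms]]] by (simp add: nsubsets_def)
  ultimately have "ht S ` S = {1..n}"
    by (intro card_subset_eq) auto
  then show ?thesis using ht_inj_on[OF nsubsets_finite[OF assms]] by (simp add: bij_betw_def)
qed

lemma mem_iff_ht:
  assumes "finite S" "1 \<le> i"
  shows "i \<in> S \<longleftrightarrow> ht S (i - 1) < ht S i"
  using ht_Suc[OF assms(1), of "i - 1"] assms(2) by (cases i) auto

definition movable :: "nat \<Rightarrow> nat set \<Rightarrow> bool" where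
  "movable i S \<longleftrightarrow> (i \<in> S) \<noteq> (Suc i \<in> S)"

text \<open>The sites \<open>i\<close> and \<open>i + 1\<close> are exchanged, so that a particle crosses the gap between them in
  whichever direction is possible.  Right and left moves are thus treated together, and a hop is its
  own inverse.\<close>

definition hop :: "nat \<Rightarrow> nat set \<Rightarrow> nat set" where
  "hop i S = {x. (if x = i then Suc i else if x = Suc i then i else x) \<in> S}"

lemma hop_mem: "x \<in> hop i S \<longleftrightarrow> (if x = i then Suc i else if x = Suc i then i else x) \<in> S"
  by (simp add: hop_def)

lemma hop_hop [simp]: "hop i (hop i S) = S"
  by (auto simp: hop_def)

lemma movable_hop [simp]: "movable i (hop i S) = movable i S"
  by (auto simp: movable_def hop_def)

lemma hop_far: "Suc i < j \<Longrightarrow> hop i (hop j S) = hop j (hop i S)"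
  by (auto simp: hop_def)

lemma movable_hop_far:
  "Suc i < j \<Longrightarrow> movable i (hop j S) = movable i S"
  "Suc i < j \<Longrightarrow> movable j (hop i S) = movable j S"
  by (auto simp: movable_def hop_def)

lemma hop_image: "hop i S = (\<lambda>x. if x = i then Suc i else if x = Suc i then i else x) ` S"
  by (force simp: hop_def image_iff)

lemma hop_nsubsets:
  assumes "S \<in> nsubsets n" "i \<in> {1..<2*n}"
  shows "hop i S \<in> nsubsets n"
proof -
  have "hop i S \<subseteq> {1..2*n}"
    using assms unfolding hop_image nsubsets_def by auto
  moreover have "card (hop i S) = card S"
    unfolding hop_image by (intro card_image) (auto simp: inj_on_def split: if_splits)
  ultimately show ?thesis using assms by (simp add: nsubsets_def)
qed

lemma hop_finite: "finite S \<Longrightarrow> finite (hop i S)"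
  by (simp add: hop_image)

lemma hop_right: "i \<in> S \<Longrightarrow> Suc i \<notin> S \<Longrightarrow> hop i S = insert (Suc i) (S - {i})"
  and hop_left: "i \<notin> S \<Longrightarrow> Suc i \<in> S \<Longrightarrow> hop i S = insert i (S - {Suc i})"
  by (auto simp: hop_def split: if_splits)

lemma ht_hop:
  assumes "finite S" "1 \<le> i"
  shows "ht (hop i S) k = (if k = i then ht S (i - 1) + (if Suc i \<in> S then 1 else 0) else ht S k)"
proof (induction k)
  case 0
  have "{x \<in> hop i S. x \<le> 0} = {x \<in> S. x \<le> 0}"
    using assms by (auto simp: hop_mem split: if_splits)
  then show ?case using assms by (auto simp: ht_def)
next
  case (Suc k)
  consider "Suc k = i" | "k = i" | "Suc k \<noteq> i" "k \<noteq> i" by auto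
  then show ?case
    using Suc ht_Suc[OF assms(1), of k] ht_Suc[OF assms(1), of "i - 1"]
      ht_Suc[OF hop_finite[OF assms(1), of i], of k] assms(2)
    by cases (auto simp: hop_mem)
qed

lemma ht_hop_movable:
  assumes "finite S" "1 \<le> i" "movable i S"
  shows "int (ht (hop i S) i) = (if i \<in> S then int (ht S i) - 1 else int (ht S i) + 1)"
  using assms ht_hop[of S i i] ht_Suc[of S "i - 1"] by (auto simp: movable_def)

definition hdist :: "nat \<Rightarrow> nat \<Rightarrow> nat" where
  "hdist s t = (s - t) + (t - s)"

definition config_dist :: "nat \<Rightarrow> nat set \<Rightarrow> nat set \<Rightarrow> nat" where
  "config_dist n S T = (\<Sum>i = 1..2*n. hdist (ht S i) (ht T i))"

text \<open>The hop across gap \<open>i\<close> takes \<open>T\<close> one step towards \<open>S\<close>: a particle at \<open>i\<close> moves right and lowers the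
  height at \<open>i\<close>, a particle at \<open>i + 1\<close> moves left and raises it.\<close>

definition closer :: "nat \<Rightarrow> nat \<Rightarrow> nat set \<Rightarrow> nat set \<Rightarrow> bool" where
  "closer n i S T \<longleftrightarrow> i \<in> {1..<2*n} \<and> movable i T \<and> (if i \<in> T then ht S i < ht T i else ht T i < ht S i)"

lemma closer_dist:
  assumes "closer n i S T" "finite T"
  shows "config_dist n S T = Suc (config_dist n S (hop i T))"
proof -
  have i: "i \<in> {1..2*n}" "1 \<le> i" "movable i T" using assms by (auto simp: closer_def)
  have "hdist (ht S i) (ht T i) = Suc (hdist (ht S i) (ht (hop i T) i))"
    using ht_hop_movable[OF assms(2) i(2,3)] assms(1)
    by (auto simp: hdist_def closer_def split: if_splits)
  moreover have "(\<Sum>k\<in>{1..2*n}-{i}. hdist (ht S k) (ht T k)) =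
      (\<Sum>k\<in>{1..2*n}-{i}. hdist (ht S k) (ht (hop i T) k))"
    using ht_hop[OF assms(2) i(2)] by (intro sum.cong) auto
  ultimately show ?thesis
    using i(1) by (simp add: config_dist_def sum.remove[of _ i])
qed

lemma closer_or_hop_closer:
  assumes "i \<in> {1..<2*n}" "movable i T" "finite T"
  shows "closer n i S T \<or> closer n i S (hop i T)"
  using ht_hop_movable[OF assms(3) _ assms(2)] assms
  by (auto simp: closer_def hop_mem movable_def)

lemma config_dist_self: "config_dist n S S = 0"
  by (simp add: config_dist_def hdist_def)

text \<open>Let \<open>a\<close> be the first site at which the heights differ.  If \<open>S\<close> is higher there, the next particle of
  \<open>T\<close> after \<open>a\<close> should move left: up to that particle the height of \<open>T\<close> is constant, so \<open>S\<close> stays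
  higher.  If \<open>T\<close> is higher, \<open>a\<close> starts a block of particles of \<open>T\<close>, whose last particle should
  move right: along the block \<open>S\<close> rises no faster than \<open>T\<close>.\<close>

lemma exists_closer:
  assumes S: "S \<in> nsubsets n" and T: "T \<in> nsubsets n" and "S \<noteq> T"
  shows "\<exists>i. closer n i S T"
proof -
  have fin: "finite S" "finite T" using S T by auto
  have "\<exists>i. ht S i \<noteq> ht T i"
  proof (rule ccontr)
    assume eq: "\<nexists>i. ht S i \<noteq> ht T i"
    have "x \<in> S \<longleftrightarrow> x \<in> T" if "1 \<le> x" for x
      using eq mem_iff_ht[OF fin(1) that] mem_iff_ht[OF fin(2) that] by simp
    moreover have "x \<notin> S" "x \<notin> T" if "\<not> 1 \<le> x" for x
      using that S T by (auto simp: nsubsets_def)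
    ultimately show False using \<open>S \<noteq> T\<close> by blast
  qed
  then obtain a where neq: "ht S a \<noteq> ht T a" and before: "\<And>i. i < a \<Longrightarrow> ht S i = ht T i"
    using exists_least_iff[of "\<lambda>i. ht S i \<noteq> ht T i"] by blast
  have a: "1 \<le> a" using neq ht_0[OF S] ht_0[OF T] by (cases a) auto
  then have before': "ht S (a - 1) = ht T (a - 1)" using before[of "a - 1"] by simp
  show ?thesis
  proof (cases "ht T a < ht S a")
    case True
    then have aT: "a \<notin> T"
      using before' ht_Suc[OF fin(1), of "a - 1"] ht_Suc[OF fin(2), of "a - 1"] a
      by (auto split: if_splits)
    have "\<exists>k>a. k \<in> T"
    proof (rule ccontr)
      assume none: "\<not> (\<exists>k>a. k \<in> T)"
      have "T \<inter> {a<..max a (2*n)} = {}" using none by auto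
      then have "ht T (max a (2*n)) = ht T a"
        using ht_split[OF fin(2), of a "max a (2*n)"] by simp
      moreover have "n \<le> ht T (max a (2*n))"
        using ht_mono[OF fin(2), of "2*n" "max a (2*n)"] ht_top[OF T] by simp
      ultimately show False using True ht_le[OF S, of a] by simp
    qed
    then obtain k where k: "a < k" "k \<in> T" and least: "\<And>x. a < x \<Longrightarrow> x < k \<Longrightarrow> x \<notin> T"
      using exists_least_iff[of "\<lambda>k. a < k \<and> k \<in> T"] by blast
    define i where "i = k - 1"
    have i: "k = Suc i" "a \<le> i" "1 \<le> i" using k a by (auto simp: i_def)
    have "T \<inter> {a<..i} = {}" using least i by auto
    then have "ht T i = ht T a" using ht_split[OF fin(2) i(2)] by simp
    moreover have "ht S a \<le> ht S i" using ht_mono[OF fin(1) i(2)] .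
    moreover have "i \<notin> T" using least[of i] aT i by (cases "i = a") auto
    moreover have "Suc i \<in> T" using k i by simp
    moreover have "Suc i \<le> 2*n" using T \<open>Suc i \<in> T\<close> by (auto simp: nsubsets_def)
    ultimately have "closer n i S T"
      using True i(3) by (auto simp: closer_def movable_def)
    then show ?thesis ..
  next
    case False
    then have lt: "ht S a < ht T a" using neq by simp
    then have aT: "a \<in> T"
      using before' ht_Suc[OF fin(1), of "a - 1"] ht_Suc[OF fin(2), of "a - 1"] a
      by (auto split: if_splits)
    then have a2: "a \<le> 2*n" using T by (auto simp: nsubsets_def)
    have "2*n+1 \<notin> T" using T by (auto simp: nsubsets_def)
    then have "\<exists>k>a. k \<notin> T" using a2 by (intro exI[of _ "2*n+1"]) auto
    then obtain k where k: "a < k" "k \<notin> T" and least: "\<And>x. a < x \<Longrightarrow> x < k \<Longrightarrow> x \<in> T"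
      using exists_least_iff[of "\<lambda>k. a < k \<and> k \<notin> T"] by blast
    define i where "i = k - 1"
    have i: "k = Suc i" "a \<le> i" "1 \<le> i" using k a by (auto simp: i_def)
    have "T \<inter> {a<..i} = {a<..i}" using least i by auto
    then have "ht T i = ht T a + (i - a)" using ht_split[OF fin(2) i(2)] by simp
    moreover have "ht S i \<le> ht S a + (i - a)" using ht_le_add[OF fin(1) i(2)] .
    ultimately have lti: "ht S i < ht T i" using lt by simp
    moreover have iT: "i \<in> T" using least[of i] aT i by (cases "i = a") auto
    moreover have "Suc i \<notin> T" using k i by simp
    moreover have "i \<noteq> 2*n" using lti ht_top[OF S] ht_top[OF T] by auto
    then have "Suc i \<le> 2*n" using T iT by (auto simp: nsubsets_def)
    ultimately have "closer n i S T"
      using i(3) by (auto simp: closer_def movable_def)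
    then show ?thesis ..
  qed
qed

text \<open>Two movable adjacent gaps have sites \<open>i\<close>, \<open>i + 1\<close>, \<open>i + 2\<close> filled alternately.  If only the middle
  site is filled, both hops move its particle, in opposite directions, and the height of \<open>S\<close> would
  have to decrease from \<open>i\<close> to \<open>i + 1\<close>; if only the middle site is empty, the height of \<open>S\<close> would
  have to increase by two.\<close>

lemma closer_not_adjacent:
  assumes "closer n i S T" "finite S" "finite T"
  shows "\<not> closer n (Suc i) S T"
  using assms ht_Suc[OF assms(2), of i] ht_Suc[OF assms(3), of i]
  by (auto simp: closer_def movable_def split: if_splits)

lemma closer_far:
  assumes "closer n i S T" "closer n j S T" "i \<noteq> j" "finite S" "finite T"
  shows "Suc i < j \<or> Suc j < i"
  using assms closer_not_adjacent[of n i S T] closer_not_adjacent[of n j S T]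
  by (metis Suc_lessI linorder_neqE_nat)

lemma closer_hop_far:
  assumes "closer n j S T" "i \<in> {1..<2*n}" "Suc i < j \<or> Suc j < i" "finite T"
  shows "closer n j S (hop i T)"
  using assms ht_hop[OF assms(4), of i j]
  by (auto simp: closer_def hop_mem movable_hop_far)

section \<open>The weights of the product\<close>

text \<open>The distance of \<open>t\<close> from the interval between \<open>s\<close> and \<open>v\<close>: the length of the detour from \<open>s\<close> to
  \<open>v\<close> through \<open>t\<close>, counted one way.\<close>

definition wexp :: "nat \<Rightarrow> nat \<Rightarrow> nat \<Rightarrow> nat" where
  "wexp s t v = (min s v - t) + (t - max s v)"

lemma hdist_wexp: "hdist s t + hdist t v = hdist s v + 2 * wexp s t v"
  by (auto simp: hdist_def wexp_def min_def max_def)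

text \<open>Twice either side is the excess of the path \<open>s, t, v, w\<close> over the distance of its ends.  This is
  associativity of the strand algebra.\<close>

lemma wexp_cocycle: "wexp s t v + wexp s v w = wexp s t w + wexp t v w"
  using hdist_wexp[of s t v] hdist_wexp[of s v w] hdist_wexp[of s t w] hdist_wexp[of t v w]
  by linarith

lemma wexp_trivial [simp]: "wexp s t t = 0" "wexp s s t = 0"
  by (auto simp: wexp_def min_def max_def)

definition wt :: "nat \<Rightarrow> nat set \<Rightarrow> nat set \<Rightarrow> nat set \<Rightarrow> upoly" where
  "wt n S T V = (\<Prod>i = 1..2*n. uvar i ^ wexp (ht S i) (ht T i) (ht V i))"

lemma wt_Upoly [simp]: "wt n S T V \<in> Upoly (2*n)"
  unfolding wt_def by (intro Upoly_prod Upoly_power Upoly_uvar)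

lemma wt_cocycle: "wt n S T V * wt n S V W = wt n S T W * wt n T V W"
  unfolding wt_def prod.distrib[symmetric] power_add[symmetric] 
  by (intro prod.cong refl arg_cong2[where f = power] wexp_cocycle)

lemma wt_trivial [simp]: "wt n S T T = 1" "wt n S S T = 1"
  by (simp_all add: wt_def)

lemma wt_single:
  assumes "\<And>k. k \<noteq> i \<Longrightarrow> wexp (ht S k) (ht T k) (ht V k) = 0" "i \<in> {1..2*n}"
  shows "wt n S T V = uvar i ^ wexp (ht S i) (ht T i) (ht V i)"
proof -
  have "(\<Prod>k\<in>{1..2*n}-{i}. uvar k ^ wexp (ht S k) (ht T k) (ht V k)) = 1"
    using assms(1) by (intro prod.neutral) auto
  then show ?thesis using assms(2) by (simp add: wt_def prod.remove[of _ i])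
qed

lemma wt_hop:
  assumes "i \<in> {1..<2*n}" "movable i T" "finite T"
  shows "wt n S T (hop i T) = (if closer n i S T then uvar i else 1)"
proof -
  have "wt n S T (hop i T) = uvar i ^ wexp (ht S i) (ht T i) (ht (hop i T) i)"
    using assms ht_hop[OF assms(3)] by (intro wt_single) auto
  moreover have "wexp (ht S i) (ht T i) (ht (hop i T) i) = (if closer n i S T then 1 else 0)"
    using ht_hop_movable[OF assms(3) _ assms(2)] assms
    by (auto simp: wexp_def closer_def min_def max_def split: if_splits)
  ultimately show ?thesis by simp
qed

lemma wt_closer:
  assumes "closer n i S T" "finite T"
  shows "wt n S (hop i T) T = 1"
proof -
  have i: "i \<in> {1..<2*n}" "movable i T" using assms by (auto simp: closer_def)
  then have "wt n S (hop i T) T = uvar i ^ wexp (ht S i) (ht (hop i T) i) (ht T i)"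
    using ht_hop[OF assms(2)] by (intro wt_single) auto
  moreover have "wexp (ht S i) (ht (hop i T) i) (ht T i) = 0"
    using ht_hop_movable[OF assms(2) _ i(2)] i(1) assms(1)
    by (auto simp: wexp_def closer_def min_def max_def split: if_splits)
  ultimately show ?thesis by simp
qed

section \<open>Monotone bijections\<close>

lemma mono_bijD:
  assumes "P \<in> mono_bij n"
  shows "dom P \<in> nsubsets n" "ran P \<in> nsubsets n"
    and "\<And>i j p q. P i = Some p \<Longrightarrow> P j = Some q \<Longrightarrow> i < j \<longleftrightarrow> p < q"
proof -
  show "dom P \<in> nsubsets n" "ran P \<in> nsubsets n" using assms by (auto simp: mono_bij_def)
  have mono: "p < q" if "P i = Some p" "P j = Some q" "i < j" for i j p q
    using assms that by (force simp: mono_bij_def dom_def)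
  show "i < j \<longleftrightarrow> p < q" if "P i = Some p" "P j = Some q" for i j p q
    using mono[of i p j q] mono[of j q i p] that by (cases i j rule: linorder_cases) auto
qed

lemma mono_bij_le_iff:
  assumes "P \<in> mono_bij n" "P i = Some p" "P j = Some q"
  shows "i \<le> j \<longleftrightarrow> p \<le> q"
  using mono_bijD(3)[OF assms(1,3,2)] by (simp add: not_less[symmetric])

text \<open>Order is preserved, hence so are ranks.  Therefore a monotone bijection is determined by its domain
  and its range.\<close>

lemma mono_bij_ht:
  assumes P: "P \<in> mono_bij n" and j: "P j = Some p"
  shows "ht (ran P) p = ht (dom P) j"
proof -
  have "{y \<in> ran P. y \<le> p} = (the \<circ> P) ` {x \<in> dom P. x \<le> j}"
  proof (intro equalityI subsetI)
    fix y assume "y \<in> {y \<in> ran P. y \<le> p}"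
    then obtain x where x: "P x = Some y" "y \<le> p" by (auto simp: ran_def)
    then have "x \<le> j" using mono_bij_le_iff[OF P x(1) j] by simp
    with x show "y \<in> (the \<circ> P) ` {x \<in> dom P. x \<le> j}" by (force simp: image_iff)
  next
    fix y assume "y \<in> (the \<circ> P) ` {x \<in> dom P. x \<le> j}"
    then obtain x where x: "P x = Some y" "x \<le> j" by auto
    then show "y \<in> {y \<in> ran P. y \<le> p}"
      using mono_bij_le_iff[OF P x(1) j] by (auto simp: ran_def)
  qed
  moreover have "inj_on (the \<circ> P) {x \<in> dom P. x \<le> j}"
  proof (rule inj_onI)
    fix x y assume "x \<in> {x \<in> dom P. x \<le> j}" "y \<in> {x \<in> dom P. x \<le> j}" "(the \<circ> P) x = (the \<circ> P) y"
    then obtain z where "P x = Some z" "P y = Some z" by auto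
    then show "x = y" using mono_bij_le_iff[OF P, of x z y z] mono_bij_le_iff[OF P, of y z x z] by simp
  qed
  ultimately show ?thesis unfolding ht_def by (simp only: card_image)
qed

lemma mono_bij_eqI:
  assumes P: "P \<in> mono_bij n" and Q: "Q \<in> mono_bij n" and "dom P = dom Q" "ran P = ran Q"
  shows "P = Q"
proof
  fix j
  show "P j = Q j"
  proof (cases "j \<in> dom P")
    case True
    moreover have "j \<in> dom Q" using True assms(3) by simp
    ultimately obtain p q where pq: "P j = Some p" "Q j = Some q" by blast
    then have "ht (ran P) p = ht (ran P) q"
      using mono_bij_ht[OF P pq(1)] mono_bij_ht[OF Q pq(2)] assms(3,4) by simp
    moreover have "p \<in> ran P" "q \<in> ran P" using pq ranI[of P j p] ranI[of Q j q] assms(4) by simp_all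
    ultimately have "p = q"
      using ht_inj_on[OF nsubsets_finite[OF mono_bijD(2)[OF P]]] by (blast dest: inj_onD)
    then show ?thesis using pq by simp
  next
    case False
    moreover have "j \<notin> dom Q" using False assms(3) by simp
    ultimately show ?thesis by (simp add: domIff)
  qed
qed

lemma mono_bij_exists:
  assumes S: "S \<in> nsubsets n" and T: "T \<in> nsubsets n"
  shows "\<exists>P \<in> mono_bij n. dom P = S \<and> ran P = T"
proof -
  define g where "g = the_inv_into T (ht T) \<circ> ht S"
  have inv: "bij_betw (the_inv_into T (ht T)) {1..n} T"
    using ht_bij[OF T] by (rule bij_betw_the_inv_into)
  have g: "bij_betw g S T"
    unfolding g_def by (rule bij_betw_trans[OF ht_bij[OF S] inv])
  have ht_g: "ht T (g x) = ht S x" if "x \<in> S" for x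
  proof -
    have "ht S x \<in> ht T ` T"
      using that ht_bij[OF S] ht_bij[OF T] by (auto simp: bij_betw_def)
    then show ?thesis
      using ht_inj_on[OF nsubsets_finite[OF T]] by (simp add: g_def f_the_inv_into_f)
  qed
  have g_mono: "g x < g y" if "x \<in> S" "y \<in> S" "x < y" for x y
  proof -
    have "g x \<in> T" "g y \<in> T" using g that by (auto simp: bij_betw_def)
    then show ?thesis
      using that le_iff_ht_le[OF nsubsets_finite[OF T], of "g y" "g x"]
        le_iff_ht_le[OF nsubsets_finite[OF S], of y x] ht_g
      by (simp add: not_le[symmetric])
  qed
  define P where "P = (\<lambda>x. if x \<in> S then Some (g x) else None)"
  have dom: "dom P = S" by (auto simp: P_def dom_def)
  have "ran P = g ` S" by (auto simp: P_def ran_def)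
  then have ran: "ran P = T" using g by (simp add: bij_betw_def)
  have "P \<in> mono_bij n"
    unfolding mono_bij_def mem_Collect_eq dom ran using S T g_mono by (simp add: P_def)
  then show ?thesis using dom ran by blast
qed

lemma finite_mono_bij [simp]: "finite (mono_bij n)"
proof (rule finite_imageD)
  have "(\<lambda>P. (dom P, ran P)) ` mono_bij n \<subseteq> nsubsets n \<times> nsubsets n"
    by (auto simp: mono_bij_def)
  then show "finite ((\<lambda>P. (dom P, ran P)) ` mono_bij n)"
    by (rule finite_subset) simp
  show "inj_on (\<lambda>P. (dom P, ran P)) (mono_bij n)"
    by (rule inj_onI) (auto intro: mono_bij_eqI)
qed

lemma mono_bij_comp:
  assumes P: "P \<in> mono_bij n" and Q: "Q \<in> mono_bij n" and "ran P = dom Q"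
  shows "Q \<circ>\<^sub>m P \<in> mono_bij n" "dom (Q \<circ>\<^sub>m P) = dom P" "ran (Q \<circ>\<^sub>m P) = ran Q"
proof -
  have ex: "\<exists>q. Q p = Some q" if "P j = Some p" for j p
    using that assms(3) by (auto simp: ran_def dom_def)
  have ex': "\<exists>j. P j = Some p" if "Q p = Some q" for p q
    using that assms(3) by (auto simp: ran_def dom_def set_eq_iff)
  show d: "dom (Q \<circ>\<^sub>m P) = dom P"
    using ex by (auto simp: map_comp_def dom_def split: option.splits)
  show r: "ran (Q \<circ>\<^sub>m P) = ran Q"
  proof (intro equalityI subsetI)
    fix q assume "q \<in> ran Q"
    then obtain p where "Q p = Some q" by (auto simp: ran_def)
    moreover obtain j where "P j = Some p" using ex' calculation by blast
    ultimately have "(Q \<circ>\<^sub>m P) j = Some q" by (simp add: map_comp_def)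
    then show "q \<in> ran (Q \<circ>\<^sub>m P)" by (rule ranI)
  qed (auto simp: ran_def map_comp_def split: option.splits)
  have "the ((Q \<circ>\<^sub>m P) i) < the ((Q \<circ>\<^sub>m P) j)" if ij: "i \<in> dom P" "j \<in> dom P" "i < j" for i j
  proof -
    obtain p p' where p: "P i = Some p" "P j = Some p'" using ij by blast
    obtain q q' where q: "Q p = Some q" "Q p' = Some q'" using ex p by blast
    have "p < p'" using mono_bijD(3)[OF P p] ij by simp
    then have "q < q'" using mono_bijD(3)[OF Q q] by simp
    then show ?thesis using p q by (simp add: map_comp_def)
  qed
  then show "Q \<circ>\<^sub>m P \<in> mono_bij n"
    using mono_bijD(1)[OF P] mono_bijD(2)[OF Q] by (simp add: mono_bij_def d r)
qed

text \<open>The strands are numbered by rank.  The strand of rank \<open>r\<close> sits at a site up to \<open>i\<close> exactly when \<open>r\<close>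
  is at most the height at \<open>i\<close>, so the strands that cross gap \<open>i\<close> twice are those whose rank lies in one
  of two intervals.\<close>

lemma alpha_eq_wexp:
  assumes P: "P \<in> mono_bij n" and Q: "Q \<in> mono_bij n" and PQ: "ran P = dom Q"
  shows "alpha P Q i = wexp (ht (dom P) i) (ht (ran P) i) (ht (ran Q) i)"
proof -
  define s t v where "s = ht (dom P) i" and "t = ht (ran P) i" and "v = ht (ran Q) i"
  have fin: "finite (dom P)" "finite (ran P)" "finite (ran Q)"
    using nsubsets_finite[OF mono_bijD(1)[OF P]] nsubsets_finite[OF mono_bijD(2)[OF P]]
      nsubsets_finite[OF mono_bijD(2)[OF Q]] by simp_all
  have le: "s \<le> n" "t \<le> n" "v \<le> n"
    unfolding s_def t_def v_def by (intro ht_le mono_bijD(1,2)[OF P] mono_bijD(2)[OF Q])+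
  let ?C = "\<lambda>r. r \<in> {t<..min s v} \<union> {max s v<..t}"
  have C: "(let p = the (P j); q = the (Q p) in max j q \<le> i \<and> i < p \<or> min j q > i \<and> i \<ge> p)
      \<longleftrightarrow> ?C (ht (dom P) j)" if j: "j \<in> dom P" for j
  proof -
    obtain p where p: "P j = Some p" using j by blast
    then have pr: "p \<in> ran P" by (rule ranI)
    then have "p \<in> dom Q" by (simp only: PQ)
    then obtain q where q: "Q p = Some q" by blast
    then have qr: "q \<in> ran Q" by (rule ranI)
    have r: "ht (ran P) p = ht (dom P) j" "ht (ran Q) q = ht (dom P) j"
      using mono_bij_ht[OF P p] mono_bij_ht[OF Q q] by (simp_all only: PQ)
    have iff: "j \<le> i \<longleftrightarrow> ht (dom P) j \<le> s" "p \<le> i \<longleftrightarrow> ht (dom P) j \<le> t" "q \<le> i \<longleftrightarrow> ht (dom P) j \<le> v"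
      using le_iff_ht_le[OF fin(1) j, of i] le_iff_ht_le[OF fin(2) pr, of i]
        le_iff_ht_le[OF fin(3) qr, of i] by (simp_all only: r s_def t_def v_def)
    have "(max j q \<le> i \<and> i < p \<or> min j q > i \<and> i \<ge> p) \<longleftrightarrow>
        (j \<le> i \<and> q \<le> i \<and> \<not> p \<le> i \<or> \<not> j \<le> i \<and> \<not> q \<le> i \<and> p \<le> i)"
      by (simp add: not_le)
    also have "\<dots> \<longleftrightarrow> ?C (ht (dom P) j)"
      unfolding iff by auto
    finally show ?thesis
      by (simp only: p q Let_def option.sel)
  qed
  then have "alpha P Q i = card {j \<in> dom P. ?C (ht (dom P) j)}"
    unfolding alpha_def by (intro arg_cong[of _ _ card] Collect_cong conj_cong refl C)
  also have "\<dots> = card (ht (dom P) ` {j \<in> dom P. ?C (ht (dom P) j)})"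
    by (intro card_image[symmetric] inj_on_subset[OF ht_inj_on[OF fin(1)]]) auto
  also have "ht (dom P) ` {j \<in> dom P. ?C (ht (dom P) j)} = {r \<in> {1..n}. ?C r}"
  proof -
    have "f ` {j \<in> A. D (f j)} = {r \<in> f ` A. D r}" for f :: "nat \<Rightarrow> nat" and A D
      by blast
    from this[of "ht (dom P)" "dom P" ?C] show ?thesis
      by (simp only: bij_betw_imp_surj_on[OF ht_bij[OF mono_bijD(1)[OF P]]])
  qed
  also have "\<dots> = {t<..min s v} \<union> {max s v<..t}"
    using le by auto
  also have "card \<dots> = wexp s t v"
    by (subst card_Un_disjoint) (auto simp: wexp_def)
  finally show ?thesis by (simp add: s_def t_def v_def)
qed

lemma id_bij_mono_bij:
  assumes "S \<in> nsubsets n"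
  shows "id_bij S \<in> mono_bij n" "dom (id_bij S) = S" "ran (id_bij S) = S"
proof -
  show d: "dom (id_bij S) = S" and r: "ran (id_bij S) = S"
    by (auto simp: id_bij_def ran_def restrict_map_def dom_def split: if_splits)
  show "id_bij S \<in> mono_bij n"
    unfolding mono_bij_def mem_Collect_eq d r using assms by (simp add: id_bij_def)
qed

lemma hop_mono_bij:
  assumes S: "S \<in> nsubsets n" and i: "i \<in> {1..<2*n}" and a: "a \<in> {i, Suc i}" "b \<in> {i, Suc i}"
    "a \<in> S" "b \<notin> S"
  shows "(id_bij S)(a \<mapsto> b) \<in> mono_bij n" "dom ((id_bij S)(a \<mapsto> b)) = S"
    "ran ((id_bij S)(a \<mapsto> b)) = hop i S"
proof -
  define g where "g = (\<lambda>x. if x = a then b else x)"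
  let ?P = "(id_bij S)(a \<mapsto> b)"
  have P: "?P = (\<lambda>x. if x \<in> S then Some (g x) else None)"
    using a by (auto simp: fun_eq_iff id_bij_def restrict_map_def g_def)
  show d: "dom ?P = S" unfolding P by (auto simp: dom_def)
  have "ran ?P = g ` S"
    unfolding P by (auto simp: ran_def)
  also have "\<dots> = insert b (S - {a})"
    using a by (auto simp: g_def)
  also have "\<dots> = hop i S"
    using a by (auto simp: hop_def split: if_splits)
  finally show r: "ran ?P = hop i S" .
  have "g x < g y" if "x \<in> S" "y \<in> S" "x < y" for x y
  proof -
    have "x \<noteq> b" "y \<noteq> b" using that a by auto
    then show ?thesis
      using that a by (auto simp: g_def)
  qed
  then have "\<forall>x\<in>S. \<forall>y\<in>S. x < y \<longrightarrow> the (?P x) < the (?P y)"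
    unfolding P by simp
  then show "?P \<in> mono_bij n"
    unfolding mono_bij_def mem_Collect_eq d r using S hop_nsubsets[OF S i] by blast
qed

section \<open>The strand algebra\<close>

lemma strand_alg_simps:
  "f \<otimes>\<^bsub>strand_alg n\<^esub> g = strand_mult n f g" "\<one>\<^bsub>strand_alg n\<^esub> = sum_fun iota (nsubsets n)"
  "\<zero>\<^bsub>strand_alg n\<^esub> = (\<lambda>P. 0)" "f \<oplus>\<^bsub>strand_alg n\<^esub> g = (\<lambda>P. f P + g P)"
  by (simp_all add: strand_alg_def)

lemma strand_carrier: "carrier (strand_alg n) = fmod (2*n) (mono_bij n)"
proof -
  have "finite {P. f P \<noteq> 0}" if "\<forall>P. P \<notin> mono_bij n \<longrightarrow> f P = 0" for f :: "_ \<Rightarrow> upoly"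
    by (rule finite_subset[OF _ finite_mono_bij[of n]]) (use that in auto)
  then show ?thesis by (auto simp: strand_alg_def fmod_def)
qed

lemma strand_mult_add_left:
  "strand_mult n (\<lambda>P. f P + g P) h = (\<lambda>P. strand_mult n f h P + strand_mult n g h P)"
  unfolding strand_mult_def fun_eq_iff
  by (auto simp: algebra_simps simp flip: sum.distrib intro!: sum.cong)

lemma strand_mult_add_right:
  "strand_mult n h (\<lambda>P. f P + g P) = (\<lambda>P. strand_mult n h f P + strand_mult n h g P)"
  unfolding strand_mult_def fun_eq_iff
  by (auto simp: algebra_simps simp flip: sum.distrib intro!: sum.cong)

lemma strand_mult_smul_left: "strand_mult n (smul c f) g = smul c (strand_mult n f g)"
  unfolding strand_mult_def smul_def fun_eq_iff
  by (auto simp: algebra_simps sum_distrib_left intro!: sum.cong)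

lemma strand_mult_smul_right: "strand_mult n f (smul c g) = smul c (strand_mult n f g)"
  unfolding strand_mult_def smul_def fun_eq_iff
  by (auto simp: algebra_simps sum_distrib_left intro!: sum.cong)

lemma strand_mult_zero [simp]:
  "strand_mult n (\<lambda>P. 0) f = (\<lambda>P. 0)" "strand_mult n f (\<lambda>P. 0) = (\<lambda>P. 0)"
  by (simp_all add: strand_mult_def cong: if_cong)

lemma strand_mult_sum_left:
  "finite Y \<Longrightarrow> strand_mult n (sum_fun f Y) g = sum_fun (\<lambda>y. strand_mult n (f y) g) Y"
  by (induction Y rule: finite_induct) (simp_all add: sum_fun_insert strand_mult_add_left)

lemma strand_mult_sum_right:
  "finite Y \<Longrightarrow> strand_mult n g (sum_fun f Y) = sum_fun (\<lambda>y. strand_mult n g (f y)) Y"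
  by (induction Y rule: finite_induct) (simp_all add: sum_fun_insert strand_mult_add_right)

lemma sum_fun_delta:
  "finite Y \<Longrightarrow> sum_fun (\<lambda>y. if y = a then f y else (\<lambda>x. 0)) Y = (if a \<in> Y then f a else (\<lambda>x. 0))"
  by (auto simp: sum_fun_def fun_eq_iff if_distribR cong: if_cong)

lemma strand_mult_basis:
  assumes P: "P \<in> mono_bij n" and Q: "Q \<in> mono_bij n"
  shows "strand_mult n (basis P) (basis Q) =
    (if ran P = dom Q then smul (wt n (dom P) (ran P) (ran Q)) (basis (Q \<circ>\<^sub>m P)) else (\<lambda>x. 0))"
proof
  fix R
  let ?F = "\<lambda>P Q. if ran P = dom Q \<and> Q \<circ>\<^sub>m P = R then (\<Prod>i = 1..2*n. uvar i ^ alpha P Q i) else 0"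
  have "strand_mult n (basis P) (basis Q) R =
      (\<Sum>P'\<in>mono_bij n. if P' = P then (\<Sum>Q'\<in>mono_bij n. if Q' = Q then ?F P Q else 0) else 0)"
    unfolding strand_mult_def
  proof (intro sum.cong refl)
    fix P'
    show "(\<Sum>Q'\<in>mono_bij n. if ran P' = dom Q' \<and> Q' \<circ>\<^sub>m P' = R
          then (\<Prod>i = 1..2*n. uvar i ^ alpha P' Q' i) * basis P P' * basis Q Q' else 0) =
        (if P' = P then (\<Sum>Q'\<in>mono_bij n. if Q' = Q then ?F P Q else 0) else 0)"
    proof (cases "P' = P")
      case True
      show ?thesis
        unfolding True if_P[OF refl] by (intro sum.cong refl) (simp add: basis_def)
    qed (simp add: basis_def cong: if_cong)
  qed
  also have "\<dots> = ?F P Q"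
    using P Q by (simp add: sum.delta)
  also have "\<dots> = (if ran P = dom Q then smul (wt n (dom P) (ran P) (ran Q)) (basis (Q \<circ>\<^sub>m P)) else (\<lambda>x. 0)) R"
  proof (cases "ran P = dom Q")
    case True
    then have "(\<Prod>i = 1..2*n. uvar i ^ alpha P Q i) = wt n (dom P) (ran P) (ran Q)"
      unfolding wt_def using alpha_eq_wexp[OF P Q] by simp
    then show ?thesis by (auto simp: smul_def basis_def)
  qed simp
  finally show "strand_mult n (basis P) (basis Q) R = \<dots>" .
qed

lemma iota_fmod: "S \<in> nsubsets n \<Longrightarrow> iota S \<in> fmod m (mono_bij n)"
  unfolding iota_def by (intro fmod_basis id_bij_mono_bij)

lemma id_bij_comp:
  assumes "P \<in> mono_bij n"
  shows "P \<circ>\<^sub>m id_bij (dom P) = P" "id_bij (ran P) \<circ>\<^sub>m P = P"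
proof -
  note idb = id_bij_mono_bij[OF mono_bijD(1)[OF assms]] id_bij_mono_bij[OF mono_bijD(2)[OF assms]]
  show "P \<circ>\<^sub>m id_bij (dom P) = P"
    using mono_bij_comp[OF idb(1) assms] idb by (intro mono_bij_eqI[OF _ assms]) simp_all
  show "id_bij (ran P) \<circ>\<^sub>m P = P"
    using mono_bij_comp[OF assms idb(4)] idb by (intro mono_bij_eqI[OF _ assms]) simp_all
qed

text \<open>Associativity on basis elements is the cocycle identity for the weights.\<close>

lemma strand_based: "based_algebra (strand_alg n) (2*n) (mono_bij n)"
proof
  fix P Q R assume PQ: "P \<in> mono_bij n" "Q \<in> mono_bij n"
  show "basis P \<otimes>\<^bsub>strand_alg n\<^esub> basis Q \<in> fmod (2*n) (mono_bij n)"
    using PQ by (auto simp: strand_alg_simps strand_mult_basis intro!: fmod_smul fmod_basis mono_bij_comp)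
  assume R: "R \<in> mono_bij n"
  show "basis P \<otimes>\<^bsub>strand_alg n\<^esub> basis Q \<otimes>\<^bsub>strand_alg n\<^esub> basis R =
      basis P \<otimes>\<^bsub>strand_alg n\<^esub> (basis Q \<otimes>\<^bsub>strand_alg n\<^esub> basis R)"
  proof (cases "ran P = dom Q \<and> ran Q = dom R")
    case True
    note C = mono_bij_comp[OF PQ] mono_bij_comp[OF PQ(2) R]
    have "R \<circ>\<^sub>m (Q \<circ>\<^sub>m P) = (R \<circ>\<^sub>m Q) \<circ>\<^sub>m P"
      using True C mono_bij_comp[OF C(1) R] mono_bij_comp[OF PQ(1) C(4)]
      by (intro mono_bij_eqI[of _ n]) simp_all
    moreover have "wt n (dom P) (dom Q) (dom R) * wt n (dom P) (dom R) (ran R) =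
        wt n (dom Q) (dom R) (ran R) * wt n (dom P) (dom Q) (ran R)"
      using wt_cocycle[of n "dom P" "dom Q" "dom R" "ran R"] by (simp only: mult.commute)
    ultimately show ?thesis
      using True C PQ R
      by (simp add: strand_alg_simps strand_mult_basis strand_mult_smul_left strand_mult_smul_right)
  next
    case False
    then show ?thesis
      using PQ R mono_bij_comp[OF PQ] mono_bij_comp[OF PQ(2) R]
      by (auto simp: strand_alg_simps strand_mult_basis strand_mult_smul_left strand_mult_smul_right)
  qed
next
  fix P assume P: "P \<in> mono_bij n"
  have "strand_mult n (iota S) (basis P) = (if S = dom P then basis P else (\<lambda>x. 0))"
    if "S \<in> nsubsets n" for S
    using that P id_bij_comp[OF P] by (auto simp: iota_def strand_mult_basis id_bij_mono_bij)
  then have "sum_fun (\<lambda>S. strand_mult n (iota S) (basis P)) (nsubsets n) =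
      sum_fun (\<lambda>S. if S = dom P then basis P else (\<lambda>x. 0)) (nsubsets n)"
    by (simp add: sum_fun_def)
  then show "\<one>\<^bsub>strand_alg n\<^esub> \<otimes>\<^bsub>strand_alg n\<^esub> basis P = basis P"
    using mono_bijD[OF P] by (simp add: strand_alg_simps strand_mult_sum_left sum_fun_delta)
  have "strand_mult n (basis P) (iota S) = (if S = ran P then basis P else (\<lambda>x. 0))"
    if "S \<in> nsubsets n" for S
    using that P id_bij_comp[OF P] by (auto simp: iota_def strand_mult_basis id_bij_mono_bij)
  then have "sum_fun (\<lambda>S. strand_mult n (basis P) (iota S)) (nsubsets n) =
      sum_fun (\<lambda>S. if S = ran P then basis P else (\<lambda>x. 0)) (nsubsets n)"
    by (simp add: sum_fun_def)
  then show "basis P \<otimes>\<^bsub>strand_alg n\<^esub> \<one>\<^bsub>strand_alg n\<^esub> = basis P"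
    using mono_bijD[OF P] by (simp add: strand_alg_simps strand_mult_sum_right sum_fun_delta)
next
  show "\<one>\<^bsub>strand_alg n\<^esub> \<in> fmod (2*n) (mono_bij n)"
    unfolding strand_alg_simps by (intro fmod_sum_fun iota_fmod)
qed (simp_all add: strand_alg_simps strand_carrier strand_mult_add_left strand_mult_add_right
      strand_mult_smul_left strand_mult_smul_right)

definition mb :: "nat \<Rightarrow> nat set \<Rightarrow> nat set \<Rightarrow> nat \<rightharpoonup> nat" where
  "mb n S T = (THE P. P \<in> mono_bij n \<and> dom P = S \<and> ran P = T)"

lemma mb_eqI: "P \<in> mono_bij n \<Longrightarrow> dom P = S \<Longrightarrow> ran P = T \<Longrightarrow> mb n S T = P"
  unfolding mb_def by (rule the_equality) (auto intro: mono_bij_eqI)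

lemma mb:
  assumes "S \<in> nsubsets n" "T \<in> nsubsets n"
  shows "mb n S T \<in> mono_bij n" "dom (mb n S T) = S" "ran (mb n S T) = T"
proof -
  obtain P where "P \<in> mono_bij n" "dom P = S" "ran P = T"
    using mono_bij_exists[OF assms] by blast
  then show "mb n S T \<in> mono_bij n" "dom (mb n S T) = S" "ran (mb n S T) = T"
    using mb_eqI[of P n S T] by simp_all
qed

text \<open>From here on the basis is indexed by pairs of configurations instead of bijections.\<close>

definition el :: "nat \<Rightarrow> nat set \<Rightarrow> nat set \<Rightarrow> strand_elt" where
  "el n S T = basis (mb n S T)"

lemma el_fmod: "S \<in> nsubsets n \<Longrightarrow> T \<in> nsubsets n \<Longrightarrow> el n S T \<in> fmod m (mono_bij n)"
  unfolding el_def by (intro fmod_basis mb)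

lemma basis_eq_el: "P \<in> mono_bij n \<Longrightarrow> basis P = el n (dom P) (ran P)"
  by (simp add: el_def mb_eqI)

lemma el_mult:
  assumes "S \<in> nsubsets n" "T \<in> nsubsets n" "T' \<in> nsubsets n" "V \<in> nsubsets n"
  shows "strand_mult n (el n S T) (el n T' V) =
    (if T = T' then smul (wt n S T V) (el n S V) else (\<lambda>x. 0))"
proof -
  note m = mb[OF assms(1,2)] mb[OF assms(3,4)]
  show ?thesis
  proof (cases "T = T'")
    case True
    then have "mb n T' V \<circ>\<^sub>m mb n S T = mb n S V"
      using mono_bij_comp[OF m(1,4)] m by (intro mb_eqI[symmetric]) simp_all
    then show ?thesis
      using m True by (simp add: el_def strand_mult_basis)
  next
    case False
    then show ?thesis
      using m by (simp add: el_def strand_mult_basis)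
  qed
qed

lemma iota_eq_el: "S \<in> nsubsets n \<Longrightarrow> iota S = el n S S"
  using id_bij_mono_bij[of S n] by (simp add: iota_def basis_eq_el)

text \<open>Sums of single hops; for suitable sets \<open>Y\<close> these are the generators \<open>R\<^sub>i\<close> and \<open>L\<^sub>i\<close>.\<close>

definition hops :: "nat \<Rightarrow> nat \<Rightarrow> nat set set \<Rightarrow> strand_elt" where
  "hops n i Y = sum_fun (\<lambda>S. el n S (hop i S)) Y"

lemma Rgen_eq_hops:
  assumes "i \<in> {1..<2*n}"
  shows "Rgen n i = hops n i {S \<in> nsubsets n. i \<in> S \<and> Suc i \<notin> S}"
proof -
  have "basis ((id_bij S)(i \<mapsto> Suc i)) = el n S (hop i S)"
    if "S \<in> nsubsets n" "i \<in> S" "Suc i \<notin> S" for S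
    unfolding el_def using mb_eqI[OF hop_mono_bij[OF that(1) assms, of i "Suc i"]] that by simp
  then show ?thesis
    unfolding Rgen_def hops_def sum_fun_def fun_eq_iff by (auto intro!: sum.cong)
qed

lemma Lgen_eq_hops:
  assumes "i \<in> {1..<2*n}"
  shows "Lgen n i = hops n i {S \<in> nsubsets n. i \<notin> S \<and> Suc i \<in> S}"
proof -
  have "basis ((id_bij S)(Suc i \<mapsto> i)) = el n S (hop i S)"
    if "S \<in> nsubsets n" "Suc i \<in> S" "i \<notin> S" for S
    unfolding el_def using mb_eqI[OF hop_mono_bij[OF that(1) assms, of "Suc i" i]] that by simp
  then show ?thesis
    unfolding Lgen_def hops_def sum_fun_def fun_eq_iff by (auto intro!: sum.cong)
qed

lemma hops_fmod: "i \<in> {1..<2*n} \<Longrightarrow> Y \<subseteq> nsubsets n \<Longrightarrow> hops n i Y \<in> fmod m (mono_bij n)"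
  unfolding hops_def by (intro fmod_sum_fun el_fmod hop_nsubsets) auto

lemma el_hops:
  assumes "i \<in> {1..<2*n}" "Y \<subseteq> nsubsets n" "U \<in> nsubsets n" "V \<in> nsubsets n"
  shows "strand_mult n (el n U V) (hops n i Y) =
    (if V \<in> Y then smul (wt n U V (hop i V)) (el n U (hop i V)) else (\<lambda>x. 0))"
proof -
  have fin: "finite Y" using assms(2) finite_nsubsets by (rule finite_subset)
  have "strand_mult n (el n U V) (el n S (hop i S)) =
      (if S = V then smul (wt n U S (hop i S)) (el n U (hop i S)) else (\<lambda>x. 0))" if "S \<in> Y" for S
    using that assms by (auto simp: el_mult hop_nsubsets subset_iff)
  then have "strand_mult n (el n U V) (hops n i Y) = sum_fun (\<lambda>S. if S = V then
      smul (wt n U S (hop i S)) (el n U (hop i S)) else (\<lambda>x. 0)) Y"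
    unfolding hops_def strand_mult_sum_right[OF fin] by (simp add: sum_fun_def)
  then show ?thesis using fin by (simp add: sum_fun_delta)
qed

lemma hops_el:
  assumes "i \<in> {1..<2*n}" "Y \<subseteq> nsubsets n" "U \<in> nsubsets n" "V \<in> nsubsets n"
  shows "strand_mult n (hops n i Y) (el n U V) =
    (if hop i U \<in> Y then smul (wt n (hop i U) U V) (el n (hop i U) V) else (\<lambda>x. 0))"
proof -
  have fin: "finite Y" using assms(2) finite_nsubsets by (rule finite_subset)
  have "strand_mult n (el n S (hop i S)) (el n U V) =
      (if S = hop i U then smul (wt n S U V) (el n S V) else (\<lambda>x. 0))" if "S \<in> Y" for S
    using that assms by (auto simp: el_mult hop_nsubsets subset_iff)
  then have "strand_mult n (hops n i Y) (el n U V) = sum_fun (\<lambda>S. if S = hop i U then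
      smul (wt n S U V) (el n S V) else (\<lambda>x. 0)) Y"
    unfolding hops_def strand_mult_sum_left[OF fin] by (simp add: sum_fun_def)
  then show ?thesis using fin by (simp add: sum_fun_delta)
qed

lemma gen_carrier:
  "i \<in> {1..<2*n} \<Longrightarrow> Rgen n i \<in> carrier (strand_alg n)"
  "i \<in> {1..<2*n} \<Longrightarrow> Lgen n i \<in> carrier (strand_alg n)"
  "S \<in> nsubsets n \<Longrightarrow> iota S \<in> carrier (strand_alg n)"
  by (auto simp: strand_carrier Rgen_eq_hops Lgen_eq_hops intro!: hops_fmod iota_fmod)

lemma iota_at_fmod: "iota_at n k \<in> fmod m (mono_bij n)"
  unfolding iota_at_def by (intro fmod_sum_fun iota_fmod) auto

lemma strand_eqI:
  assumes f: "f \<in> fmod (2*n) (mono_bij n)" and g: "g \<in> fmod (2*n) (mono_bij n)"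
    and eq: "\<And>S. S \<in> nsubsets n \<Longrightarrow> strand_mult n (iota S) f = strand_mult n (iota S) g"
  shows "f = g"
proof -
  interpret A: based_algebra "strand_alg n" "2*n" "mono_bij n" by (rule strand_based)
  have "f = strand_mult n (sum_fun iota (nsubsets n)) f"
    if "f \<in> fmod (2*n) (mono_bij n)" for f
    using A.one_mult[OF that] by (simp add: strand_alg_simps)
  then have "f = sum_fun (\<lambda>S. strand_mult n (iota S) f) (nsubsets n)"
    "g = sum_fun (\<lambda>S. strand_mult n (iota S) g) (nsubsets n)"
    using f g by (simp_all flip: strand_mult_sum_left)
  moreover have "sum_fun (\<lambda>S. strand_mult n (iota S) f) (nsubsets n) =
      sum_fun (\<lambda>S. strand_mult n (iota S) g) (nsubsets n)"
    using eq by (simp add: sum_fun_def)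
  ultimately show ?thesis by simp
qed

lemma el_step:
  assumes "S \<in> nsubsets n" "T \<in> nsubsets n" "closer n i S T"
  shows "el n S T = strand_mult n (el n S (hop i T)) (el n (hop i T) T)"
proof -
  have "hop i T \<in> nsubsets n" "finite T"
    using assms nsubsets_finite[of T n] by (auto simp: closer_def intro: hop_nsubsets)
  then show ?thesis using assms wt_closer[OF assms(3)] by (simp add: el_mult)
qed

text \<open>The strand algebra is generated by idempotents and single hops: along a
  shortest path the weights are trivial, so every basis element is a product of hops.\<close>

lemma strand_hom_eqI:
  assumes B: "ring B" and \<phi>: "\<phi> \<in> ring_hom (strand_alg n) B" and \<psi>: "\<psi> \<in> ring_hom (strand_alg n) B"
    and scalar: "\<And>c. c \<in> Upoly (2*n) \<Longrightarrow> \<phi> (smul c \<one>\<^bsub>strand_alg n\<^esub>) = \<psi> (smul c \<one>\<^bsub>strand_alg n\<^esub>)"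
    and iota: "\<And>S. S \<in> nsubsets n \<Longrightarrow> \<phi> (iota S) = \<psi> (iota S)"
    and hop: "\<And>S i. S \<in> nsubsets n \<Longrightarrow> i \<in> {1..<2*n} \<Longrightarrow> movable i S \<Longrightarrow>
      \<phi> (el n S (hop i S)) = \<psi> (el n S (hop i S))"
    and f: "f \<in> carrier (strand_alg n)"
  shows "\<phi> f = \<psi> f"
proof -
  interpret A: based_algebra "strand_alg n" "2*n" "mono_bij n" by (rule strand_based)
  have el: "\<phi> (el n S T) = \<psi> (el n S T)" if S: "S \<in> nsubsets n" and T: "T \<in> nsubsets n" for S T
    using T
  proof (induction "config_dist n S T" arbitrary: T rule: less_induct)
    case less
    show ?case
    proof (cases "S = T")
      case True
      then show ?thesis using iota[OF S] iota_eq_el[OF S] by simp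
    next
      case False
      then obtain i where i: "closer n i S T" using exists_closer S less.prems by blast
      then have i': "i \<in> {1..<2*n}" "movable i T" by (auto simp: closer_def)
      have T': "hop i T \<in> nsubsets n" using hop_nsubsets[OF less.prems i'(1)] .
      have "config_dist n S (hop i T) < config_dist n S T"
        using closer_dist[OF i nsubsets_finite[OF less.prems]] by simp
      then have "\<phi> (el n S (hop i T)) = \<psi> (el n S (hop i T))" using less.hyps T' by blast
      moreover have "\<phi> (el n (hop i T) T) = \<psi> (el n (hop i T) T)"
        using hop[OF T' i'(1)] i' by simp
      moreover have "el n S (hop i T) \<in> carrier (strand_alg n)" "el n (hop i T) T \<in> carrier (strand_alg n)"
        unfolding strand_carrier using T' S less.prems by (auto intro: el_fmod)
      ultimately show ?thesis
        unfolding el_step[OF S less.prems i] using ring_hom_mult[OF \<phi>] ring_hom_mult[OF \<psi>]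
        by (simp add: strand_alg_simps)
    qed
  qed
  show ?thesis
  proof (rule A.hom_eqI[OF B \<phi> \<psi> scalar])
    fix P assume P: "P \<in> mono_bij n"
    show "\<phi> (basis P) = \<psi> (basis P)"
      unfolding basis_eq_el[OF P] by (rule el[OF mono_bijD(1,2)[OF P]])
  qed (use f in \<open>simp_all add: strand_carrier\<close>)
qed

section \<open>Representations by hopping particles\<close>

text \<open>The data that a homomorphism out of the strand algebra amounts to.  The element \<open>G i\<close> plays the part
  of \<open>R\<^sub>i + L\<^sub>i\<close>; its two summands are told apart by the idempotents.\<close>

locale hopping_rep = central_algebra B "2*n" s
  for B :: "('b, 'd) ring_scheme" (structure) and n :: nat and s +
  fixes J :: "nat set \<Rightarrow> 'b" and G :: "nat \<Rightarrow> 'b"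
  assumes J_closed [simp]: "S \<in> nsubsets n \<Longrightarrow> J S \<in> carrier B"
    and G_closed [simp]: "i \<in> {1..<2*n} \<Longrightarrow> G i \<in> carrier B"
    and J_J: "S \<in> nsubsets n \<Longrightarrow> T \<in> nsubsets n \<Longrightarrow> J S \<otimes> J T = (if S = T then J S else \<zero>)"
    and J_sum: "(\<Oplus>S\<in>nsubsets n. J S) = \<one>"
    and J_G: "S \<in> nsubsets n \<Longrightarrow> i \<in> {1..<2*n} \<Longrightarrow> movable i S \<Longrightarrow>
      J S \<otimes> G i = J S \<otimes> G i \<otimes> J (hop i S)"
    and J_G_G: "S \<in> nsubsets n \<Longrightarrow> i \<in> {1..<2*n} \<Longrightarrow> movable i S \<Longrightarrow>
      J S \<otimes> (G i \<otimes> G i) = s (uvar i) \<otimes> J S"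
    and G_far: "i \<in> {1..<2*n} \<Longrightarrow> j \<in> {1..<2*n} \<Longrightarrow> Suc i < j \<Longrightarrow> G i \<otimes> G j = G j \<otimes> G i"
begin

text \<open>The products of \<open>G\<close> along shortest paths from \<open>S\<close>.\<close>

inductive geo :: "nat set \<Rightarrow> nat set \<Rightarrow> 'b \<Rightarrow> bool" for S where
  refl: "S \<in> nsubsets n \<Longrightarrow> geo S S (J S)"
| step: "geo S (hop i T) a \<Longrightarrow> T \<in> nsubsets n \<Longrightarrow> closer n i S T \<Longrightarrow> geo S T (a \<otimes> G i)"

lemma geo_props:
  "geo S T a \<Longrightarrow> S \<in> nsubsets n \<and> T \<in> nsubsets n \<and> a \<in> carrier B \<and> J S \<otimes> a = a \<and> a \<otimes> J T = a"
proof (induction rule: geo.induct)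
  case refl
  then show ?case by (simp add: J_J)
next
  case (step i T a)
  then have i: "i \<in> {1..<2*n}" "movable i (hop i T)" by (auto simp: closer_def)
  let ?T = "hop i T"
  have T': "?T \<in> nsubsets n" and a: "a \<in> carrier B" and aJ: "a \<otimes> J ?T = a" using step by auto
  have "a \<otimes> G i = a \<otimes> (J ?T \<otimes> G i)"
    using T' a i by (simp add: aJ flip: m_assoc)
  also have "\<dots> = a \<otimes> (J ?T \<otimes> G i \<otimes> J T)"
    using J_G[OF T' i] by simp
  also have "\<dots> = a \<otimes> G i \<otimes> J T"
    using T' a i step by (simp add: aJ flip: m_assoc)
  finally have "a \<otimes> G i \<otimes> J T = a \<otimes> G i" by simp
  moreover have "J S \<otimes> (a \<otimes> G i) = a \<otimes> G i" using step a i by (simp flip: m_assoc)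
  ultimately show ?case using step i by auto
qed

lemma geo_exists:
  assumes "S \<in> nsubsets n" "T \<in> nsubsets n"
  shows "\<exists>a. geo S T a"
  using assms(2)
proof (induction "config_dist n S T" arbitrary: T rule: less_induct)
  case less
  show ?case
  proof (cases "S = T")
    case True
    then show ?thesis using geo.refl assms by blast
  next
    case False
    then obtain i where i: "closer n i S T" using exists_closer assms(1) less.prems by blast
    then have "hop i T \<in> nsubsets n" using hop_nsubsets[OF less.prems] by (auto simp: closer_def)
    moreover have "config_dist n S (hop i T) < config_dist n S T"
      using closer_dist[OF i nsubsets_finite[OF less.prems]] by simp
    ultimately obtain a where "geo S (hop i T) a" using less.hyps by blast
    then show ?thesis using geo.step less.prems i by blast
  qed
qed

text \<open>Two last steps of shortest paths across distant gaps: from \<open>T\<close> one may hop back across both gaps, and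
  a shortest path to the configuration reached in this way extends to each of the given two, up to
  the induction hypothesis \<open>unique\<close>.\<close>

lemma geo_diamond:
  assumes T: "T \<in> nsubsets n" and i: "closer n i S T" and j: "closer n j S T" and ij: "Suc i < j"
    and a: "geo S (hop i T) a" and b: "geo S (hop j T) b"
    and unique: "\<And>c d U. config_dist n S U < config_dist n S T \<Longrightarrow> geo S U c \<Longrightarrow> geo S U d \<Longrightarrow> c = d"
  shows "a \<otimes> G i = b \<otimes> G j"
proof -
  have fin: "finite T" by (rule nsubsets_finite[OF T])
  have i': "i \<in> {1..<2*n}" and j': "j \<in> {1..<2*n}" using i j by (auto simp: closer_def)
  have iT: "hop i T \<in> nsubsets n" and jT: "hop j T \<in> nsubsets n"
    using hop_nsubsets[OF T] i' j' by auto
  have jiT: "hop j (hop i T) \<in> nsubsets n" using hop_nsubsets[OF iT j'] .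
  obtain c where c: "geo S (hop j (hop i T)) c"
    using geo_exists jiT geo_props[OF a] by blast
  have cc: "c \<in> carrier B" using geo_props[OF c] by simp
  have "geo S (hop i T) (c \<otimes> G j)"
    using c iT closer_hop_far[OF j i' _ fin] ij by (intro geo.step) auto
  moreover have "config_dist n S (hop i T) < config_dist n S T"
    using closer_dist[OF i fin] by simp
  ultimately have "a = c \<otimes> G j" using unique a by blast
  moreover have "geo S (hop j T) (c \<otimes> G i)"
    using c jT closer_hop_far[OF i j' _ fin] ij hop_far[OF ij, of T] by (intro geo.step) auto
  moreover have "config_dist n S (hop j T) < config_dist n S T"
    using closer_dist[OF j fin] by simp
  ultimately have "a = c \<otimes> G j" "b = c \<otimes> G i" using unique b by blast+
  then show ?thesis
    using cc i' j' G_far[OF i' j' ij] by (simp add: m_assoc)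
qed

lemma geo_unique:
  assumes "geo S T a" "geo S T b"
  shows "a = b"
  using assms
proof (induction "config_dist n S T" arbitrary: T a b rule: less_induct)
  case less
  have S: "S \<in> nsubsets n" and T: "T \<in> nsubsets n" using geo_props[OF less.prems(1)] by auto
  have finS: "finite S" and finT: "finite T" using S T by (auto intro: nsubsets_finite)
  have no_step: "\<not> closer n i S S" for i
    using closer_dist[of n i S S, OF _ finS] by (auto simp: config_dist_self)
  from less.prems(1) show ?case
  proof cases
    case refl
    from less.prems(2) show ?thesis
      by cases (use refl no_step in auto)
  next
    case i: (step i a')
    from less.prems(2) show ?thesis
    proof cases
      case refl
      then show ?thesis using i no_step by auto
    next
      case j: (step j b')
      consider "i = j" | "Suc i < j" | "Suc j < i"
        using closer_far[OF i(4) j(4) _ finS finT] by blast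
      then show ?thesis
      proof cases
        case 1
        moreover have "config_dist n S (hop i T) < config_dist n S T"
          using closer_dist[OF i(4) finT] by simp
        ultimately have "a' = b'" using less.hyps i(2) j(2) by blast
        then show ?thesis using i j 1 by simp
      next
        case 2
        then show ?thesis
          using geo_diamond[OF T i(4) j(4) _ i(2) j(2)] less.hyps i(1) j(1) by blast
      next
        case 3
        then show ?thesis
          using geo_diamond[OF T j(4) i(4) _ j(2) i(2)] less.hyps i(1) j(1) by metis
      qed
    qed
  qed
qed

definition E :: "nat set \<Rightarrow> nat set \<Rightarrow> 'b" where
  "E S T = (THE a. geo S T a)"

lemma E_eqI: "geo S T a \<Longrightarrow> E S T = a"
  unfolding E_def by (rule the_equality) (auto intro: geo_unique)

lemma geo_E: "S \<in> nsubsets n \<Longrightarrow> T \<in> nsubsets n \<Longrightarrow> geo S T (E S T)"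
  using geo_exists[of S T] E_eqI by auto

lemma E_closed [simp]: "S \<in> nsubsets n \<Longrightarrow> T \<in> nsubsets n \<Longrightarrow> E S T \<in> carrier B"
  and J_E: "S \<in> nsubsets n \<Longrightarrow> T \<in> nsubsets n \<Longrightarrow> J S \<otimes> E S T = E S T"
  and E_J: "S \<in> nsubsets n \<Longrightarrow> T \<in> nsubsets n \<Longrightarrow> E S T \<otimes> J T = E S T"
  using geo_props[OF geo_E] by auto

lemma E_self: "S \<in> nsubsets n \<Longrightarrow> E S S = J S"
  by (rule E_eqI[OF geo.refl])

lemma E_step:
  assumes "S \<in> nsubsets n" "T \<in> nsubsets n" "closer n i S T"
  shows "E S T = E S (hop i T) \<otimes> G i"
proof -
  have "hop i T \<in> nsubsets n" using assms by (auto simp: closer_def intro: hop_nsubsets)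
  then show ?thesis using assms by (intro E_eqI geo.step geo_E)
qed

text \<open>If the hop leads back towards \<open>S\<close>, it cancels the last step of a shortest path and leaves \<open>u\<^sub>i\<close>;
  otherwise it prolongs the path.\<close>

lemma E_G:
  assumes S: "S \<in> nsubsets n" and T: "T \<in> nsubsets n" and i: "i \<in> {1..<2*n}" "movable i T"
  shows "E S T \<otimes> G i = s (wt n S T (hop i T)) \<otimes> E S (hop i T)"
proof -
  have T': "hop i T \<in> nsubsets n" using hop_nsubsets[OF T i(1)] .
  have fin: "finite T" by (rule nsubsets_finite[OF T])
  have u: "uvar i \<in> Upoly (2*n)" using i by (intro Upoly_uvar) auto
  show ?thesis
  proof (cases "closer n i S T")
    case True
    have "E S T \<otimes> G i = E S (hop i T) \<otimes> (G i \<otimes> G i)"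
      using E_step[OF S T True] S T' i by (simp add: m_assoc)
    also have "\<dots> = E S (hop i T) \<otimes> (J (hop i T) \<otimes> (G i \<otimes> G i))"
      using S T' i by (simp add: E_J flip: m_assoc)
    also have "\<dots> = E S (hop i T) \<otimes> (s (uvar i) \<otimes> J (hop i T))"
      using J_G_G[OF T' i(1)] i by simp
    also have "\<dots> = s (uvar i) \<otimes> (E S (hop i T) \<otimes> J (hop i T))"
      using S T' u scalar_central[OF u, of "E S (hop i T)"] by (simp flip: m_assoc)
    also have "\<dots> = s (uvar i) \<otimes> E S (hop i T)"
      using S T' by (simp add: E_J)
    finally show ?thesis using wt_hop[OF i fin] True by simp
  next
    case False
    then have "closer n i S (hop i T)" using closer_or_hop_closer[OF i fin] by blast
    then show ?thesis
      using E_step[OF S T'] False wt_hop[OF i fin] S T T' i by simp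
  qed
qed

text \<open>The second factor is built up hop by hop with \<open>E_G\<close>; the cocycle identity collects the weights, and
  the weight inside the second factor is 1 since each hop leads away from \<open>T\<close>.\<close>

lemma E_mult:
  assumes S: "S \<in> nsubsets n" and T: "T \<in> nsubsets n" and V: "V \<in> nsubsets n"
  shows "E S T \<otimes> E T V = s (wt n S T V) \<otimes> E S V"
  using V
proof (induction "config_dist n T V" arbitrary: V rule: less_induct)
  case less
  show ?case
  proof (cases "T = V")
    case True
    then show ?thesis using S T E_self E_J by simp
  next
    case False
    then obtain i where i: "closer n i T V" using exists_closer T less.prems by blast
    then have i': "i \<in> {1..<2*n}" "movable i (hop i V)" by (auto simp: closer_def)
    let ?V = "hop i V"
    have V': "?V \<in> nsubsets n" using hop_nsubsets[OF less.prems i'(1)] .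
    have fin: "finite V" by (rule nsubsets_finite[OF less.prems])
    have "config_dist n T ?V < config_dist n T V"
      using closer_dist[OF i fin] by simp
    then have IH: "E S T \<otimes> E T ?V = s (wt n S T ?V) \<otimes> E S ?V" using less.hyps V' by blast
    have "E S T \<otimes> E T V = (E S T \<otimes> E T ?V) \<otimes> G i"
      using E_step[OF T less.prems i] S T V' i' by (simp add: m_assoc)
    also have "\<dots> = s (wt n S T ?V) \<otimes> (E S ?V \<otimes> G i)"
      unfolding IH using S V' i' by (simp add: m_assoc)
    also have "\<dots> = s (wt n S T ?V) \<otimes> (s (wt n S ?V V) \<otimes> E S V)"
      using E_G[OF S V' i'] by simp
    also have "\<dots> = s (wt n S T ?V * wt n S ?V V) \<otimes> E S V"
      using S less.prems by (simp add: scalar_mult m_assoc)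
    also have "wt n S T ?V * wt n S ?V V = wt n S T V"
      by (simp add: wt_cocycle wt_closer[OF i fin])
    finally show ?thesis .
  qed
qed

lemma E_mult_neq:
  assumes "S \<in> nsubsets n" "T \<in> nsubsets n" "T' \<in> nsubsets n" "V \<in> nsubsets n" "T \<noteq> T'"
  shows "E S T \<otimes> E T' V = \<zero>"
proof -
  have "E S T \<otimes> E T' V = E S T \<otimes> J T \<otimes> (J T' \<otimes> E T' V)"
    using assms by (simp add: E_J J_E)
  also have "\<dots> = E S T \<otimes> (J T \<otimes> J T') \<otimes> E T' V"
    using assms by (simp add: m_assoc)
  also have "\<dots> = \<zero>" using assms by (simp add: J_J)
  finally show ?thesis .
qed

definition rep :: "strand_elt \<Rightarrow> 'b" where
  "rep = lin (\<lambda>P. E (dom P) (ran P))"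

lemma rep_values: "(\<lambda>P. E (dom P) (ran P)) \<in> mono_bij n \<rightarrow> carrier B"
  using mono_bijD by auto

lemma rep_el: "S \<in> nsubsets n \<Longrightarrow> T \<in> nsubsets n \<Longrightarrow> rep (el n S T) = E S T"
  unfolding rep_def el_def using mb[of S n T] by (simp add: lin_basis[OF rep_values])

lemma rep_add: "f \<in> fmod (2*n) (mono_bij n) \<Longrightarrow> g \<in> fmod (2*n) (mono_bij n) \<Longrightarrow>
    rep (\<lambda>x. f x + g x) = rep f \<oplus> rep g"
  unfolding rep_def by (rule lin_add[OF rep_values])

lemma rep_sum_fun:
  "finite Y \<Longrightarrow> (\<And>y. y \<in> Y \<Longrightarrow> f y \<in> fmod (2*n) (mono_bij n)) \<Longrightarrow>
    rep (sum_fun f Y) = (\<Oplus>y\<in>Y. rep (f y))"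
proof (induction Y rule: finite_induct)
  case empty
  then show ?case by (simp add: rep_def lin_zero[OF rep_values])
next
  case (insert y Y)
  have closed: "(\<lambda>y. rep (f y)) \<in> insert y Y \<rightarrow> carrier B"
    using insert.prems lin_closed[OF rep_values] by (auto simp: rep_def)
  have "rep (sum_fun f (insert y Y)) = rep (f y) \<oplus> rep (sum_fun f Y)"
    using insert by (simp add: sum_fun_insert rep_add fmod_sum_fun)
  also have "\<dots> = rep (f y) \<oplus> (\<Oplus>y\<in>Y. rep (f y))"
    using insert by simp
  also have "\<dots> = (\<Oplus>y\<in>insert y Y. rep (f y))"
    using insert.hyps closed by (intro finsum_insert[symmetric]) auto
  finally show ?case .
qed

text \<open>Products of basis elements are matched by \<open>E_mult\<close>, and the unit by the sum of the idempotents.\<close>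

theorem rep_hom: "rep \<in> ring_hom (strand_alg n) B"
  unfolding rep_def
proof (rule lin_ring_hom[OF rep_values strand_based])
  fix P Q assume P: "P \<in> mono_bij n" and Q: "Q \<in> mono_bij n"
  note D = mono_bijD(1,2)[OF P] mono_bijD(1,2)[OF Q]
  show "lin (\<lambda>P. E (dom P) (ran P)) (basis P \<otimes>\<^bsub>strand_alg n\<^esub> basis Q) =
      E (dom P) (ran P) \<otimes> E (dom Q) (ran Q)"
  proof (cases "ran P = dom Q")
    case True
    then show ?thesis
      using P Q D mono_bij_comp[OF P Q True]
      by (simp add: strand_alg_simps strand_mult_basis lin_smul_basis[OF rep_values] E_mult[symmetric])
  next
    case False
    then show ?thesis
      using P Q D by (simp add: strand_alg_simps strand_mult_basis lin_zero[OF rep_values] E_mult_neq)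
  qed
next
  have "rep (sum_fun iota (nsubsets n)) = (\<Oplus>S\<in>nsubsets n. rep (iota S))"
    by (intro rep_sum_fun iota_fmod) simp_all
  also have "\<dots> = (\<Oplus>S\<in>nsubsets n. J S)"
    by (rule finsum_cong') (auto simp: iota_eq_el rep_el E_self)
  finally show "lin (\<lambda>P. E (dom P) (ran P)) \<one>\<^bsub>strand_alg n\<^esub> = \<one>"
    by (simp add: strand_alg_simps J_sum rep_def)
qed

lemma rep_scalar: "c \<in> Upoly (2*n) \<Longrightarrow> rep (smul c \<one>\<^bsub>strand_alg n\<^esub>) = s c"
  using ring_hom_one[OF rep_hom] based_algebra.one_fmod[OF strand_based, of n]
  by (simp add: rep_def lin_smul[OF rep_values])

lemma rep_smul: "c \<in> Upoly (2*n) \<Longrightarrow> f \<in> fmod (2*n) (mono_bij n) \<Longrightarrow> rep (smul c f) = s c \<otimes> rep f"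
  by (simp add: rep_def lin_smul[OF rep_values])

lemma E_hop:
  assumes S: "S \<in> nsubsets n" and i: "i \<in> {1..<2*n}" "movable i S"
  shows "E S (hop i S) = J S \<otimes> G i"
  using E_G[OF S S i] hop_nsubsets[OF S i(1)] S by (simp add: E_self)

lemma rep_hops:
  assumes i: "i \<in> {1..<2*n}" and Y: "Y \<subseteq> {S \<in> nsubsets n. movable i S}"
  shows "rep (hops n i Y) = (\<Oplus>S\<in>Y. J S \<otimes> G i)"
proof -
  have fin: "finite Y" by (rule finite_subset[OF Y]) simp
  have N: "S \<in> nsubsets n" "hop i S \<in> nsubsets n" "movable i S" if "S \<in> Y" for S
    using that Y hop_nsubsets i by auto
  have "rep (hops n i Y) = (\<Oplus>S\<in>Y. rep (el n S (hop i S)))"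
    unfolding hops_def using fin N by (intro rep_sum_fun el_fmod)
  also have "\<dots> = (\<Oplus>S\<in>Y. J S \<otimes> G i)"
    by (rule finsum_cong') (use N i in \<open>auto simp: rep_el E_hop\<close>)
  finally show ?thesis .
qed

end

section \<open>Free algebras\<close>

lemma free_alg_simps:
  "carrier (free_alg m G) = fmod m {w. set w \<subseteq> G}"
  "f \<otimes>\<^bsub>free_alg m G\<^esub> g = (\<lambda>w. \<Sum>k \<le> length w. f (take k w) * g (drop k w))"
  "\<one>\<^bsub>free_alg m G\<^esub> = basis []" "\<zero>\<^bsub>free_alg m G\<^esub> = (\<lambda>w. 0)"
  "f \<oplus>\<^bsub>free_alg m G\<^esub> g = (\<lambda>w. f w + g w)"
  by (simp_all add: free_alg_def fmod_def)

lemma free_mult_basis: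
  "basis u \<otimes>\<^bsub>free_alg m G\<^esub> basis v = basis (u @ v)"
proof
  fix w
  have "basis u (take k w) * basis v (drop k w) = (if k = length u \<and> w = u @ v then 1 else 0)"
    if "k \<le> length w" for k
  proof (cases "take k w = u \<and> drop k w = v")
    case True
    then have "w = u @ v" using append_take_drop_id[of k w] by simp
    moreover have "k = length u" using True that by (metis length_take min_absorb2)
    ultimately have "w = u @ v" "k = length u" by simp_all
    then show ?thesis by (simp add: basis_def)
  next
    case False
    then show ?thesis by (auto simp: basis_def)
  qed
  then have "(\<Sum>k\<le>length w. basis u (take k w) * basis v (drop k w)) =
      (\<Sum>k\<le>length w. if k = length u then (if w = u @ v then 1 else 0) else 0)"
    by (intro sum.cong refl) auto
  also have "\<dots> = basis (u @ v) w"
    by (auto simp: basis_def sum.delta)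
  finally show "(basis u \<otimes>\<^bsub>free_alg m G\<^esub> basis v) w = basis (u @ v) w"
    by (simp add: free_alg_simps)
qed

lemma free_based: "based_algebra (free_alg m G) m {w. set w \<subseteq> G}"
proof
  fix f g h :: "'a list \<Rightarrow> upoly" and c
  show "(\<lambda>x. f x + g x) \<otimes>\<^bsub>free_alg m G\<^esub> h = (\<lambda>x. (f \<otimes>\<^bsub>free_alg m G\<^esub> h) x + (g \<otimes>\<^bsub>free_alg m G\<^esub> h) x)"
    by (simp add: free_alg_simps distrib_right sum.distrib)
  show "h \<otimes>\<^bsub>free_alg m G\<^esub> (\<lambda>x. f x + g x) = (\<lambda>x. (h \<otimes>\<^bsub>free_alg m G\<^esub> f) x + (h \<otimes>\<^bsub>free_alg m G\<^esub> g) x)"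
    by (simp add: free_alg_simps distrib_left sum.distrib)
  show "smul c f \<otimes>\<^bsub>free_alg m G\<^esub> g = smul c (f \<otimes>\<^bsub>free_alg m G\<^esub> g)"
    "f \<otimes>\<^bsub>free_alg m G\<^esub> smul c g = smul c (f \<otimes>\<^bsub>free_alg m G\<^esub> g)"
    by (simp_all add: free_alg_simps smul_def sum_distrib_left mult_ac)
qed (simp_all add: free_alg_simps(1,3,4,5) free_mult_basis fmod_basis)

text \<open>The universal property of the free algebra: a word goes to the product of the values of its
  letters.\<close>

lemma (in central_algebra) free_lift:
  assumes \<gamma>: "\<gamma> \<in> G \<rightarrow> carrier B"
  obtains h where "h \<in> ring_hom (free_alg m G) B"
    "\<And>c. c \<in> Upoly m \<Longrightarrow> h (smul c \<one>\<^bsub>free_alg m G\<^esub>) = s c"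
    "\<And>g. g \<in> G \<Longrightarrow> h (basis [g]) = \<gamma> g"
proof -
  define v where "v w = foldr (\<lambda>g a. \<gamma> g \<otimes> a) w \<one>" for w
  have closed: "v w \<in> carrier B" if "set w \<subseteq> G" for w
    using that by (induction w) (use \<gamma> in \<open>auto simp: v_def\<close>)
  have v: "v \<in> {w. set w \<subseteq> G} \<rightarrow> carrier B" using closed by auto
  have app: "v (u @ w) = v u \<otimes> v w" if "set u \<subseteq> G" "set w \<subseteq> G" for u w
    using that(1)
  proof (induction u)
    case Nil
    then show ?case using closed[OF that(2)] by (simp add: v_def)
  next
    case (Cons g u)
    have "v ((g # u) @ w) = \<gamma> g \<otimes> v (u @ w)" "v (g # u) = \<gamma> g \<otimes> v u" by (simp_all add: v_def)
    then show ?case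
      using Cons closed[of u] closed[OF that(2)] \<gamma> by (simp add: m_assoc Pi_iff)
  qed
  show ?thesis
  proof
    show "lin v \<in> ring_hom (free_alg m G) B"
      by (rule lin_ring_hom[OF v free_based])
        (simp_all add: free_mult_basis lin_basis[OF v] app free_alg_simps(3), simp add: v_def)
    show "lin v (smul c \<one>\<^bsub>free_alg m G\<^esub>) = s c" if "c \<in> Upoly m" for c
      using that lin_smul_basis[OF v, of "[]" c] by (simp add: free_alg_simps(3) v_def)
    show "lin v (basis [g]) = \<gamma> g" if "g \<in> G" for g
      using that lin_basis[OF v, of "[g]"] \<gamma> by (simp add: v_def Pi_iff)
  qed
qed

lemma free_hom_eqI:
  assumes "ring B" and \<phi>: "\<phi> \<in> ring_hom (free_alg m G) B" and \<psi>: "\<psi> \<in> ring_hom (free_alg m G) B"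
    and "\<And>c. c \<in> Upoly m \<Longrightarrow> \<phi> (smul c \<one>\<^bsub>free_alg m G\<^esub>) = \<psi> (smul c \<one>\<^bsub>free_alg m G\<^esub>)"
    and gen: "\<And>g. g \<in> G \<Longrightarrow> \<phi> (basis [g]) = \<psi> (basis [g])"
    and "f \<in> carrier (free_alg m G)"
  shows "\<phi> f = \<psi> f"
proof -
  interpret F: based_algebra "free_alg m G" m "{w. set w \<subseteq> G}" by (rule free_based)
  have word: "\<phi> (basis w) = \<psi> (basis w)" if "set w \<subseteq> G" for w
    using that
  proof (induction w)
    case Nil
    then show ?case
      using ring_hom_one[OF \<phi>] ring_hom_one[OF \<psi>] by (simp add: free_alg_simps(3))
  next
    case (Cons g w)
    have "basis [g] \<in> carrier (free_alg m G)" "basis w \<in> carrier (free_alg m G)"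
      using Cons.prems by (auto simp: free_alg_simps(1) intro!: fmod_basis)
    moreover have "basis (g # w) = basis [g] \<otimes>\<^bsub>free_alg m G\<^esub> basis w"
      by (simp add: free_mult_basis)
    ultimately show ?case
      using Cons gen[of g] ring_hom_mult[OF \<phi>] ring_hom_mult[OF \<psi>] by simp
  qed
  show ?thesis
  proof (rule F.hom_eqI[OF assms(1) \<phi> \<psi> assms(4)])
    show "\<phi> (basis w) = \<psi> (basis w)" if "w \<in> {w. set w \<subseteq> G}" for w
      using that by (simp add: word)
  qed (use assms(6) in \<open>simp_all add: free_alg_simps(1)\<close>)
qed

section \<open>Particles and holes\<close>

definition holes :: "nat \<Rightarrow> nat set \<Rightarrow> nat set" where
  "holes n S = {1..2*n} - S"

lemma local_states_eq: "local_states (2*n + 1) n = nsubsets n"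
  by (simp add: local_states_def nsubsets_def)

lemmas local_states_Suc = local_states_eq[unfolded Suc_eq_plus1[symmetric]]

lemma holes_nsubsets [intro]: "S \<in> nsubsets n \<Longrightarrow> holes n S \<in> nsubsets n"
  using card_Diff_subset[of S "{1..2*n}"] nsubsets_finite[of S n]
  by (auto simp: holes_def nsubsets_def)

lemma holes_holes: "S \<in> nsubsets n \<Longrightarrow> holes n (holes n S) = S"
  by (auto simp: holes_def nsubsets_def)

lemma bij_holes: "bij_betw (holes n) (nsubsets n) (nsubsets n)"
  by (rule bij_betw_byWitness[of _ "holes n"]) (auto simp: holes_holes)

lemma holes_mem: "i \<in> {1..2*n} \<Longrightarrow> i \<in> holes n S \<longleftrightarrow> i \<notin> S"
  by (auto simp: holes_def)

lemma holes_hop: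
  assumes "i \<in> {1..<2*n}"
  shows "holes n (hop i S) = hop i (holes n S)"
proof -
  have "x \<in> holes n (hop i S) \<longleftrightarrow> x \<in> hop i (holes n S)" for x
    using assms by (cases "x = i \<or> x = Suc i") (auto simp: holes_def hop_mem)
  then show ?thesis by blast
qed

lemma r_defined_Suc: "r_defined (Suc i) x \<longleftrightarrow> i \<in> x \<and> Suc i \<notin> x"
  and l_defined_Suc: "l_defined (Suc i) x \<longleftrightarrow> i \<notin> x \<and> Suc i \<in> x"
proof -
  have "x \<inter> {i, Suc i} = {i} \<longleftrightarrow> i \<in> x \<and> Suc i \<notin> x"
    by (simp add: Int_insert_right)
  moreover have "x \<inter> {i, Suc i} = {Suc i} \<longleftrightarrow> i \<notin> x \<and> Suc i \<in> x"
    by (simp add: Int_insert_right)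
  ultimately show "r_defined (Suc i) x \<longleftrightarrow> i \<in> x \<and> Suc i \<notin> x"
    "l_defined (Suc i) x \<longleftrightarrow> i \<notin> x \<and> Suc i \<in> x"
    unfolding r_defined_def l_defined_def diff_Suc_1 by simp_all
qed

lemma r_move_Suc: "r_defined (Suc i) x \<Longrightarrow> r_move (Suc i) x = hop i x"
  and l_move_Suc: "l_defined (Suc i) x \<Longrightarrow> l_move (Suc i) x = hop i x"
  by (simp_all add: r_defined_Suc l_defined_Suc r_move_def l_move_def hop_right hop_left)

text \<open>The indices of the variables of the two algebras differ by one.  Lowering the indices kills \<open>u\<^sub>1\<close>, and
  that is consistent because \<open>u\<^sub>1\<close> is zero in the quotient.\<close>

definition raise_vars :: "upoly \<Rightarrow> upoly" where
  "raise_vars = subst (\<lambda>i. uvar (Suc i))"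

definition lower_vars :: "upoly \<Rightarrow> upoly" where
  "lower_vars = subst (\<lambda>i. if i = 1 then 0 else uvar (i - 1))"

lemma raise_vars_hom: "raise_vars \<in> ring_hom (coeff_ring (2*n)) (coeff_ring (2*n + 1))"
  unfolding raise_vars_def by (rule subst_ring_hom) (auto intro!: Upoly_uvar)

lemma lower_vars_hom: "lower_vars \<in> ring_hom (coeff_ring (2*n + 1)) (coeff_ring (2*n))"
  unfolding lower_vars_def by (rule subst_ring_hom) (auto intro!: Upoly_uvar)

lemma raise_vars_Upoly: "c \<in> Upoly (2*n) \<Longrightarrow> raise_vars c \<in> Upoly (2*n + 1)"
  using ring_hom_closed[OF raise_vars_hom] by simp

lemma lower_vars_Upoly: "c \<in> Upoly (2*n + 1) \<Longrightarrow> lower_vars c \<in> Upoly (2*n)"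
  using ring_hom_closed[OF lower_vars_hom] by simp

lemma lower_raise: "c \<in> Upoly (2*n) \<Longrightarrow> lower_vars (raise_vars c) = c"
  by (induction rule: Upoly_induct)
    (auto simp: lower_vars_def raise_vars_def subst_const subst_uvar subst_add subst_mult)

section \<open>The strand algebra acts through the local-state algebra\<close>

abbreviation os_free :: "nat \<Rightarrow> (gen list \<Rightarrow> upoly) ring" where
  "os_free n \<equiv> free_alg (2*n + 1) (gens (2*n + 1) n)"

text \<open>A quotient of the free algebra in which the relations of the local-state algebra and \<open>u\<^sub>1 = 0\<close> hold.
  It is made into a representation by hopping particles.\<close>

locale os_quotient = ring B for B :: "('b, 'd) ring_scheme" (structure) +
  fixes n :: nat and q :: "(gen list \<Rightarrow> upoly) \<Rightarrow> 'b"
  assumes q_hom: "q \<in> ring_hom (os_free n) B"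
    and q_surj: "b \<in> carrier B \<Longrightarrow> \<exists>a\<in>carrier (os_free n). b = q a"
    and q_rels: "(f, g) \<in> B_rels (2*n + 1) n \<Longrightarrow> q f = q g"
    and q_u1: "q (smul (uvar 1) (basis [])) = \<zero>"
begin

abbreviation F where
  "F \<equiv> os_free n"

sublocale F: based_algebra F "2*n + 1" "{w. set w \<subseteq> gens (2*n + 1) n}"
  by (rule free_based)

lemma free_scalar_hom: "(\<lambda>c. q (smul c (basis []))) \<in> ring_hom (coeff_ring (2*n + 1)) B"
  using ring_hom_trans[OF F.scalar_hom q_hom] by (simp add: comp_def free_alg_simps(3))

definition sc :: "upoly \<Rightarrow> 'b" where
  "sc c = q (smul (raise_vars c) (basis []))"

sublocale central_algebra B "2*n" sc
proof -
  have "central_algebra B (2*n) (\<lambda>c. q (smul (raise_vars c) \<one>\<^bsub>F\<^esub>))"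
    using q_surj by (intro F.central_algebra_quotient ring_axioms q_hom raise_vars_hom)
  then show "central_algebra B (2*n) sc" by (simp add: sc_def[abs_def] free_alg_simps(3))
qed

lemma word_fmod: "set w \<subseteq> gens (2*n + 1) n \<Longrightarrow> basis w \<in> carrier F"
  unfolding F.carrier_eq by (intro fmod_basis) simp

lemma q_closed: "a \<in> carrier F \<Longrightarrow> q a \<in> carrier B"
  by (rule ring_hom_closed[OF q_hom])

lemma q_zero [simp]: "q (\<lambda>w. 0) = \<zero>"
  using ring_hom_zero[OF q_hom F.is_ring ring_axioms] by (simp add: free_alg_simps(4))

definition I :: "nat set \<Rightarrow> 'b" where "I x = q (basis [GI x])"
definition R :: "nat \<Rightarrow> 'b" where "R i = q (basis [GR i])"
definition L :: "nat \<Rightarrow> 'b" where "L i = q (basis [GL i])"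

lemma gens_mem:
  "x \<in> nsubsets n \<Longrightarrow> GI x \<in> gens (2*n + 1) n"
  "i \<in> {1..<2*n} \<Longrightarrow> GR (Suc i) \<in> gens (2*n + 1) n"
  "i \<in> {1..<2*n} \<Longrightarrow> GL (Suc i) \<in> gens (2*n + 1) n"
  by (auto simp: gens_def local_states_Suc image_iff)

lemmas gens_Suc = gens_mem[unfolded Suc_eq_plus1[symmetric]]

lemma gen_closed [simp]:
  "x \<in> nsubsets n \<Longrightarrow> I x \<in> carrier B"
  "i \<in> {1..<2*n} \<Longrightarrow> R (Suc i) \<in> carrier B"
  "i \<in> {1..<2*n} \<Longrightarrow> L (Suc i) \<in> carrier B"
proof -
  show "x \<in> nsubsets n \<Longrightarrow> I x \<in> carrier B"
    unfolding I_def by (rule q_closed, rule word_fmod) (simp add: gens_Suc)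
  show "i \<in> {1..<2*n} \<Longrightarrow> R (Suc i) \<in> carrier B" "i \<in> {1..<2*n} \<Longrightarrow> L (Suc i) \<in> carrier B"
    unfolding R_def L_def by (rule q_closed, rule word_fmod, use gens_mem in simp)+
qed

lemma q_Cons:
  assumes "set (g # w) \<subseteq> gens (2*n + 1) n"
  shows "q (basis (g # w)) = q (basis [g]) \<otimes> q (basis w)"
proof -
  have "basis (g # w) = basis [g] \<otimes>\<^bsub>F\<^esub> basis w" by (simp add: free_mult_basis)
  then show ?thesis
    using assms ring_hom_mult[OF q_hom word_fmod word_fmod, of "[g]" w] by simp
qed

lemma q_smul:
  assumes "c \<in> Upoly (2*n)" "set w \<subseteq> gens (2*n + 1) n"
  shows "q (smul (raise_vars c) (basis w)) = sc c \<otimes> q (basis w)"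
proof -
  have f: "basis w \<in> fmod (2*n + 1) {w. set w \<subseteq> gens (2*n + 1) n}"
    using assms(2) by (intro fmod_basis) simp
  have c: "raise_vars c \<in> Upoly (2*n + 1)" by (rule raise_vars_Upoly[OF assms(1)])
  have "smul (raise_vars c) \<one>\<^bsub>F\<^esub> \<in> carrier F"
    unfolding F.carrier_eq by (intro fmod_smul c F.one_fmod)
  then show ?thesis
    using ring_hom_mult[OF q_hom, of "smul (raise_vars c) \<one>\<^bsub>F\<^esub>" "basis w"] word_fmod[OF assms(2)]
    by (simp add: F.smul_eq_mult(1)[OF c f] sc_def free_alg_simps(3))
qed

lemma raise_uvar: "raise_vars (uvar i) = uvar (Suc i)"
  by (simp add: raise_vars_def subst_uvar)

lemma gap_range: "i \<in> {1..<2*n} \<Longrightarrow> Suc i \<in> {2..2*n + 1 - 1}"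
  by auto

context
  fixes x :: "nat set" and i :: nat
  assumes x: "x \<in> nsubsets n" and i: "i \<in> {1..<2*n}"
begin

lemma x_state: "x \<in> local_states (2*n + 1) n"
  using x by (simp only: local_states_eq)

lemma hop_x: "hop i x \<in> nsubsets n"
  by (rule hop_nsubsets[OF x i])

lemma word_gens: "set [GI x, GR (Suc i), GL (Suc i), GI (hop i x)] \<subseteq> gens (2*n + 1) n"
  using gens_mem x i hop_x by simp

lemma I_R_0: "\<not> (i \<in> x \<and> Suc i \<notin> x) \<Longrightarrow> I x \<otimes> R (Suc i) = \<zero>"
  using q_rels[OF B1_R0[OF x_state gap_range[OF i]]] word_gens q_Cons[of "GI x" "[GR (Suc i)]"]
  by (simp add: r_defined_Suc I_def R_def)

lemma I_L_0: "\<not> (i \<notin> x \<and> Suc i \<in> x) \<Longrightarrow> I x \<otimes> L (Suc i) = \<zero>"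
  using q_rels[OF B1_L0[OF x_state gap_range[OF i]]] word_gens q_Cons[of "GI x" "[GL (Suc i)]"]
  by (simp add: l_defined_Suc I_def L_def)

lemma I_R:
  assumes "i \<in> x" "Suc i \<notin> x"
  shows "I x \<otimes> R (Suc i) = I x \<otimes> R (Suc i) \<otimes> I (hop i x)"
    "I x \<otimes> (R (Suc i) \<otimes> L (Suc i)) = sc (uvar i) \<otimes> I x"
proof -
  have d: "r_defined (Suc i) x" using assms by (simp add: r_defined_Suc)
  have u: "uvar i \<in> Upoly (2*n)" using i by (intro Upoly_uvar) auto
  show "I x \<otimes> R (Suc i) = I x \<otimes> R (Suc i) \<otimes> I (hop i x)"
  proof -
    have "I x \<otimes> R (Suc i) = I x \<otimes> (R (Suc i) \<otimes> I (hop i x))"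
      using q_rels[OF B1_R'[OF x_state gap_range[OF i] d]] word_gens
      by (simp add: r_move_Suc[OF d] q_Cons[of _ "_ # _"] I_def[symmetric] R_def[symmetric])
    then show ?thesis using x i hop_x by (subst m_assoc) simp_all
  qed
  show "I x \<otimes> (R (Suc i) \<otimes> L (Suc i)) = sc (uvar i) \<otimes> I x"
    using q_rels[OF B2_R[OF x_state gap_range[OF i] d]] word_gens x i q_smul[OF u, of "[GI x]"]
    by (simp add: q_Cons[of _ "_ # _"] raise_uvar I_def[symmetric] R_def[symmetric] L_def[symmetric])
qed

lemma I_L:
  assumes "i \<notin> x" "Suc i \<in> x"
  shows "I x \<otimes> L (Suc i) = I x \<otimes> L (Suc i) \<otimes> I (hop i x)"
    "I x \<otimes> (L (Suc i) \<otimes> R (Suc i)) = sc (uvar i) \<otimes> I x"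
proof -
  have d: "l_defined (Suc i) x" using assms by (simp add: l_defined_Suc)
  have u: "uvar i \<in> Upoly (2*n)" using i by (intro Upoly_uvar) auto
  show "I x \<otimes> L (Suc i) = I x \<otimes> L (Suc i) \<otimes> I (hop i x)"
  proof -
    have "I x \<otimes> L (Suc i) = I x \<otimes> (L (Suc i) \<otimes> I (hop i x))"
      using q_rels[OF B1_L'[OF x_state gap_range[OF i] d]] word_gens
      by (simp add: l_move_Suc[OF d] q_Cons[of _ "_ # _"] I_def[symmetric] L_def[symmetric])
    then show ?thesis using x i hop_x by (subst m_assoc) simp_all
  qed
  show "I x \<otimes> (L (Suc i) \<otimes> R (Suc i)) = sc (uvar i) \<otimes> I x"
    using q_rels[OF B2_L[OF x_state gap_range[OF i] d]] word_gens x i q_smul[OF u, of "[GI x]"]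
    by (simp add: q_Cons[of _ "_ # _"] raise_uvar I_def[symmetric] R_def[symmetric] L_def[symmetric])
qed

lemma u_I_0:
  assumes "i \<notin> x" "Suc i \<notin> x"
  shows "sc (uvar i) \<otimes> I x = \<zero>"
proof -
  have u: "uvar i \<in> Upoly (2*n)" using i by (intro Upoly_uvar) auto
  have "{Suc i - 1, Suc i} \<inter> x = {}" using assms by simp
  from q_rels[OF B4[OF x_state gap_range[OF i] this]] show ?thesis
    using q_smul[OF u, of "[GI x]"] word_gens
    by (simp add: raise_uvar I_def)
qed

end

definition J :: "nat set \<Rightarrow> 'b" where "J S = I (holes n S)"
definition G :: "nat \<Rightarrow> 'b" where "G i = R (Suc i) \<oplus> L (Suc i)"

lemma holes_i:
  assumes "i \<in> {1..<2*n}"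
  shows "i \<in> holes n S \<longleftrightarrow> i \<notin> S" "Suc i \<in> holes n S \<longleftrightarrow> Suc i \<notin> S"
  using assms by (simp_all add: holes_mem)

text \<open>With \<open>a\<close> and \<open>b\<close> the idempotents before and after a hop, only one direction \<open>l\<close> of the hop \<open>g\<close> is
  possible at \<open>a\<close>, and only the opposite direction \<open>r\<close> at \<open>b\<close>.\<close>

lemma two_steps:
  assumes "a \<in> carrier B" "b \<in> carrier B" "g \<in> carrier B" "l \<in> carrier B" "r \<in> carrier B"
    and g: "a \<otimes> g = a \<otimes> l" "b \<otimes> g = b \<otimes> r" and l: "a \<otimes> l = a \<otimes> l \<otimes> b"
  shows "a \<otimes> (g \<otimes> g) = a \<otimes> (l \<otimes> r)"
proof -
  have "a \<otimes> (g \<otimes> g) = (a \<otimes> l \<otimes> b) \<otimes> g"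
    using assms(1-5) by (simp add: g l[symmetric] flip: m_assoc)
  also have "\<dots> = a \<otimes> l \<otimes> b \<otimes> r"
    using assms(1-5) by (simp add: m_assoc g)
  also have "\<dots> = a \<otimes> (l \<otimes> r)"
    unfolding l[symmetric] using assms(1-5) by (simp add: m_assoc)
  finally show ?thesis .
qed

text \<open>A particle at \<open>i\<close> with a hole at \<open>i + 1\<close> hops right, that is, the hole moves left.\<close>

lemma J_G_eq:
  assumes S: "S \<in> nsubsets n" and i: "i \<in> {1..<2*n}"
  shows "i \<in> S \<Longrightarrow> Suc i \<notin> S \<Longrightarrow> J S \<otimes> G i = J S \<otimes> L (Suc i)"
    and "i \<notin> S \<Longrightarrow> Suc i \<in> S \<Longrightarrow> J S \<otimes> G i = J S \<otimes> R (Suc i)"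
  using I_R_0[OF holes_nsubsets[OF S] i] I_L_0[OF holes_nsubsets[OF S] i] holes_i[OF i, of S]
    holes_nsubsets[OF S] i
  by (simp_all add: J_def G_def r_distr)

lemma G_far:
  assumes i: "i \<in> {1..<2*n}" and j: "j \<in> {1..<2*n}" and ij: "Suc i < j"
  shows "G i \<otimes> G j = G j \<otimes> G i"
proof -
  note ii = gap_range[OF i] and jj = gap_range[OF j]
  have "Suc i + 1 < Suc j" using ij by simp
  note c = q_rels[OF comm_RR[OF ii jj this]] q_rels[OF comm_LL[OF ii jj this]]
    q_rels[OF comm_RL[OF ii jj disjI1[OF this]]] q_rels[OF comm_RL[OF jj ii disjI2[OF this]]]
  have "R (Suc i) \<otimes> R (Suc j) = R (Suc j) \<otimes> R (Suc i)" "L (Suc i) \<otimes> L (Suc j) = L (Suc j) \<otimes> L (Suc i)"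
    "R (Suc i) \<otimes> L (Suc j) = L (Suc j) \<otimes> R (Suc i)" "R (Suc j) \<otimes> L (Suc i) = L (Suc i) \<otimes> R (Suc j)"
    using c gens_mem i j by (simp_all add: q_Cons[of _ "_ # _"] R_def[symmetric] L_def[symmetric])
  then show ?thesis
    using i j by (simp add: G_def l_distr r_distr a_ac)
qed

lemma J_sum: "(\<Oplus>S\<in>nsubsets n. J S) = \<one>"
proof -
  have inj: "inj_on (holes n) (nsubsets n)" and im: "holes n ` nsubsets n = nsubsets n"
    using bij_holes[of n] by (auto simp: bij_betw_def)
  have "(\<Oplus>S\<in>nsubsets n. J S) = (\<Oplus>x\<in>holes n ` nsubsets n. I x)"
    unfolding J_def by (rule add.finprod_reindex[symmetric, OF _ inj]) (auto simp: im)
  also have "\<dots> = (\<Oplus>x\<in>nsubsets n. (q \<circ> (\<lambda>x. basis [GI x])) x)"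
    by (simp add: im I_def)
  also have "\<dots> = q (\<Oplus>\<^bsub>F\<^esub>x\<in>nsubsets n. basis [GI x])"
  proof -
    interpret q: ring_hom_ring F B q by (intro ring_hom_ringI2 F.is_ring ring_axioms q_hom)
    have "(\<lambda>x. basis [GI x]) \<in> nsubsets n \<rightarrow> carrier F"
      by (rule Pi_I, rule word_fmod) (simp add: gens_Suc)
    from q.hom_finsum[OF this] show ?thesis by (simp only: comp_def)
  qed
  also have "\<dots> = q (sum_fun (\<lambda>x. basis [GI x]) (nsubsets n))"
    using gens_mem by (subst F.sum_fun_eq_finsum) (auto intro!: fmod_basis)
  also have "\<dots> = q (basis [])"
    using q_rels[OF unit] by (simp add: local_states_Suc)
  also have "\<dots> = \<one>" using ring_hom_one[OF q_hom] by (simp add: free_alg_simps(3))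
  finally show ?thesis .
qed

lemma I_I: "x \<in> nsubsets n \<Longrightarrow> y \<in> nsubsets n \<Longrightarrow> I x \<otimes> I y = (if x = y then I x else \<zero>)"
proof -
  assume x: "x \<in> nsubsets n" and y: "y \<in> nsubsets n"
  then have "q (basis [GI x, GI y]) = q (if x = y then basis [GI x] else (\<lambda>w. 0))"
    by (intro q_rels idem) (simp_all only: local_states_eq)
  moreover have "q (basis [GI x, GI y]) = I x \<otimes> I y"
    using x y gens_Suc(1) by (simp add: q_Cons[of _ "_ # _"] I_def)
  ultimately show ?thesis by (simp add: I_def split: if_splits)
qed

sublocale hopping_rep B n sc J G
proof
  fix S T assume S: "S \<in> nsubsets n" and T: "T \<in> nsubsets n"
  have "holes n S = holes n T \<longleftrightarrow> S = T" using holes_holes S T by metis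
  then show "J S \<otimes> J T = (if S = T then J S else \<zero>)"
    using S T by (simp add: J_def I_I holes_nsubsets)
next
  fix S i assume S: "S \<in> nsubsets n" and i: "i \<in> {1..<2*n}" and m: "movable i S"
  let ?x = "holes n S"
  have x: "?x \<in> nsubsets n" using S by auto
  have hx: "hop i ?x \<in> nsubsets n" by (rule hop_nsubsets[OF x i])
  have hS: "hop i S \<in> nsubsets n" by (rule hop_nsubsets[OF S i])
  have JhS: "J (hop i S) = I (hop i ?x)" using holes_hop[OF i] by (simp add: J_def)
  have hm: "i \<in> hop i S \<longleftrightarrow> Suc i \<in> S" "Suc i \<in> hop i S \<longleftrightarrow> i \<in> S" by (simp_all add: hop_mem)
  have cl: "J S \<in> carrier B" "G i \<in> carrier B"
    using x i by (simp_all add: J_def G_def)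
  note c = x hx S i
  consider "i \<in> S" "Suc i \<notin> S" | "i \<notin> S" "Suc i \<in> S" using m by (auto simp: movable_def)
  then have "J S \<otimes> G i = J S \<otimes> G i \<otimes> J (hop i S) \<and> J S \<otimes> (G i \<otimes> G i) = sc (uvar i) \<otimes> J S"
  proof cases
    case 1
    then have A: "I ?x \<otimes> L (Suc i) = I ?x \<otimes> L (Suc i) \<otimes> I (hop i ?x)"
      and U: "I ?x \<otimes> (L (Suc i) \<otimes> R (Suc i)) = sc (uvar i) \<otimes> I ?x"
      using I_L[OF x i] holes_i[OF i, of S] by auto
    have g: "J S \<otimes> G i = I ?x \<otimes> L (Suc i)" using J_G_eq(1)[OF S i 1] by (simp add: J_def)
    have hr: "I (hop i ?x) \<otimes> G i = I (hop i ?x) \<otimes> R (Suc i)"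
      using J_G_eq(2)[OF hS i] hm 1 by (simp add: JhS)
    have "J S \<otimes> (G i \<otimes> G i) = I ?x \<otimes> (L (Suc i) \<otimes> R (Suc i))"
      unfolding J_def using cl c g hr A by (intro two_steps) (simp_all add: J_def)
    then have "J S \<otimes> (G i \<otimes> G i) = sc (uvar i) \<otimes> J S"
      unfolding U by (simp only: J_def)
    moreover have "J S \<otimes> G i = J S \<otimes> G i \<otimes> J (hop i S)"
      unfolding g JhS by (rule A)
    ultimately show ?thesis by blast
  next
    case 2
    then have A: "I ?x \<otimes> R (Suc i) = I ?x \<otimes> R (Suc i) \<otimes> I (hop i ?x)"
      and U: "I ?x \<otimes> (R (Suc i) \<otimes> L (Suc i)) = sc (uvar i) \<otimes> I ?x"
      using I_R[OF x i] holes_i[OF i, of S] by auto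
    have g: "J S \<otimes> G i = I ?x \<otimes> R (Suc i)" using J_G_eq(2)[OF S i 2] by (simp add: J_def)
    have hr: "I (hop i ?x) \<otimes> G i = I (hop i ?x) \<otimes> L (Suc i)"
      using J_G_eq(1)[OF hS i] hm 2 by (simp add: JhS)
    have "J S \<otimes> (G i \<otimes> G i) = I ?x \<otimes> (R (Suc i) \<otimes> L (Suc i))"
      unfolding J_def using cl c g hr A by (intro two_steps) (simp_all add: J_def)
    then have "J S \<otimes> (G i \<otimes> G i) = sc (uvar i) \<otimes> J S"
      unfolding U by (simp only: J_def)
    moreover have "J S \<otimes> G i = J S \<otimes> G i \<otimes> J (hop i S)"
      unfolding g JhS by (rule A)
    ultimately show ?thesis by blast
  qed
  then show "J S \<otimes> G i = J S \<otimes> G i \<otimes> J (hop i S)" "J S \<otimes> (G i \<otimes> G i) = sc (uvar i) \<otimes> J S"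
    by auto
next
  show "J S \<in> carrier B" if "S \<in> nsubsets n" for S
    using that by (simp add: J_def holes_nsubsets)
  show "G i \<in> carrier B" if "i \<in> {1..<2*n}" for i
    using that by (simp add: G_def)
qed (rule J_sum, erule (2) G_far)

lemma decompose:
  assumes a: "a \<in> carrier B"
  shows "a = (\<Oplus>S\<in>nsubsets n. J S \<otimes> a)"
proof -
  have "(\<Oplus>S\<in>nsubsets n. J S) \<otimes> a = (\<Oplus>S\<in>nsubsets n. J S \<otimes> a)"
    using a by (intro finsum_ldistr) auto
  then show ?thesis using a by (simp add: J_sum)
qed

text \<open>The idempotents \<open>J S\<close> add up to 1.\<close>

lemma eq_by_idempotents:
  assumes "a \<in> carrier B" "b \<in> carrier B" "\<And>S. S \<in> nsubsets n \<Longrightarrow> J S \<otimes> a = J S \<otimes> b"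
  shows "a = b"
proof -
  have "(\<Oplus>S\<in>nsubsets n. J S \<otimes> a) = (\<Oplus>S\<in>nsubsets n. J S \<otimes> b)"
    using assms by (intro finsum_cong') auto
  then show ?thesis using decompose assms by metis
qed

lemma J_finsum:
  assumes "Y \<subseteq> nsubsets n" "S \<in> nsubsets n" "\<And>T. T \<in> Y \<Longrightarrow> a T \<in> carrier B"
  shows "J S \<otimes> (\<Oplus>T\<in>Y. J T \<otimes> a T) = (if S \<in> Y then J S \<otimes> a S else \<zero>)"
proof -
  have fin: "finite Y" using assms(1) finite_nsubsets by (rule finite_subset)
  have Y: "T \<in> nsubsets n" if "T \<in> Y" for T using that assms(1) by auto
  have "J S \<otimes> (\<Oplus>T\<in>Y. J T \<otimes> a T) = (\<Oplus>T\<in>Y. J S \<otimes> (J T \<otimes> a T))"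
    using assms fin Y by (intro finsum_rdistr) auto
  also have "\<dots> = (\<Oplus>T\<in>Y. if S = T then J S \<otimes> a T else \<zero>)"
    using assms Y by (intro finsum_cong') (auto simp: J_J simp flip: m_assoc)
  also have "\<dots> = (if S \<in> Y then J S \<otimes> a S else \<zero>)"
  proof (cases "S \<in> Y")
    case True
    then show ?thesis
      using finsum_singleton[OF True fin, of "\<lambda>T. J S \<otimes> a T"] assms by auto
  next
    case False
    then have "(\<Oplus>T\<in>Y. if S = T then J S \<otimes> a T else \<zero>) = (\<Oplus>T\<in>Y. \<zero>)"
      by (intro finsum_cong') auto
    then show ?thesis using False by simp
  qed
  finally show ?thesis .
qed

lemma J_L: "S \<in> nsubsets n \<Longrightarrow> i \<in> {1..<2*n} \<Longrightarrow>
    J S \<otimes> L (Suc i) = (if i \<in> S \<and> Suc i \<notin> S then J S \<otimes> G i else \<zero>)"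
  using J_G_eq(1)[of S i] I_L_0[of "holes n S" i] holes_i[of i S] by (auto simp: J_def)

lemma J_R: "S \<in> nsubsets n \<Longrightarrow> i \<in> {1..<2*n} \<Longrightarrow>
    J S \<otimes> R (Suc i) = (if i \<notin> S \<and> Suc i \<in> S then J S \<otimes> G i else \<zero>)"
  using J_G_eq(2)[of S i] I_R_0[of "holes n S" i] holes_i[of i S] by (auto simp: J_def)

lemma rep_Rgen:
  assumes i: "i \<in> {1..<2*n}"
  shows "rep (Rgen n i) = L (Suc i)"
proof -
  let ?Y = "{S \<in> nsubsets n. i \<in> S \<and> Suc i \<notin> S}"
  have "rep (Rgen n i) = (\<Oplus>S\<in>?Y. J S \<otimes> G i)"
    unfolding Rgen_eq_hops[OF i] by (rule rep_hops[OF i]) (auto simp: movable_def)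
  also have "\<dots> = L (Suc i)"
  proof (rule eq_by_idempotents)
    show "(\<Oplus>S\<in>?Y. J S \<otimes> G i) \<in> carrier B"
      using i by (intro finsum_closed) auto
    show "J S \<otimes> (\<Oplus>S\<in>?Y. J S \<otimes> G i) = J S \<otimes> L (Suc i)" if "S \<in> nsubsets n" for S
      using that i by (subst J_finsum) (auto simp: J_L)
  qed (use i in simp)
  finally show ?thesis .
qed

lemma rep_Lgen:
  assumes i: "i \<in> {1..<2*n}"
  shows "rep (Lgen n i) = R (Suc i)"
proof -
  let ?Y = "{S \<in> nsubsets n. i \<notin> S \<and> Suc i \<in> S}"
  have "rep (Lgen n i) = (\<Oplus>S\<in>?Y. J S \<otimes> G i)"
    unfolding Lgen_eq_hops[OF i] by (rule rep_hops[OF i]) (auto simp: movable_def)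
  also have "\<dots> = R (Suc i)"
  proof (rule eq_by_idempotents)
    show "(\<Oplus>S\<in>?Y. J S \<otimes> G i) \<in> carrier B"
      using i by (intro finsum_closed) auto
    show "J S \<otimes> (\<Oplus>S\<in>?Y. J S \<otimes> G i) = J S \<otimes> R (Suc i)" if "S \<in> nsubsets n" for S
      using that i by (subst J_finsum) (auto simp: J_R)
  qed (use i in simp)
  finally show ?thesis .
qed

lemma rep_iota: "S \<in> nsubsets n \<Longrightarrow> rep (iota S) = J S"
  by (simp add: iota_eq_el rep_el E_self)

lemma rep_iota_at: "rep (iota_at n k) = (\<Oplus>S\<in>{S \<in> nsubsets n. k \<in> S}. J S \<otimes> \<one>)"
proof -
  have "rep (iota_at n k) = (\<Oplus>S\<in>{S \<in> nsubsets n. k \<in> S}. rep (iota S))"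
    unfolding iota_at_def by (rule rep_sum_fun) (simp_all add: iota_fmod)
  also have "\<dots> = (\<Oplus>S\<in>{S \<in> nsubsets n. k \<in> S}. J S \<otimes> \<one>)"
    by (rule finsum_cong') (auto simp: rep_iota)
  finally show ?thesis .
qed

lemma u_J_0:
  assumes "S \<in> nsubsets n" "i \<in> {1..<2*n}" "i \<in> S" "Suc i \<in> S"
  shows "sc (uvar i) \<otimes> J S = \<zero>"
  using u_I_0[OF holes_nsubsets[OF assms(1)] assms(2)] holes_i[OF assms(2), of S] assms by (simp add: J_def)

text \<open>At a configuration where the first hop is possible this is \<open>B2\<close>.  If both sites are filled, the
  left side vanishes since no hop is possible, and the right side vanishes by \<open>B4\<close>.  At the other
  configurations both sides are zero.\<close>

lemma LR_RL:
  assumes i: "i \<in> {1..<2*n}"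
  shows "L (Suc i) \<otimes> R (Suc i) = sc (uvar i) \<otimes> rep (iota_at n i)"
    "R (Suc i) \<otimes> L (Suc i) = sc (uvar i) \<otimes> rep (iota_at n (Suc i))"
proof -
  have u: "uvar i \<in> Upoly (2*n)" using i by (intro Upoly_uvar) auto
  have iota_closed: "rep (iota_at n k) \<in> carrier B" for k
    unfolding rep_iota_at by (intro finsum_closed) auto
  have J_iota: "J S \<otimes> (sc (uvar i) \<otimes> rep (iota_at n k)) = (if k \<in> S then sc (uvar i) \<otimes> J S else \<zero>)"
    if S: "S \<in> nsubsets n" for S k
  proof -
    have "J S \<otimes> (sc (uvar i) \<otimes> rep (iota_at n k)) = sc (uvar i) \<otimes> (J S \<otimes> rep (iota_at n k))"
      using S u iota_closed[of k] scalar_central[OF u, of "J S"] by (simp flip: m_assoc)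
    also have "J S \<otimes> rep (iota_at n k) = (if k \<in> S then J S else \<zero>)"
      unfolding rep_iota_at using S by (subst J_finsum) auto
    finally show ?thesis using u by simp
  qed
  have J_LR: "J S \<otimes> (L (Suc i) \<otimes> R (Suc i)) = (if i \<in> S then sc (uvar i) \<otimes> J S else \<zero>)"
    if S: "S \<in> nsubsets n" for S
  proof (cases "i \<in> S \<and> Suc i \<notin> S")
    case True
    then show ?thesis using I_L(2)[OF holes_nsubsets[OF S] i] holes_i[OF i, of S] by (simp add: J_def)
  next
    case False
    then have "J S \<otimes> L (Suc i) = \<zero>"
      unfolding J_L[OF S i] by auto
    then have "J S \<otimes> (L (Suc i) \<otimes> R (Suc i)) = \<zero>"
      using S i by (simp flip: m_assoc)
    then show ?thesis using False u_J_0[OF S i] by auto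
  qed
  have J_RL: "J S \<otimes> (R (Suc i) \<otimes> L (Suc i)) = (if Suc i \<in> S then sc (uvar i) \<otimes> J S else \<zero>)"
    if S: "S \<in> nsubsets n" for S
  proof (cases "i \<notin> S \<and> Suc i \<in> S")
    case True
    then show ?thesis using I_R(2)[OF holes_nsubsets[OF S] i] holes_i[OF i, of S] by (simp add: J_def)
  next
    case False
    then have "J S \<otimes> R (Suc i) = \<zero>"
      unfolding J_R[OF S i] by auto
    then have "J S \<otimes> (R (Suc i) \<otimes> L (Suc i)) = \<zero>"
      using S i by (simp flip: m_assoc)
    then show ?thesis using False u_J_0[OF S i] by auto
  qed
  show "L (Suc i) \<otimes> R (Suc i) = sc (uvar i) \<otimes> rep (iota_at n i)"
    by (rule eq_by_idempotents) (use i u iota_closed in \<open>simp_all add: J_LR J_iota\<close>)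
  show "R (Suc i) \<otimes> L (Suc i) = sc (uvar i) \<otimes> rep (iota_at n (Suc i))"
    by (rule eq_by_idempotents) (use i u iota_closed in \<open>simp_all add: J_RL J_iota\<close>)
qed

lemma rep_A_rels: "(a, b) \<in> A_rels n \<Longrightarrow> rep a = rep b"
proof -
  assume "(a, b) \<in> A_rels n"
  then obtain i where i: "i \<in> {1..2*n-1}" and
    "a = Rgen n i \<otimes>\<^bsub>strand_alg n\<^esub> Lgen n i \<and> b = smul (uvar i) (iota_at n i) \<or>
     a = Lgen n i \<otimes>\<^bsub>strand_alg n\<^esub> Rgen n i \<and> b = smul (uvar i) (iota_at n (Suc i))"
    by (auto simp: A_rels_def)
  moreover have i': "i \<in> {1..<2*n}" using i by auto
  moreover have "uvar i \<in> Upoly (2*n)" using i by (intro Upoly_uvar) auto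
  moreover note iota_at_fmod[of n _ "2*n"]
  ultimately show "rep a = rep b"
    using LR_RL[OF i'] gen_carrier(1,2)[OF i'] ring_hom_mult[OF rep_hom]
    by (auto simp: rep_smul rep_Rgen rep_Lgen)
qed

lemma rep_calA_rels:
  assumes "i \<in> {2..2*n-1}"
  shows "rep (Rgen n i) \<otimes> rep (Rgen n (i - 1)) = \<zero>" "rep (Lgen n (i - 1)) \<otimes> rep (Lgen n i) = \<zero>"
proof -
  have i: "i \<in> {1..<2*n}" "i - 1 \<in> {1..<2*n}" "Suc (i - 1) = i" using assms by auto
  have r: "i \<in> {2..2*n + 1 - 1}" "i + 1 \<in> {2..2*n + 1 - 1}" using assms by auto
  have g: "GR i \<in> gens (2*n+1) n" "GL i \<in> gens (2*n+1) n"
    "GR (Suc i) \<in> gens (2*n+1) n" "GL (Suc i) \<in> gens (2*n+1) n"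
    using gens_mem(2,3)[OF i(2)] gens_mem(2,3)[OF i(1)] i(3) by auto
  show "rep (Rgen n i) \<otimes> rep (Rgen n (i - 1)) = \<zero>"
    using q_rels[OF B3_L[OF r]] g i q_Cons[of "GL (Suc i)" "[GL i]"]
    by (simp add: rep_Rgen[OF i(1)] rep_Rgen[OF i(2)] i(3) L_def del: One_nat_def add: Suc_eq_plus1[symmetric])
  show "rep (Lgen n (i - 1)) \<otimes> rep (Lgen n i) = \<zero>"
    using q_rels[OF B3_R[OF r]] g i q_Cons[of "GR i" "[GR (Suc i)]"]
    by (simp add: rep_Lgen[OF i(1)] rep_Lgen[OF i(2)] i(3) R_def del: One_nat_def add: Suc_eq_plus1[symmetric])
qed

end

section \<open>The local-state algebra acts through the strand algebra\<close>

lemma iota_Rgen: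
  assumes "S \<in> nsubsets n" "i \<in> {1..<2*n}"
  shows "strand_mult n (iota S) (Rgen n i) =
    (if i \<in> S \<and> Suc i \<notin> S then el n S (hop i S) else (\<lambda>P. 0))"
  using assms el_hops[OF assms(2), of "{S \<in> nsubsets n. i \<in> S \<and> Suc i \<notin> S}" S S]
  by (simp add: iota_eq_el Rgen_eq_hops)

lemma iota_Lgen:
  assumes "S \<in> nsubsets n" "i \<in> {1..<2*n}"
  shows "strand_mult n (iota S) (Lgen n i) =
    (if i \<notin> S \<and> Suc i \<in> S then el n S (hop i S) else (\<lambda>P. 0))"
  using assms el_hops[OF assms(2), of "{S \<in> nsubsets n. i \<notin> S \<and> Suc i \<in> S}" S S]
  by (simp add: iota_eq_el Lgen_eq_hops)

lemma Rgen_iota: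
  assumes "S \<in> nsubsets n" "i \<in> {1..<2*n}" "i \<in> S" "Suc i \<notin> S"
  shows "strand_mult n (Rgen n i) (iota (hop i S)) = el n S (hop i S)"
  using assms hop_nsubsets[OF assms(1,2)]
    hops_el[OF assms(2), of "{S \<in> nsubsets n. i \<in> S \<and> Suc i \<notin> S}" "hop i S" "hop i S"]
  by (simp add: iota_eq_el Rgen_eq_hops)

lemma Lgen_iota:
  assumes "S \<in> nsubsets n" "i \<in> {1..<2*n}" "i \<notin> S" "Suc i \<in> S"
  shows "strand_mult n (Lgen n i) (iota (hop i S)) = el n S (hop i S)"
  using assms hop_nsubsets[OF assms(1,2)]
    hops_el[OF assms(2), of "{S \<in> nsubsets n. i \<notin> S \<and> Suc i \<in> S}" "hop i S" "hop i S"]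
  by (simp add: iota_eq_el Lgen_eq_hops)

lemma el_iota:
  "S \<in> nsubsets n \<Longrightarrow> T \<in> nsubsets n \<Longrightarrow> strand_mult n (el n S T) (iota T) = el n S T"
  by (simp add: iota_eq_el el_mult)

lemma wt_back:
  assumes "S \<in> nsubsets n" "i \<in> {1..<2*n}" "movable i S"
  shows "wt n S (hop i S) S = uvar i"
proof -
  have fin: "finite S" by (rule nsubsets_finite[OF assms(1)])
  have "\<not> closer n i S S"
    using closer_dist[of n i S S, OF _ fin] by (auto simp: config_dist_self)
  then have "closer n i S (hop i S)"
    using closer_or_hop_closer[OF assms(2,3) fin] by blast
  then show ?thesis
    using wt_hop[OF assms(2) _ hop_finite[OF fin], of i S] assms(3) by simp
qed

lemma el_hop_back:
  assumes S: "S \<in> nsubsets n" and i: "i \<in> {1..<2*n}"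
  shows "i \<in> S \<Longrightarrow> Suc i \<notin> S \<Longrightarrow> strand_mult n (el n S (hop i S)) (Lgen n i) = smul (uvar i) (iota S)"
    and "i \<notin> S \<Longrightarrow> Suc i \<in> S \<Longrightarrow> strand_mult n (el n S (hop i S)) (Rgen n i) = smul (uvar i) (iota S)"
  using S i hop_nsubsets[OF S i] wt_back[OF S i]
    el_hops[OF i, of "{S \<in> nsubsets n. i \<notin> S \<and> Suc i \<in> S}" S "hop i S"]
    el_hops[OF i, of "{S \<in> nsubsets n. i \<in> S \<and> Suc i \<notin> S}" S "hop i S"]
  by (simp_all add: iota_eq_el Lgen_eq_hops Rgen_eq_hops hop_mem movable_def)

lemma iota_iota_at:
  assumes "S \<in> nsubsets n"
  shows "strand_mult n (iota S) (iota_at n k) = (if k \<in> S then iota S else (\<lambda>P. 0))"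
proof -
  have "strand_mult n (iota S) (iota T) = (if T = S then iota S else (\<lambda>P. 0))"
    if "T \<in> nsubsets n" for T
    using assms that by (simp add: iota_eq_el el_mult)
  then have "strand_mult n (iota S) (iota_at n k) =
      sum_fun (\<lambda>T. if T = S then iota S else (\<lambda>P. 0)) {T \<in> nsubsets n. k \<in> T}"
    unfolding iota_at_def by (subst strand_mult_sum_right) (auto simp: sum_fun_def fun_eq_iff intro!: sum.cong)
  then show ?thesis using assms by (simp add: sum_fun_delta)
qed

text \<open>A hop across a distant gap does not change the height at \<open>j\<close>, so the second hop leads away from \<open>S\<close>
  and has weight 1.\<close>

lemma iota_hops_far:
  assumes S: "S \<in> nsubsets n" and i: "i \<in> {1..<2*n}" and j: "j \<in> {1..<2*n}"
    and ij: "Suc i < j \<or> Suc j < i"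
    and Y: "Y \<subseteq> nsubsets n" and Z: "Z \<subseteq> {S \<in> nsubsets n. movable j S}"
    and inv: "hop i S \<in> Z \<longleftrightarrow> S \<in> Z"
  shows "strand_mult n (strand_mult n (iota S) (hops n i Y)) (hops n j Z) =
    (if S \<in> Y \<and> S \<in> Z then el n S (hop j (hop i S)) else (\<lambda>P. 0))"
proof -
  have S': "hop i S \<in> nsubsets n" by (rule hop_nsubsets[OF S i])
  have fin: "finite S" by (rule nsubsets_finite[OF S])
  have ZN: "Z \<subseteq> nsubsets n" using Z by auto
  have "wt n S (hop i S) (hop j (hop i S)) = 1" if "S \<in> Z"
  proof -
    have "movable j (hop i S)" using that inv Z by auto
    moreover have "\<not> closer n j S (hop i S)"
      using ht_hop[OF fin, of i j] i ij by (auto simp: closer_def)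
    ultimately show ?thesis using wt_hop[OF j _ hop_finite[OF fin]] by simp
  qed
  then show ?thesis
    using inv S S' el_hops[OF i Y S S] el_hops[OF j ZN S S'] by (simp add: iota_eq_el)
qed

lemma hops_far_commute:
  assumes i: "i \<in> {1..<2*n}" and j: "j \<in> {1..<2*n}" and ij: "Suc i < j"
    and Y: "Y \<subseteq> {S \<in> nsubsets n. movable i S}" and Z: "Z \<subseteq> {S \<in> nsubsets n. movable j S}"
    and invY: "\<And>S. S \<in> nsubsets n \<Longrightarrow> hop j S \<in> Y \<longleftrightarrow> S \<in> Y"
    and invZ: "\<And>S. S \<in> nsubsets n \<Longrightarrow> hop i S \<in> Z \<longleftrightarrow> S \<in> Z"
  shows "strand_mult n (hops n i Y) (hops n j Z) = strand_mult n (hops n j Z) (hops n i Y)"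
proof -
  interpret A: based_algebra "strand_alg n" "2*n" "mono_bij n" by (rule strand_based)
  have YZ: "Y \<subseteq> nsubsets n" "Z \<subseteq> nsubsets n" using Y Z by auto
  note f = hops_fmod[OF i YZ(1), of "2*n"] hops_fmod[OF j YZ(2), of "2*n"]
  show ?thesis
  proof (rule strand_eqI)
    fix S assume S: "S \<in> nsubsets n"
    have "strand_mult n (iota S) (strand_mult n (hops n i Y) (hops n j Z)) =
        strand_mult n (strand_mult n (iota S) (hops n i Y)) (hops n j Z)"
      using A.mult_assoc[OF iota_fmod[OF S] f] by (simp add: strand_alg_simps)
    also have "\<dots> = (if S \<in> Y \<and> S \<in> Z then el n S (hop j (hop i S)) else (\<lambda>P. 0))"
      using ij by (intro iota_hops_far S i j YZ Z invZ) simp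
    also have "\<dots> = (if S \<in> Z \<and> S \<in> Y then el n S (hop i (hop j S)) else (\<lambda>P. 0))"
      using hop_far[OF ij] by simp
    also have "\<dots> = strand_mult n (strand_mult n (iota S) (hops n j Z)) (hops n i Y)"
      using ij by (intro iota_hops_far[symmetric] S i j YZ Y invY) simp
    also have "\<dots> = strand_mult n (iota S) (strand_mult n (hops n j Z) (hops n i Y))"
      using A.mult_assoc[OF iota_fmod[OF S] f(2,1)] by (simp add: strand_alg_simps)
    finally show "strand_mult n (iota S) (strand_mult n (hops n i Y) (hops n j Z)) =
        strand_mult n (iota S) (strand_mult n (hops n j Z) (hops n i Y))" .
  qed (use A.mult_fmod f in \<open>simp_all add: strand_alg_simps\<close>)
qed

lemma gen_far_commute:
  assumes "i \<in> {1..<2*n}" "j \<in> {1..<2*n}" "Suc i < j"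
  shows "strand_mult n (Rgen n i) (Rgen n j) = strand_mult n (Rgen n j) (Rgen n i)"
    "strand_mult n (Lgen n i) (Lgen n j) = strand_mult n (Lgen n j) (Lgen n i)"
    "strand_mult n (Rgen n i) (Lgen n j) = strand_mult n (Lgen n j) (Rgen n i)"
    "strand_mult n (Lgen n i) (Rgen n j) = strand_mult n (Rgen n j) (Lgen n i)"
  unfolding Rgen_eq_hops[OF assms(1)] Rgen_eq_hops[OF assms(2)]
    Lgen_eq_hops[OF assms(1)] Lgen_eq_hops[OF assms(2)]
  by (rule hops_far_commute[OF assms]; use assms in \<open>auto simp: hop_mem movable_def hop_nsubsets\<close>)+

text \<open>A quotient of the strand algebra in which the defining relations of \<open>\<A>\<^sub>n\<close> hold.\<close>

locale strand_quotient = ring C for C :: "('c, 'd) ring_scheme" (structure) +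
  fixes n :: nat and q :: "strand_elt \<Rightarrow> 'c"
  assumes q_hom: "q \<in> ring_hom (strand_alg n) C"
    and q_surj: "b \<in> carrier C \<Longrightarrow> \<exists>a\<in>carrier (strand_alg n). b = q a"
    and q_RL: "i \<in> {1..<2*n} \<Longrightarrow>
      q (strand_mult n (Rgen n i) (Lgen n i)) = q (smul (uvar i) (iota_at n i))"
    and q_LR: "i \<in> {1..<2*n} \<Longrightarrow>
      q (strand_mult n (Lgen n i) (Rgen n i)) = q (smul (uvar i) (iota_at n (Suc i)))"
    and q_RR: "i \<in> {1..<2*n} \<Longrightarrow> Suc i \<in> {1..<2*n} \<Longrightarrow> q (Rgen n (Suc i)) \<otimes> q (Rgen n i) = \<zero>"
    and q_LL: "i \<in> {1..<2*n} \<Longrightarrow> Suc i \<in> {1..<2*n} \<Longrightarrow> q (Lgen n i) \<otimes> q (Lgen n (Suc i)) = \<zero>"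
begin

sublocale S: based_algebra "strand_alg n" "2*n" "mono_bij n"
  by (rule strand_based)

definition sc :: "upoly \<Rightarrow> 'c" where
  "sc c = q (smul (lower_vars c) \<one>\<^bsub>strand_alg n\<^esub>)"

sublocale central_algebra C "2*n + 1" sc
  unfolding sc_def using q_surj
  by (intro S.central_algebra_quotient ring_axioms q_hom lower_vars_hom)

lemma q_mult: "a \<in> carrier (strand_alg n) \<Longrightarrow> b \<in> carrier (strand_alg n) \<Longrightarrow>
    q a \<otimes> q b = q (strand_mult n a b)"
  using ring_hom_mult[OF q_hom] by (simp add: strand_alg_simps)

lemma q_zero: "q (\<lambda>P. 0) = \<zero>"
  using ring_hom_zero[OF q_hom S.is_ring ring_axioms] by (simp add: strand_alg_simps)

lemma mult_carrier: "a \<in> carrier (strand_alg n) \<Longrightarrow> b \<in> carrier (strand_alg n) \<Longrightarrow>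
    strand_mult n a b \<in> carrier (strand_alg n)"
  using S.m_closed by (simp add: strand_alg_simps)

lemma q_smul:
  assumes "c \<in> Upoly (2*n + 1)" "a \<in> carrier (strand_alg n)"
  shows "q (smul (lower_vars c) a) = sc c \<otimes> q a"
proof -
  have c: "lower_vars c \<in> Upoly (2*n)" by (rule lower_vars_Upoly[OF assms(1)])
  have "smul (lower_vars c) \<one>\<^bsub>strand_alg n\<^esub> \<in> carrier (strand_alg n)"
    unfolding S.carrier_eq by (intro fmod_smul c S.one_fmod)
  then show ?thesis
    using ring_hom_mult[OF q_hom _ assms(2)] S.smul_eq_mult(1)[OF c] assms(2)
    by (simp add: sc_def S.carrier_eq)
qed

text \<open>This is \<open>B4\<close>: with both sites filled \<open>\<iota>\<^sub>S R\<^sub>i = 0\<close>, whereas \<open>R\<^sub>i L\<^sub>i = \<iota>\<^sub>i u\<^sub>i\<close>.\<close>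

lemma q_u_iota:
  assumes S: "S \<in> nsubsets n" and i: "i \<in> {1..<2*n}" and mem: "i \<in> S" "Suc i \<in> S"
  shows "q (smul (uvar i) (iota S)) = \<zero>"
proof -
  have u: "uvar i \<in> Upoly (2*n)" using i by (intro Upoly_uvar) auto
  have uc: "smul (uvar i) (iota_at n i) \<in> carrier (strand_alg n)"
    unfolding strand_carrier by (intro fmod_smul u iota_at_fmod)
  have "smul (uvar i) (iota S) = strand_mult n (iota S) (smul (uvar i) (iota_at n i))"
    using iota_iota_at[OF S, of i] mem by (simp add: strand_mult_smul_right)
  then have "q (smul (uvar i) (iota S)) = q (iota S) \<otimes> q (smul (uvar i) (iota_at n i))"
    using q_mult[OF gen_carrier(3)[OF S] uc] by simp
  also have "\<dots> = q (iota S) \<otimes> q (strand_mult n (Rgen n i) (Lgen n i))"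
    by (simp only: q_RL[OF i])
  also have "\<dots> = q (strand_mult n (strand_mult n (iota S) (Rgen n i)) (Lgen n i))"
    using gen_carrier(3)[OF S] gen_carrier(1,2)[OF i] S.m_assoc[of "iota S" "Rgen n i" "Lgen n i"]
    by (simp add: q_mult mult_carrier strand_alg_simps)
  also have "\<dots> = \<zero>"
    using iota_Rgen[OF S i] mem by (simp add: q_zero)
  finally show ?thesis .
qed

fun val :: "gen \<Rightarrow> strand_elt" where
  "val (GI x) = iota (holes n x)"
| "val (GR i) = Lgen n (i - 1)"
| "val (GL i) = Rgen n (i - 1)"

lemma val_carrier: "g \<in> gens (2*n + 1) n \<Longrightarrow> val g \<in> carrier (strand_alg n)"
  by (auto simp: gens_def local_states_Suc intro!: gen_carrier holes_nsubsets) arith+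

context
  fixes h :: "(gen list \<Rightarrow> upoly) \<Rightarrow> 'c"
  assumes h_hom: "h \<in> ring_hom (os_free n) C"
    and h_scalar: "\<And>c. c \<in> Upoly (2*n + 1) \<Longrightarrow>
      h (smul c \<one>\<^bsub>os_free n\<^esub>) = sc c"
    and h_gen: "\<And>g. g \<in> gens (2*n + 1) n \<Longrightarrow> h (basis [g]) = q (val g)"
begin

interpretation F: based_algebra "os_free n" "2*n + 1"
    "{w. set w \<subseteq> gens (2*n + 1) n}"
  by (rule free_based)

lemma h_Cons:
  assumes "set (g # w) \<subseteq> gens (2*n + 1) n"
  shows "h (basis (g # w)) = q (val g) \<otimes> h (basis w)"
proof -
  have "basis [g] \<in> carrier (os_free n)"
    "basis w \<in> carrier (os_free n)"
    unfolding F.carrier_eq using assms by (intro fmod_basis; simp)+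
  from ring_hom_mult[OF h_hom this] show ?thesis
    using assms h_gen by (simp add: free_mult_basis)
qed

lemma h_word2: "set [a, b] \<subseteq> gens (2*n + 1) n \<Longrightarrow>
    h (basis [a, b]) = q (strand_mult n (val a) (val b))"
  by (subst h_Cons) (simp_all add: h_gen q_mult val_carrier)

lemma h_word3: "set [a, b, c] \<subseteq> gens (2*n + 1) n \<Longrightarrow>
    h (basis [a, b, c]) = q (strand_mult n (strand_mult n (val a) (val b)) (val c))"
  using S.m_assoc[of "val a" "val b" "val c"]
  by (subst h_Cons) (simp_all add: h_word2 q_mult val_carrier mult_carrier strand_alg_simps)

lemma h_smul:
  assumes "x \<in> nsubsets n" "i \<in> {1..<2*n}"
  shows "h (smul (uvar (Suc i)) (basis [GI x])) = q (smul (uvar i) (iota (holes n x)))"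
proof -
  have u: "uvar (Suc i) \<in> Upoly (2*n + 1)" using assms by (intro Upoly_uvar) auto
  have g: "GI x \<in> gens (2*n + 1) n" using assms by (simp add: gens_def local_states_Suc)
  have b: "basis [GI x] \<in> fmod (2*n + 1) {w. set w \<subseteq> gens (2*n + 1) n}"
    using g by (intro fmod_basis) simp
  have "smul (uvar (Suc i)) \<one>\<^bsub>os_free n\<^esub>
      \<in> carrier (os_free n)"
    unfolding F.carrier_eq by (intro fmod_smul u F.one_fmod)
  then have "h (smul (uvar (Suc i)) (basis [GI x])) = sc (uvar (Suc i)) \<otimes> q (iota (holes n x))"
    using ring_hom_mult[OF h_hom, of "smul (uvar (Suc i)) \<one>\<^bsub>os_free n\<^esub>" "basis [GI x]"]
      b h_gen[OF g] h_scalar[OF u]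
    unfolding F.smul_eq_mult(1)[OF u b] F.carrier_eq by simp
  also have "\<dots> = q (smul (lower_vars (uvar (Suc i))) (iota (holes n x)))"
    using q_smul[OF u gen_carrier(3)[OF holes_nsubsets[OF assms(1)]]] by simp
  also have "lower_vars (uvar (Suc i)) = uvar i"
    using assms by (simp add: lower_vars_def subst_uvar)
  finally show ?thesis .
qed

lemma h_zero: "h (\<lambda>w. 0) = \<zero>"
  using ring_hom_zero[OF h_hom F.is_ring ring_axioms] by (simp add: free_alg_simps(4))

lemma h_unit: "h (sum_fun (\<lambda>x. basis [GI x]) (nsubsets n)) = h (basis [])"
proof -
  interpret h: ring_hom_ring "os_free n" C h
    by (intro ring_hom_ringI2 F.is_ring ring_axioms h_hom)
  interpret q: ring_hom_ring "strand_alg n" C q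
    by (intro ring_hom_ringI2 S.is_ring ring_axioms q_hom)
  have g: "GI x \<in> gens (2*n + 1) n" if "x \<in> nsubsets n" for x
    using that by (simp add: gens_def local_states_Suc)
  have c: "(\<lambda>x. basis [GI x]) \<in> nsubsets n \<rightarrow> carrier (os_free n)"
    unfolding F.carrier_eq using g by (intro Pi_I fmod_basis) simp
  have "h (sum_fun (\<lambda>x. basis [GI x]) (nsubsets n)) = (\<Oplus>x\<in>nsubsets n. h (basis [GI x]))"
  proof -
    have "basis [GI x] \<in> fmod (2*n + 1) {w. set w \<subseteq> gens (2*n + 1) n}" if "x \<in> nsubsets n" for x
      using g[OF that] by (intro fmod_basis) simp
    then have "sum_fun (\<lambda>x. basis [GI x]) (nsubsets n) =
        (\<Oplus>\<^bsub>os_free n\<^esub>x\<in>nsubsets n. basis [GI x])"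
      by (intro F.sum_fun_eq_finsum finite_nsubsets)
    then show ?thesis using h.hom_finsum[OF c] by (simp only: comp_def)
  qed
  also have "\<dots> = (\<Oplus>x\<in>nsubsets n. q (iota (holes n x)))"
    using g by (intro finsum_cong') (auto simp: h_gen intro!: ring_hom_closed[OF q_hom] gen_carrier)
  also have "\<dots> = (\<Oplus>S\<in>holes n ` nsubsets n. q (iota S))"
  proof (rule add.finprod_reindex[symmetric])
    show "inj_on (holes n) (nsubsets n)" using bij_holes by (rule bij_betw_imp_inj_on)
    show "(\<lambda>S. q (iota S)) \<in> holes n ` nsubsets n \<rightarrow> carrier C"
      by (auto intro!: ring_hom_closed[OF q_hom] gen_carrier)
  qed
  also have "holes n ` nsubsets n = nsubsets n"
    using bij_holes by (rule bij_betw_imp_surj_on)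
  also have "(\<Oplus>S\<in>nsubsets n. q (iota S)) = q (sum_fun iota (nsubsets n))"
  proof -
    have c: "iota \<in> nsubsets n \<rightarrow> carrier (strand_alg n)" by (auto intro: gen_carrier)
    show ?thesis
      using q.hom_finsum[OF c] S.sum_fun_eq_finsum[OF finite_nsubsets iota_fmod]
      by (simp only: comp_def)
  qed
  also have "\<dots> = h (basis [])"
    using ring_hom_one[OF q_hom] ring_hom_one[OF h_hom] by (simp add: strand_alg_simps free_alg_simps(3))
  finally show ?thesis .
qed

text \<open>All relations except \<open>B3\<close> and \<open>B4\<close> already hold in the strand algebra itself.\<close>

lemma h_rels: "(f, g) \<in> B_rels (2*n + 1) n \<Longrightarrow> h f = h g"
proof -
  assume fg: "(f, g) \<in> B_rels (2*n + 1) n"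
  have G: "x \<in> local_states (2*n + 1) n \<Longrightarrow> GI x \<in> gens (2*n + 1) n"
    "i \<in> {2..2*n + 1 - 1} \<Longrightarrow> GR i \<in> gens (2*n + 1) n"
    "i \<in> {2..2*n + 1 - 1} \<Longrightarrow> GL i \<in> gens (2*n + 1) n" for x i
    by (auto simp: gens_def)
  have idx: "\<exists>j. i = Suc j \<and> j \<in> {1..<2*n}" if "i \<in> {2..2*n + 1 - 1}" for i
    using that by (intro exI[of _ "i - 1"]) auto
  have hl: "holes n x \<in> nsubsets n" "x \<in> nsubsets n" if "x \<in> local_states (2*n + 1) n" for x
    using that holes_nsubsets by (simp_all add: local_states_Suc)
  have right: "\<exists>j. i = Suc j \<and> j \<in> {1..<2*n} \<and> r_move i x = hop j x \<and> j \<notin> holes n x \<and> Suc j \<in> holes n x"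
    if "i \<in> {2..2*n + 1 - 1}" "r_defined i x" for i x
    using idx[OF that(1)] that(2) by (auto simp: r_defined_Suc r_move_Suc holes_mem)
  have left: "\<exists>j. i = Suc j \<and> j \<in> {1..<2*n} \<and> l_move i x = hop j x \<and> j \<in> holes n x \<and> Suc j \<notin> holes n x"
    if "i \<in> {2..2*n + 1 - 1}" "l_defined i x" for i x
    using idx[OF that(1)] that(2) by (auto simp: l_defined_Suc l_move_Suc holes_mem)
  have hopx: "hop j x \<in> local_states (2*n + 1) n" if "x \<in> local_states (2*n + 1) n" "j \<in> {1..<2*n}" for x j
    using that hop_nsubsets[of x n j] by (simp add: local_states_Suc)
  from fg show "h f = h g"
  proof (cases rule: B_rels.cases)
    case (idem x y)
    have "holes n x = holes n y \<longleftrightarrow> x = y"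
      using bij_betw_imp_inj_on[OF bij_holes] hl(2)[OF idem(3)] hl(2)[OF idem(4)]
      by (rule inj_on_eq_iff)
    then have "strand_mult n (iota (holes n x)) (iota (holes n y)) = (if x = y then iota (holes n x) else (\<lambda>P. 0))"
      using hl(1)[OF idem(3)] hl(1)[OF idem(4)] by (simp add: iota_eq_el el_mult)
    then show ?thesis
      unfolding idem(1,2) using G(1)[OF idem(3)] G(1)[OF idem(4)] by (simp add: h_word2 h_gen h_zero q_zero)
  next
    case unit
    then show ?thesis using h_unit by (simp add: local_states_Suc)
  next
    case (B1_R x i)
    obtain j where j: "i = Suc j" "j \<in> {1..<2*n}" and mv: "r_move i x = hop j x"
      and m: "j \<notin> holes n x" "Suc j \<in> holes n x"
      using right[OF B1_R(4,5)] by blast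
    show ?thesis
      unfolding B1_R(1,2) mv unfolding j(1)
      using G B1_R(3) B1_R(4)[unfolded j(1)] hopx[OF B1_R(3) j(2)] m iota_Lgen[OF hl(1)[OF B1_R(3)] j(2)]
        Lgen_iota[OF hl(1)[OF B1_R(3)] j(2)]
      by (simp add: h_word2 holes_hop[OF j(2)])
  next
    case (B1_R' x i)
    obtain j where j: "i = Suc j" "j \<in> {1..<2*n}" and mv: "r_move i x = hop j x"
      and m: "j \<notin> holes n x" "Suc j \<in> holes n x"
      using right[OF B1_R'(4,5)] by blast
    show ?thesis
      unfolding B1_R'(1,2) mv unfolding j(1)
      using G B1_R'(3) B1_R'(4)[unfolded j(1)] hopx[OF B1_R'(3) j(2)] m iota_Lgen[OF hl(1)[OF B1_R'(3)] j(2)]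
        el_iota[OF hl(1)[OF B1_R'(3)] hop_nsubsets[OF hl(1)[OF B1_R'(3)] j(2)]]
      by (simp add: h_word2 h_word3 holes_hop[OF j(2)])
  next
    case (B1_R0 x i)
    obtain j where j: "i = Suc j" "j \<in> {1..<2*n}" using idx[OF B1_R0(4)] by blast
    have m: "\<not> (j \<notin> holes n x \<and> Suc j \<in> holes n x)"
      using B1_R0(5) j by (simp add: r_defined_Suc holes_mem)
    have "strand_mult n (iota (holes n x)) (Lgen n j) = (\<lambda>P. 0)"
      unfolding iota_Lgen[OF hl(1)[OF B1_R0(3)] j(2)] using m by auto
    then show ?thesis
      unfolding B1_R0(1,2) j(1)
      using G B1_R0(3) B1_R0(4)[unfolded j(1)] by (simp add: h_word2 h_zero q_zero)
  next
    case (B1_L x i)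
    obtain j where j: "i = Suc j" "j \<in> {1..<2*n}" and mv: "l_move i x = hop j x"
      and m: "j \<in> holes n x" "Suc j \<notin> holes n x"
      using left[OF B1_L(4,5)] by blast
    show ?thesis
      unfolding B1_L(1,2) mv unfolding j(1)
      using G B1_L(3) B1_L(4)[unfolded j(1)] hopx[OF B1_L(3) j(2)] m iota_Rgen[OF hl(1)[OF B1_L(3)] j(2)]
        Rgen_iota[OF hl(1)[OF B1_L(3)] j(2)]
      by (simp add: h_word2 holes_hop[OF j(2)])
  next
    case (B1_L' x i)
    obtain j where j: "i = Suc j" "j \<in> {1..<2*n}" and mv: "l_move i x = hop j x"
      and m: "j \<in> holes n x" "Suc j \<notin> holes n x"
      using left[OF B1_L'(4,5)] by blast
    show ?thesis
      unfolding B1_L'(1,2) mv unfolding j(1)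
      using G B1_L'(3) B1_L'(4)[unfolded j(1)] hopx[OF B1_L'(3) j(2)] m iota_Rgen[OF hl(1)[OF B1_L'(3)] j(2)]
        el_iota[OF hl(1)[OF B1_L'(3)] hop_nsubsets[OF hl(1)[OF B1_L'(3)] j(2)]]
      by (simp add: h_word2 h_word3 holes_hop[OF j(2)])
  next
    case (B1_L0 x i)
    obtain j where j: "i = Suc j" "j \<in> {1..<2*n}" using idx[OF B1_L0(4)] by blast
    have m: "\<not> (j \<in> holes n x \<and> Suc j \<notin> holes n x)"
      using B1_L0(5) j by (simp add: l_defined_Suc holes_mem)
    have "strand_mult n (iota (holes n x)) (Rgen n j) = (\<lambda>P. 0)"
      unfolding iota_Rgen[OF hl(1)[OF B1_L0(3)] j(2)] using m by auto
    then show ?thesis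
      unfolding B1_L0(1,2) j(1)
      using G B1_L0(3) B1_L0(4)[unfolded j(1)] by (simp add: h_word2 h_zero q_zero)
  next
    case (B2_R x i)
    obtain j where j: "i = Suc j" "j \<in> {1..<2*n}" and mv: "r_move i x = hop j x"
      and m: "j \<notin> holes n x" "Suc j \<in> holes n x"
      using right[OF B2_R(4,5)] by blast
    show ?thesis
      unfolding B2_R(1,2) j(1) h_smul[OF hl(2)[OF B2_R(3)] j(2)]
      using G B2_R(3) B2_R(4)[unfolded j(1)] m iota_Lgen[OF hl(1)[OF B2_R(3)] j(2)]
        el_hop_back(2)[OF hl(1)[OF B2_R(3)] j(2)]
      by (simp add: h_word3)
  next
    case (B2_L x i)
    obtain j where j: "i = Suc j" "j \<in> {1..<2*n}" and mv: "l_move i x = hop j x"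
      and m: "j \<in> holes n x" "Suc j \<notin> holes n x"
      using left[OF B2_L(4,5)] by blast
    show ?thesis
      unfolding B2_L(1,2) j(1) h_smul[OF hl(2)[OF B2_L(3)] j(2)]
      using G B2_L(3) B2_L(4)[unfolded j(1)] m iota_Rgen[OF hl(1)[OF B2_L(3)] j(2)]
        el_hop_back(1)[OF hl(1)[OF B2_L(3)] j(2)]
      by (simp add: h_word3)
  next
    case (B3_R i)
    obtain j where j: "i = Suc j" "j \<in> {1..<2*n}" using idx[OF B3_R(3)] by blast
    have "Suc j \<in> {1..<2*n}" using B3_R(4) j by auto
    then have "q (strand_mult n (Lgen n j) (Lgen n (Suc j))) = \<zero>"
      using q_LL[OF j(2)] q_mult gen_carrier j(2) by simp
    then show ?thesis
      unfolding B3_R(1,2) using G(2)[OF B3_R(3)] G(2)[OF B3_R(4)] j by (simp add: h_word2 h_zero)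
  next
    case (B3_L i)
    obtain j where j: "i = Suc j" "j \<in> {1..<2*n}" using idx[OF B3_L(3)] by blast
    have "Suc j \<in> {1..<2*n}" using B3_L(4) j by auto
    then have "q (strand_mult n (Rgen n (Suc j)) (Rgen n j)) = \<zero>"
      using q_RR[OF j(2)] q_mult gen_carrier j(2) by simp
    then show ?thesis
      unfolding B3_L(1,2) using G(3)[OF B3_L(3)] G(3)[OF B3_L(4)] j by (simp add: h_word2 h_zero)
  next
    case (B4 x i)
    obtain j where j: "i = Suc j" "j \<in> {1..<2*n}" using idx[OF B4(4)] by blast
    have m: "j \<in> holes n x" "Suc j \<in> holes n x" using B4(5) j by (auto simp: holes_mem)
    show ?thesis
      unfolding B4(1,2) j(1) h_smul[OF hl(2)[OF B4(3)] j(2)] h_zero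
      by (rule q_u_iota[OF hl(1)[OF B4(3)] j(2) m])
  next
    case (comm_RR i j)
    obtain i' where i': "i = Suc i'" "i' \<in> {1..<2*n}" using idx[OF comm_RR(3)] by blast
    obtain j' where j': "j = Suc j'" "j' \<in> {1..<2*n}" using idx[OF comm_RR(4)] by blast
    note ij = i'(1) j'(1) i'(2) j'(2)
    have far: "Suc i' < j'" using comm_RR(5) ij by simp
    show ?thesis
      unfolding comm_RR(1,2) using G comm_RR(3,4) ij(1,2) gen_far_commute[OF ij(3,4) far] by (simp add: h_word2)
  next
    case (comm_LL i j)
    obtain i' where i': "i = Suc i'" "i' \<in> {1..<2*n}" using idx[OF comm_LL(3)] by blast
    obtain j' where j': "j = Suc j'" "j' \<in> {1..<2*n}" using idx[OF comm_LL(4)] by blast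
    note ij = i'(1) j'(1) i'(2) j'(2)
    have far: "Suc i' < j'" using comm_LL(5) ij by simp
    show ?thesis
      unfolding comm_LL(1,2) using G comm_LL(3,4) ij(1,2) gen_far_commute[OF ij(3,4) far] by (simp add: h_word2)
  next
    case (comm_RL i j)
    obtain i' where i': "i = Suc i'" "i' \<in> {1..<2*n}" using idx[OF comm_RL(3)] by blast
    obtain j' where j': "j = Suc j'" "j' \<in> {1..<2*n}" using idx[OF comm_RL(4)] by blast
    note ij = i'(1) j'(1) i'(2) j'(2)
    have "Suc i' < j' \<or> Suc j' < i'" using comm_RL(5) ij by simp
    then have "strand_mult n (Lgen n i') (Rgen n j') = strand_mult n (Rgen n j') (Lgen n i')"
      using gen_far_commute(4)[OF ij(3,4)] gen_far_commute(3)[OF ij(4,3)] by auto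
    then show ?thesis
      unfolding comm_RL(1,2) using G comm_RL(3,4) ij(1,2) by (simp add: h_word2)
  qed
qed

end

end

section \<open>The isomorphism\<close>

text \<open>The algebras to be compared are quotients of quotients; both projections are handled at once.\<close>

lemma quotient_hom:
  assumes "ring A" "rels \<subseteq> carrier A \<times> carrier A"
    and "p \<in> ring_hom R A" and p_surj: "\<And>a. a \<in> carrier A \<Longrightarrow> \<exists>r\<in>carrier R. a = p r"
  shows "ring (quot_by A rels)"
    and "(\<lambda>r. cls A rels (p r)) \<in> ring_hom R (quot_by A rels)"
    and "b \<in> carrier (quot_by A rels) \<Longrightarrow> \<exists>r\<in>carrier R. b = cls A rels (p r)"
proof -
  show "ring (quot_by A rels)" by (rule ring_quot_by[OF assms(1,2)])
  show "(\<lambda>r. cls A rels (p r)) \<in> ring_hom R (quot_by A rels)"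
    using ring_hom_trans[OF assms(3) cls_hom[OF assms(1,2)]] by (simp add: comp_def)
  show "\<exists>r\<in>carrier R. b = cls A rels (p r)" if b: "b \<in> carrier (quot_by A rels)"
  proof -
    obtain a where a: "a \<in> carrier A" "b = cls A rels a" using cls_surj[OF assms(1,2) b] by blast
    obtain r where "r \<in> carrier R" "a = p r" using p_surj[OF a(1)] by blast
    with a show ?thesis by blast
  qed
qed

lemma A_rels_carrier: "A_rels n \<subseteq> carrier (strand_alg n) \<times> carrier (strand_alg n)"
proof -
  interpret A: based_algebra "strand_alg n" "2*n" "mono_bij n" by (rule strand_based)
  have "Rgen n i \<otimes>\<^bsub>strand_alg n\<^esub> Lgen n i \<in> carrier (strand_alg n)"
    "Lgen n i \<otimes>\<^bsub>strand_alg n\<^esub> Rgen n i \<in> carrier (strand_alg n)"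
    "smul (uvar i) (iota_at n k) \<in> carrier (strand_alg n)" if "i \<in> {1..2*n-1}" for i k
  proof -
    have i: "i \<in> {1..<2*n}" using that by auto
    show "Rgen n i \<otimes>\<^bsub>strand_alg n\<^esub> Lgen n i \<in> carrier (strand_alg n)"
      "Lgen n i \<otimes>\<^bsub>strand_alg n\<^esub> Rgen n i \<in> carrier (strand_alg n)"
      using gen_carrier(1,2)[OF i] by simp_all
    have "uvar i \<in> Upoly (2*n)" using i by (intro Upoly_uvar) auto
    then show "smul (uvar i) (iota_at n k) \<in> carrier (strand_alg n)"
      unfolding strand_carrier by (intro fmod_smul iota_at_fmod)
  qed
  then show ?thesis unfolding A_rels_def by blast
qed

lemma B_rels_carrier:
  "B_rels m k \<subseteq> carrier (free_alg m (gens m k)) \<times> carrier (free_alg m (gens m k))"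
proof -
  have word: "basis w \<in> fmod m {w. set w \<subseteq> gens m k}" if "set w \<subseteq> gens m k" for w
    using that by (intro fmod_basis) simp
  have G: "x \<in> local_states m k \<Longrightarrow> GI x \<in> gens m k" "i \<in> {2..m-1} \<Longrightarrow> GR i \<in> gens m k"
    "i \<in> {2..m-1} \<Longrightarrow> GL i \<in> gens m k" for x i
    by (auto simp: gens_def)
  have u: "uvar i \<in> Upoly m" if "i \<in> {2..m-1}" for i
    using that by (intro Upoly_uvar) auto
  have moves: "r_defined i x \<Longrightarrow> r_move i x \<in> local_states m k"
    "l_defined i x \<Longrightarrow> l_move i x \<in> local_states m k"
    if x: "x \<in> local_states m k" and i: "i \<in> {2..m-1}" for i x
  proof -
    have fin: "finite x" using x finite_subset[of x "{1..m-1}"] by (simp add: local_states_def)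
    show "r_move i x \<in> local_states m k" if "r_defined i x"
    proof -
      have "i - 1 \<in> x" "i \<notin> x" using that i r_defined_Suc[of "i - 1" x] by simp_all
      then show ?thesis
        using x i fin card_Suc_Diff1[of x "i - 1"] by (auto simp: local_states_def r_move_def)
    qed
    show "l_move i x \<in> local_states m k" if "l_defined i x"
    proof -
      have "i - 1 \<notin> x" "i \<in> x" using that i l_defined_Suc[of "i - 1" x] by simp_all
      then show ?thesis
        using x i fin card_Suc_Diff1[of x i] by (auto simp: local_states_def l_move_def)
    qed
  qed
  have "f \<in> fmod m {w. set w \<subseteq> gens m k} \<and> g \<in> fmod m {w. set w \<subseteq> gens m k}"
    if "(f, g) \<in> B_rels m k" for f g
    using that
  proof (cases rule: B_rels.cases)
    case unit
    have "sum_fun (\<lambda>x. basis [GI x]) (local_states m k) \<in> fmod m {w. set w \<subseteq> gens m k}"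
      using G(1) by (intro fmod_sum_fun word) simp
    then show ?thesis using unit word by simp
  qed (use word G u moves in \<open>auto intro!: fmod_smul\<close>)
  then show ?thesis by (auto simp: free_alg_simps(1))
qed

theorem theorem1p9:
  fixes n :: nat
  assumes "n \<ge> 1"
  shows "\<exists>\<phi> \<in> ring_iso (calA n) (Bbar (2*n + 1) n).
           \<forall>i \<in> {1..2*n}. \<phi> (calA_scalar n (uvar i)) = Bbar_scalar (2*n + 1) n (uvar (i + 1))"
proof -
  let ?F = "os_free n" and ?S = "strand_alg n"
  let ?C = "calA n" and ?B = "Bbar (2*n + 1) n"
  interpret F: based_algebra ?F "2*n + 1" "{w. set w \<subseteq> gens (2*n + 1) n}" by (rule free_based)
  interpret S: based_algebra ?S "2*n" "mono_bij n" by (rule strand_based)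

  have hA: "A_cls n \<in> ring_hom ?S (A_alg n)" and ring_A: "ring (A_alg n)"
    unfolding A_cls_def A_alg_def
    by (rule cls_hom[OF S.is_ring A_rels_carrier], rule ring_quot_by[OF S.is_ring A_rels_carrier])
  have surj_A: "\<exists>r\<in>carrier ?S. a = A_cls n r" if "a \<in> carrier (A_alg n)" for a
    using cls_surj[OF S.is_ring A_rels_carrier] that unfolding A_cls_def A_alg_def by blast
  interpret A: ring "A_alg n" by (rule ring_A)
  have range: "i \<in> {1..<2*n} \<and> i - 1 \<in> {1..<2*n}" if "i \<in> {2..2*n-1}" for i using that by auto
  have gA: "A_cls n (Rgen n i) \<in> carrier (A_alg n)" "A_cls n (Lgen n i) \<in> carrier (A_alg n)"
    if "i \<in> {1..<2*n}" for i
    using gen_carrier(1,2)[OF that] ring_hom_closed[OF hA] by auto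
  have calA_carrier: "calA_rels n \<subseteq> carrier (A_alg n) \<times> carrier (A_alg n)"
    unfolding calA_rels_def using gA range by auto
  define q where "q r = cls (A_alg n) (calA_rels n) (A_cls n r)" for r
  have ring_C: "ring ?C" and q_hom: "q \<in> ring_hom ?S ?C"
    and q_surj: "\<And>c. c \<in> carrier ?C \<Longrightarrow> \<exists>r\<in>carrier ?S. c = q r"
    unfolding q_def[abs_def] calA_def
    by (rule quotient_hom[OF ring_A calA_carrier hA surj_A]; assumption?)+

  let ?BA = "B_alg (2*n + 1) n" and ?Bcls = "cls ?F (B_rels (2*n + 1) n)"
  have hB: "?Bcls \<in> ring_hom ?F ?BA" and ring_B0: "ring ?BA"
    unfolding B_alg_def
    by (rule cls_hom[OF F.is_ring B_rels_carrier], rule ring_quot_by[OF F.is_ring B_rels_carrier])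
  have surj_B: "\<exists>r\<in>carrier ?F. a = ?Bcls r" if "a \<in> carrier ?BA" for a
    using cls_surj[OF F.is_ring B_rels_carrier] that unfolding B_alg_def by blast
  interpret B0: ring ?BA by (rule ring_B0)
  have u1: "smul (uvar 1) \<one>\<^bsub>?F\<^esub> \<in> carrier ?F"
    unfolding F.carrier_eq by (intro fmod_smul F.one_fmod Upoly_uvar) simp
  have Bbar_carrier: "Bbar_rels (2*n + 1) n \<subseteq> carrier ?BA \<times> carrier ?BA"
    unfolding Bbar_rels_def B_scalar_def using ring_hom_closed[OF hB u1] B0.zero_closed by simp
  define p where "p r = cls ?BA (Bbar_rels (2*n + 1) n) (?Bcls r)" for r
  have ring_B: "ring ?B" and p_hom: "p \<in> ring_hom ?F ?B"
    and p_surj: "\<And>c. c \<in> carrier ?B \<Longrightarrow> \<exists>r\<in>carrier ?F. c = p r"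
    unfolding p_def[abs_def] Bbar_def
    by (rule quotient_hom[OF ring_B0 Bbar_carrier hB surj_B]; assumption?)+

  interpret C: ring ?C by (rule ring_C)
  interpret B: ring ?B by (rule ring_B)
  have q_zero: "q (\<lambda>P. 0) = \<zero>\<^bsub>?C\<^esub>"
    using ring_hom_zero[OF q_hom S.is_ring ring_C] by (simp add: strand_alg_simps)

  interpret Q: strand_quotient ?C n q
  proof
    fix i assume i: "i \<in> {1..<2*n}"
    then have i': "i \<in> {1..2*n-1}" by auto
    show "q (strand_mult n (Rgen n i) (Lgen n i)) = q (smul (uvar i) (iota_at n i))"
      unfolding q_def A_cls_def
      by (rule arg_cong[OF cls_eqI[OF S.is_ring A_rels_carrier]])
        (use i' in \<open>auto simp: A_rels_def strand_alg_simps(1)\<close>)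
    show "q (strand_mult n (Lgen n i) (Rgen n i)) = q (smul (uvar i) (iota_at n (Suc i)))"
      unfolding q_def A_cls_def
      by (rule arg_cong[OF cls_eqI[OF S.is_ring A_rels_carrier]])
        (use i' in \<open>auto simp: A_rels_def strand_alg_simps(1)\<close>)
    assume Si: "Suc i \<in> {1..<2*n}"
    have Si': "Suc i \<in> {2..2*n-1}" using i Si by auto
    note ch = cls_hom[OF ring_A calA_carrier]
    have zero: "cls (A_alg n) (calA_rels n) \<zero>\<^bsub>A_alg n\<^esub> = \<zero>\<^bsub>?C\<^esub>"
      using ring_hom_zero[OF ch ring_A] ring_C by (simp add: calA_def)
    have "(A_cls n (Rgen n (Suc i)) \<otimes>\<^bsub>A_alg n\<^esub> A_cls n (Rgen n (Suc i - 1)), \<zero>\<^bsub>A_alg n\<^esub>) \<in> calA_rels n"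
      unfolding calA_rels_def using Si' by blast
    from cls_eqI[OF ring_A calA_carrier this]
    show "q (Rgen n (Suc i)) \<otimes>\<^bsub>?C\<^esub> q (Rgen n i) = \<zero>\<^bsub>?C\<^esub>"
      using ring_hom_mult[OF ch gA(1)[OF Si] gA(1)[OF i]] by (simp add: q_def zero calA_def)
    have "(A_cls n (Lgen n (Suc i - 1)) \<otimes>\<^bsub>A_alg n\<^esub> A_cls n (Lgen n (Suc i)), \<zero>\<^bsub>A_alg n\<^esub>) \<in> calA_rels n"
      unfolding calA_rels_def using Si' by blast
    from cls_eqI[OF ring_A calA_carrier this]
    show "q (Lgen n i) \<otimes>\<^bsub>?C\<^esub> q (Lgen n (Suc i)) = \<zero>\<^bsub>?C\<^esub>"
      using ring_hom_mult[OF ch gA(2)[OF i] gA(2)[OF Si]] by (simp add: q_def zero calA_def)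
  qed (use q_hom q_surj in auto)

  have p_scalar: "p (smul c \<one>\<^bsub>?F\<^esub>) = Bbar_scalar (2*n + 1) n c" for c
    by (simp add: p_def Bbar_scalar_def B_scalar_def)
  have q_scalar: "q (smul c \<one>\<^bsub>?S\<^esub>) = calA_scalar n c" for c
    by (simp add: q_def calA_scalar_def)
  note bh = cls_hom[OF ring_B0 Bbar_carrier]
  have p_u1: "p (smul (uvar 1) (basis [])) = \<zero>\<^bsub>?B\<^esub>"
  proof -
    have "(B_scalar (2*n + 1) n (uvar 1), \<zero>\<^bsub>?BA\<^esub>) \<in> Bbar_rels (2*n + 1) n"
      by (simp add: Bbar_rels_def)
    from cls_eqI[OF ring_B0 Bbar_carrier this] show ?thesis
      using ring_hom_zero[OF bh ring_B0] ring_B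
      by (simp add: p_def B_scalar_def Bbar_def free_alg_simps(3))
  qed

  interpret P: os_quotient ?B n p
  proof
    fix f g assume "(f, g) \<in> B_rels (2*n + 1) n"
    then show "p f = p g"
      unfolding p_def by (rule arg_cong[OF cls_eqI[OF F.is_ring B_rels_carrier]])
  qed (use p_hom p_surj p_u1 in auto)

  \<comment> \<open>The mapping property of the strand algebra yields \<open>\<psi>\<close>, in two stages since \<open>calA\<close> is an iterated quotient.\<close>
  obtain \<psi>0 where \<psi>0: "\<psi>0 \<in> ring_hom (A_alg n) ?B" "\<And>a. a \<in> carrier ?S \<Longrightarrow> \<psi>0 (A_cls n a) = P.rep a"
    using quot_by_factor[OF S.is_ring A_rels_carrier ring_B P.rep_hom P.rep_A_rels]
    unfolding A_alg_def A_cls_def by blast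
  have "\<psi>0 a = \<psi>0 b" if "(a, b) \<in> calA_rels n" for a b
  proof -
    obtain i where i: "i \<in> {2..2*n-1}" and b: "b = \<zero>\<^bsub>A_alg n\<^esub>" and
      a: "a = A_cls n (Rgen n i) \<otimes>\<^bsub>A_alg n\<^esub> A_cls n (Rgen n (i - 1)) \<or>
          a = A_cls n (Lgen n (i - 1)) \<otimes>\<^bsub>A_alg n\<^esub> A_cls n (Lgen n i)"
      using \<open>(a, b) \<in> calA_rels n\<close> unfolding calA_rels_def by blast
    have r: "i \<in> {1..<2*n}" "i - 1 \<in> {1..<2*n}" using range[OF i] by auto
    have "\<psi>0 a = \<zero>\<^bsub>?B\<^esub>"
      using a P.rep_calA_rels[OF i] ring_hom_mult[OF \<psi>0(1)] gA[OF r(1)] gA[OF r(2)]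
        gen_carrier(1,2)[OF r(1)] gen_carrier(1,2)[OF r(2)] by (auto simp: \<psi>0(2))
    then show ?thesis
      unfolding b using ring_hom_zero[OF \<psi>0(1) ring_A ring_B] by simp
  qed
  then obtain \<psi> where \<psi>: "\<psi> \<in> ring_hom ?C ?B" "\<And>a. a \<in> carrier (A_alg n) \<Longrightarrow>
      \<psi> (cls (A_alg n) (calA_rels n) a) = \<psi>0 a"
    using quot_by_factor[OF ring_A calA_carrier ring_B \<psi>0(1)] unfolding calA_def by blast
  have \<psi>_q: "\<psi> (q a) = P.rep a" if "a \<in> carrier ?S" for a
    using \<psi>(2)[OF ring_hom_closed[OF hA that]] \<psi>0(2)[OF that] by (simp add: q_def)

  \<comment> \<open>The universal property of the free algebra yields the map \<open>\<chi>\<close> in the opposite direction.\<close>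
  have "(\<lambda>g. q (Q.val g)) \<in> gens (2*n + 1) n \<rightarrow> carrier ?C"
    using Q.val_carrier ring_hom_closed[OF q_hom] by blast
  then obtain h where h: "h \<in> ring_hom ?F ?C"
    "\<And>c. c \<in> Upoly (2*n + 1) \<Longrightarrow> h (smul c \<one>\<^bsub>?F\<^esub>) = Q.sc c"
    "\<And>g. g \<in> gens (2*n + 1) n \<Longrightarrow> h (basis [g]) = q (Q.val g)"
    using Q.free_lift by blast
  obtain \<chi>0 where \<chi>0: "\<chi>0 \<in> ring_hom ?BA ?C" "\<And>f. f \<in> carrier ?F \<Longrightarrow> \<chi>0 (?Bcls f) = h f"
    using quot_by_factor[OF F.is_ring B_rels_carrier ring_C h(1) Q.h_rels[OF h]]
    unfolding B_alg_def by blast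
  have "\<chi>0 a = \<chi>0 b" if "(a, b) \<in> Bbar_rels (2*n + 1) n" for a b
  proof -
    have ab: "a = ?Bcls (smul (uvar 1) \<one>\<^bsub>?F\<^esub>)" "b = \<zero>\<^bsub>?BA\<^esub>"
      using that by (auto simp: Bbar_rels_def B_scalar_def)
    have "\<chi>0 a = Q.sc (uvar 1)"
      unfolding ab \<chi>0(2)[OF u1] by (rule h(2)) (simp add: Upoly_uvar)
    also have "\<dots> = \<zero>\<^bsub>?C\<^esub>"
      by (simp add: Q.sc_def lower_vars_def subst_uvar q_zero)
    finally show ?thesis
      unfolding ab(2) using ring_hom_zero[OF \<chi>0(1) ring_B0 ring_C] by simp
  qed
  then obtain \<chi> where \<chi>: "\<chi> \<in> ring_hom ?B ?C" "\<And>a. a \<in> carrier ?BA \<Longrightarrow>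
      \<chi> (cls ?BA (Bbar_rels (2*n + 1) n) a) = \<chi>0 a"
    using quot_by_factor[OF ring_B0 Bbar_carrier ring_C \<chi>0(1)] unfolding Bbar_def by blast
  have \<chi>_p: "\<chi> (p f) = h f" if "f \<in> carrier ?F" for f
    using \<chi>(2)[OF ring_hom_closed[OF hB that]] \<chi>0(2)[OF that] by (simp add: p_def)

  have scalar_F: "smul c \<one>\<^bsub>?F\<^esub> \<in> carrier ?F" if "c \<in> Upoly (2*n + 1)" for c
    unfolding F.carrier_eq using that by (intro fmod_smul F.one_fmod)
  have scalar_S: "smul c \<one>\<^bsub>?S\<^esub> \<in> carrier ?S" if "c \<in> Upoly (2*n)" for c
    unfolding S.carrier_eq using that by (intro fmod_smul S.one_fmod)
  have word: "basis [g] \<in> carrier ?F" if "g \<in> gens (2*n + 1) n" for g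
    unfolding F.carrier_eq using that by (intro fmod_basis) simp
  have gen: "GI x \<in> gens (2*n + 1) n" "i \<in> {1..<2*n} \<Longrightarrow> GR (Suc i) \<in> gens (2*n + 1) n"
    "i \<in> {1..<2*n} \<Longrightarrow> GL (Suc i) \<in> gens (2*n + 1) n" if "x \<in> nsubsets n" for x i
    using P.gens_mem that by auto

  have \<chi>_\<psi>: "\<chi> (\<psi> c) = c" if c: "c \<in> carrier ?C" for c
  proof -
    obtain a where a: "a \<in> carrier ?S" "c = q a" using q_surj[OF c] by blast
    have "\<chi> (P.rep a) = q a"
    proof (rule strand_hom_eqI[OF ring_C _ q_hom _ _ _ a(1), of "\<lambda>a. \<chi> (P.rep a)"])
      show "(\<lambda>a. \<chi> (P.rep a)) \<in> ring_hom ?S ?C"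
        using ring_hom_trans[OF P.rep_hom \<chi>(1)] by (simp add: comp_def)
    next
      fix c assume c: "c \<in> Upoly (2*n)"
      have "\<chi> (P.rep (smul c \<one>\<^bsub>?S\<^esub>)) = \<chi> (p (smul (raise_vars c) \<one>\<^bsub>?F\<^esub>))"
        using P.rep_scalar[OF c] by (simp add: P.sc_def free_alg_simps(3))
      also have "\<dots> = Q.sc (raise_vars c)"
        using \<chi>_p[OF scalar_F[OF raise_vars_Upoly[OF c]]] h(2)[OF raise_vars_Upoly[OF c]] by simp
      also have "\<dots> = q (smul c \<one>\<^bsub>?S\<^esub>)" by (simp add: Q.sc_def lower_raise[OF c])
      finally show "\<chi> (P.rep (smul c \<one>\<^bsub>?S\<^esub>)) = q (smul c \<one>\<^bsub>?S\<^esub>)" .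
    next
      have J: "\<chi> (P.J S) = q (iota S)" if S: "S \<in> nsubsets n" for S
      proof -
        have g: "GI (holes n S) \<in> gens (2*n + 1) n" using gen(1)[OF holes_nsubsets[OF S]] .
        show ?thesis
          using \<chi>_p[OF word[OF g]] h(3)[OF g] holes_holes[OF S] by (simp add: P.J_def P.I_def)
      qed
      fix S assume S: "S \<in> nsubsets n"
      show "\<chi> (P.rep (iota S)) = q (iota S)"
        using P.rep_iota[OF S] J[OF S] by simp
      fix i assume i: "i \<in> {1..<2*n}" and m: "movable i S"
      have R: "\<chi> (P.R (Suc i)) = q (Lgen n i)" "\<chi> (P.L (Suc i)) = q (Rgen n i)"
        using \<chi>_p[OF word] h(3) gen(2,3)[OF S i] by (simp_all add: P.R_def P.L_def)
      have closed: "P.R (Suc i) \<in> carrier ?B" "P.L (Suc i) \<in> carrier ?B" "P.J S \<in> carrier ?B"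
        using P.gen_closed i P.J_closed S by auto
      have "\<chi> (P.rep (el n S (hop i S))) = \<chi> (P.J S \<otimes>\<^bsub>?B\<^esub> P.G i)"
        using P.rep_el[OF S hop_nsubsets[OF S i]] P.E_hop[OF S i m] by simp
      also have "\<dots> = q (iota S) \<otimes>\<^bsub>?C\<^esub> (q (Lgen n i) \<oplus>\<^bsub>?C\<^esub> q (Rgen n i))"
        using ring_hom_mult[OF \<chi>(1) closed(3) P.G_closed[OF i]] ring_hom_add[OF \<chi>(1) closed(1,2)]
        by (simp only: P.G_def J[OF S] R)
      also have "\<dots> = q (iota S) \<otimes>\<^bsub>?C\<^esub> q (Lgen n i) \<oplus>\<^bsub>?C\<^esub> q (iota S) \<otimes>\<^bsub>?C\<^esub> q (Rgen n i)"
        using gen_carrier(3)[OF S] gen_carrier(1,2)[OF i] ring_hom_closed[OF q_hom] by (intro C.r_distr) auto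
      also have "\<dots> = q (strand_mult n (iota S) (Lgen n i)) \<oplus>\<^bsub>?C\<^esub> q (strand_mult n (iota S) (Rgen n i))"
        using gen_carrier(3)[OF S] gen_carrier(1,2)[OF i] by (simp add: Q.q_mult)
      also have "\<dots> = q (el n S (hop i S))"
      proof -
        have "q (el n S (hop i S)) \<in> carrier ?C"
          using el_fmod[OF S hop_nsubsets[OF S i], of "2*n"] ring_hom_closed[OF q_hom]
          by (simp add: strand_carrier)
        then show ?thesis
          using m unfolding iota_Lgen[OF S i] iota_Rgen[OF S i] movable_def by (auto simp: q_zero)
      qed
      finally show "\<chi> (P.rep (el n S (hop i S))) = q (el n S (hop i S))" .
    qed
    then show ?thesis using \<psi>_q[OF a(1)] a(2) by simp
  qed

  \<comment> \<open>On scalars the composite lowers and raises the indices of the variables; only \<open>u\<^sub>1\<close> is lost.\<close>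
  have \<psi>_\<chi>: "\<psi> (\<chi> b) = b" if b: "b \<in> carrier ?B" for b
  proof -
    obtain f where f: "f \<in> carrier ?F" "b = p f" using p_surj[OF b] by blast
    have "\<psi> (h f) = p f"
    proof (rule free_hom_eqI[OF ring_B _ p_hom _ _ f(1), of "\<lambda>f. \<psi> (h f)"])
      show "(\<lambda>f. \<psi> (h f)) \<in> ring_hom ?F ?B"
        using ring_hom_trans[OF h(1) \<psi>(1)] by (simp add: comp_def)
    next
      fix c assume c: "c \<in> Upoly (2*n + 1)"
      have lc: "lower_vars c \<in> Upoly (2*n)" by (rule lower_vars_Upoly[OF c])
      have "\<psi> (h (smul c \<one>\<^bsub>?F\<^esub>)) = P.rep (smul (lower_vars c) \<one>\<^bsub>?S\<^esub>)"
        using h(2)[OF c] \<psi>_q[OF scalar_S[OF lc]] by (simp add: Q.sc_def)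
      also have "\<dots> = P.sc (lower_vars c)" by (rule P.rep_scalar[OF lc])
      also have "\<dots> = p (smul c (basis []))"
      proof (rule coeff_hom_eqI[OF _ P.free_scalar_hom _ _ c])
        show "(\<lambda>c. P.sc (lower_vars c)) \<in> ring_hom (coeff_ring (2*n + 1)) ?B"
          using ring_hom_trans[OF lower_vars_hom P.scalar_hom] by (simp add: comp_def)
        show "P.sc (lower_vars (Poly_Mapping.single 0 r)) = p (smul (Poly_Mapping.single 0 r) (basis []))" for r
          by (simp add: P.sc_def lower_vars_def raise_vars_def subst_const)
        show "P.sc (lower_vars (uvar i)) = p (smul (uvar i) (basis []))" if "i \<in> {1..2*n + 1}" for i
        proof (cases "i = 1")
          case True
          then show ?thesis using p_u1 P.q_zero by (simp add: P.sc_def lower_vars_def raise_vars_def subst_uvar subst_zero)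
        next
          case False
          then show ?thesis using that by (simp add: P.sc_def lower_vars_def raise_vars_def subst_uvar)
        qed
      qed
      finally show "\<psi> (h (smul c \<one>\<^bsub>?F\<^esub>)) = p (smul c \<one>\<^bsub>?F\<^esub>)"
        by (simp add: free_alg_simps(3))
    next
      fix g assume g: "g \<in> gens (2*n + 1) n"
      have "\<psi> (h (basis [g])) = P.rep (Q.val g)"
        using h(3)[OF g] \<psi>_q[OF Q.val_carrier[OF g]] by simp
      also have "\<dots> = p (basis [g])"
      proof (cases g)
        case (GI x)
        then have x: "x \<in> nsubsets n" using g by (auto simp: gens_def local_states_Suc)
        then show ?thesis
          using P.rep_iota[OF holes_nsubsets[OF x]] GI holes_holes[OF x] by (simp add: P.J_def P.I_def)
      next
        case (GR i)
        then obtain j where j: "i = Suc j" "j \<in> {1..<2*n}"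
          using g by (cases i) (auto simp: gens_def)
        then show ?thesis using P.rep_Lgen[OF j(2)] GR by (simp add: P.R_def)
      next
        case (GL i)
        then obtain j where j: "i = Suc j" "j \<in> {1..<2*n}"
          using g by (cases i) (auto simp: gens_def)
        then show ?thesis using P.rep_Rgen[OF j(2)] GL by (simp add: P.L_def)
      qed
      finally show "\<psi> (h (basis [g])) = p (basis [g])" .
    qed
    then show ?thesis using \<chi>_p[OF f(1)] f(2) by simp
  qed

  have "bij_betw \<psi> (carrier ?C) (carrier ?B)"
    by (rule bij_betw_byWitness[of _ \<chi>])
      (use \<chi>_\<psi> \<psi>_\<chi> ring_hom_closed[OF \<psi>(1)] ring_hom_closed[OF \<chi>(1)] in auto)
  then have "\<psi> \<in> ring_iso ?C ?B" using \<psi>(1) by (simp add: ring_iso_def)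
  moreover have "\<psi> (calA_scalar n (uvar i)) = Bbar_scalar (2*n + 1) n (uvar (i + 1))"
    if "i \<in> {1..2*n}" for i
  proof -
    have u: "uvar i \<in> Upoly (2*n)" using that by (rule Upoly_uvar)
    have "\<psi> (calA_scalar n (uvar i)) = P.sc (uvar i)"
      unfolding q_scalar[symmetric] \<psi>_q[OF scalar_S[OF u]] by (rule P.rep_scalar[OF u])
    also have "\<dots> = Bbar_scalar (2*n + 1) n (uvar (i + 1))"
      unfolding p_scalar[symmetric] by (simp add: P.sc_def raise_vars_def subst_uvar free_alg_simps(3))
    finally show ?thesis .
  qed
  ultimately show ?thesis by blast
qed

end
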